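(* Let $m\ge1$ be an integer, let $\Gamma_b,\Gamma_i$ be of class $C^{m+2}$, and let $\{\mathcal T_h\}_h$ be a quasi-uniform family of interface-fitted curved meshes as described in the context. There exist $h_0>0$ and a constant $C$, independent of $K$ and $h$, such that $$\|v\|_{0,\partial K}^2\le C\left(h_K^{-1}\|v\|_{0,K}^2+h_K|v|_{1,K}^2\right),\qquad v\in H^1(K),\quad K\in\mathcal T_h,\quad h\le h_0.$$
   Context: Geometry. $\Omega\subset\mathbb R^2$ is a bounded domain with smooth boundary $\Gamma_b$; $\Gamma_i\subset\Omega$ is a smooth curve separating $\Omega$ into disjoint open subdomains $\Omega^\pm$, $\Omega=\Omega^-\cup\Gamma_i\cup\Omega^+$. Each $\Gamma\in\{\Gamma_b,\Gamma_i\}$ has a regular parameterization $\mathbf g:[\xi_s,\xi_e]\to\mathbb R^2$ (depending on $\Gamma$) of class at least $C^2$. Put $\boldsymbol\tau=\mathbf g'/\|\mathbf g'\|$, $\mathbf n=Q\boldsymbol\tau$ with $Q=\begin{bmatrix}0&1\\-1&0\end{bmatrix}$, $\kappa=(\mathbf g')^TQ\mathbf g''/\|\mathbf g'\|^3$. The Frenet transformation is $P_\Gamma(\eta,\xi)=\mathbf g(\xi)+\eta\,\mathbf n(\xi)$, and $N_\Gamma(\epsilon)=P_\Gamma([-\epsilon,\epsilon]\times[\xi_s,\xi_e])$. Let $\epsilon_0>0$ be such that for $0<\epsilon\le\epsilon_0$ and both curves: $P_\Gamma$ is a bijection onto $N_\Gamma(\epsilon)$ with inverse $R_\Gamma(x,y)=(\eta(x,y),\xi(x,y))$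 (for a closed curve, modulo identification of $\xi_s$ and $\xi_e$, $\xi$ being taken as a continuous branch on each element); $\tfrac12\le1+\eta\kappa(\xi)\le2$; $|\det DP_\Gamma|,|\det DR_\Gamma|$ lie between positive constants and $\|DP_\Gamma\|,\|DR_\Gamma\|$ are bounded; and $N_{\Gamma_b}(\epsilon)\cap N_{\Gamma_i}(\epsilon)=\emptyset$. Meshes. Start from shape-regular straight-sided triangulations $\overline{\mathcal T}_h$ associated with $\Omega$. An edge fits a curve if both its endpoints lie on the curve. The mesh is interface-fitted: no element is cut by $\Gamma_i$ without having an edge fitted to $\Gamma_i$. Elements with a designated edge fitted to $\Gamma_b$ or $\Gamma_i$ are replaced by curved triangles $K$ in which that straight edge is replaced by the corresponding arc of the curve; these curved triangles form $\mathcal T_h^c$. The remaining straight triangles form $\mathcal T_h^r$, and $\mathcal T_h=\mathcal T_h^c\cup\mathcal T_h^r$. With $h_K=\operatorname{diam}K$, $h=\max_Kh_K$, and $\rho_K$ the supremum of radii of balls contained in $K$, we assume $h_K/\rho_K\le C_{\mathrm{sh}}$ uniformly. Quasi-uniform means $h\le C h_K$ for all $K\in\mathcal T_h$ uniformly. The curve $\Gamma$ associated with $K\in\mathcal T_h^c$ is the one to which its curved edge belongs; for some fixed $\epsilon\in(0,\epsilon_0]$ and all sufficiently small $h$, each $K\in\mathcal T_h^c$ lies in $N_\Gamma(\epsilon)$ of its associated curve. $\|\cdot\|_{0,K}$, $\|\cdot\|_{0,\partial K}$ are $L^2$ norms and $|\cdot|_{1,K}$ is the $H^1(K)$ seminorm.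 *)

theory Defs
  imports "HOL-Analysis.Analysis"
begin

type_synonym point = "real^2"


section \<open>Functions of class \<open>C\<^sup>k\<close>\<close>

text \<open>Continuity of all iterated directional derivatives up to order \<open>k\<close>, on an open set \<open>S\<close>.\<close>

primrec Ck_on :: "nat \<Rightarrow> 'a::euclidean_space set \<Rightarrow> ('a \<Rightarrow> 'b::real_normed_vector) \<Rightarrow> bool" where
  "Ck_on 0 S f \<longleftrightarrow> continuous_on S f"
| "Ck_on (Suc k) S f \<longleftrightarrow>
     (\<forall>x\<in>S. f differentiable (at x)) \<and> (\<forall>v. Ck_on k S (\<lambda>x. frechet_derivative f (at x) v))"

definition smooth :: "('a::euclidean_space \<Rightarrow> 'b::real_normed_vector) \<Rightarrow> bool" where
  "smooth f \<longleftrightarrow> (\<forall>k. Ck_on k UNIV f)"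


section \<open>Closed curves and the Frenet transformation\<close>

record curve =
  par :: "real \<Rightarrow> point"
  lo :: real
  hi :: real

definition curve_image :: "curve \<Rightarrow> point set" where
  "curve_image \<Gamma> = par \<Gamma> ` {lo \<Gamma>..hi \<Gamma>}"

abbreviation period :: "curve \<Rightarrow> real" where
  "period \<Gamma> \<equiv> hi \<Gamma> - lo \<Gamma>"

text \<open>
  The parameterization on \<open>[lo, hi]\<close> of a closed curve is represented by its periodic extension to
  the real line, so that being of class \<open>C\<^sup>k\<close> includes the matching of the derivatives at the seam,
  and a sub-arc passing through the seam is the image of an ordinary interval.
\<close>

definition regular_closed_curve :: "nat \<Rightarrow> curve \<Rightarrow> bool" where
  "regular_closed_curve k \<Gamma> \<longleftrightarrow>
     lo \<Gamma> < hi \<Gamma> \<and>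
     (\<forall>t. par \<Gamma> (t + period \<Gamma>) = par \<Gamma> t) \<and>
     inj_on (par \<Gamma>) {lo \<Gamma>..<hi \<Gamma>} \<and>
     Ck_on k UNIV (par \<Gamma>) \<and>
     (\<forall>t. vector_derivative (par \<Gamma>) (at t) \<noteq> 0)"

definition dpar :: "curve \<Rightarrow> real \<Rightarrow> point" where
  "dpar \<Gamma> t = vector_derivative (par \<Gamma>) (at t)"

definition ddpar :: "curve \<Rightarrow> real \<Rightarrow> point" where
  "ddpar \<Gamma> t = vector_derivative (dpar \<Gamma>) (at t)"

definition Qmat :: "real^2^2" where
  "Qmat = vector [vector [0, 1], vector [-1, 0]]"

definition tangent :: "curve \<Rightarrow> real \<Rightarrow> point" where
  "tangent \<Gamma> t = dpar \<Gamma> t /\<^sub>R norm (dpar \<Gamma> t)"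

definition normal :: "curve \<Rightarrow> real \<Rightarrow> point" where
  "normal \<Gamma> t = Qmat *v tangent \<Gamma> t"

definition curvature :: "curve \<Rightarrow> real \<Rightarrow> real" where
  "curvature \<Gamma> t = (dpar \<Gamma> t \<bullet> (Qmat *v ddpar \<Gamma> t)) / norm (dpar \<Gamma> t) ^ 3"

text \<open>The argument \<open>p\<close> is the pair \<open>(\<eta>, \<xi>)\<close>.\<close>

definition frenet :: "curve \<Rightarrow> real^2 \<Rightarrow> point" where
  "frenet \<Gamma> p = par \<Gamma> (p $ 2) + (p $ 1) *\<^sub>R normal \<Gamma> (p $ 2)"

definition frenet_nbhd :: "curve \<Rightarrow> real \<Rightarrow> point set" where
  "frenet_nbhd \<Gamma> \<epsilon> = frenet \<Gamma> ` {p. p $ 1 \<in> {-\<epsilon>..\<epsilon>} \<and> p $ 2 \<in> {lo \<Gamma>..hi \<Gamma>}}"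

text \<open>The half-open interval for \<open>\<xi>\<close> realizes the identification of the two end parameters.\<close>

definition frenet_strip :: "curve \<Rightarrow> real \<Rightarrow> (real^2) set" where
  "frenet_strip \<Gamma> \<epsilon> = {p. p $ 1 \<in> {-\<epsilon>..\<epsilon>} \<and> p $ 2 \<in> {lo \<Gamma>..<hi \<Gamma>}}"

definition frenet_inv :: "curve \<Rightarrow> real \<Rightarrow> point \<Rightarrow> real^2" where
  "frenet_inv \<Gamma> \<epsilon> = inv_into (frenet_strip \<Gamma> \<epsilon>) (frenet \<Gamma>)"

text \<open>
  The conditions on the derivative of the inverse are stated in the open strip, away from the seam,
  where \<open>frenet_inv\<close> is continuous; the branches across the seam have the same derivatives up to a
  shift of \<open>\<xi>\<close> by the period.
\<close>

definition frenet_admissible :: "curve \<Rightarrow> real \<Rightarrow> bool" where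
  "frenet_admissible \<Gamma> \<epsilon>0 \<longleftrightarrow>
     (\<exists>c>0. \<exists>C>0. \<forall>\<epsilon>. 0 < \<epsilon> \<and> \<epsilon> \<le> \<epsilon>0 \<longrightarrow>
        bij_betw (frenet \<Gamma>) (frenet_strip \<Gamma> \<epsilon>) (frenet_nbhd \<Gamma> \<epsilon>) \<and>
        (\<forall>\<eta>\<in>{-\<epsilon>..\<epsilon>}. \<forall>\<xi>\<in>{lo \<Gamma>..hi \<Gamma>}.
           1/2 \<le> 1 + \<eta> * curvature \<Gamma> \<xi> \<and> 1 + \<eta> * curvature \<Gamma> \<xi> \<le> 2) \<and>
        (\<forall>p\<in>frenet_strip \<Gamma> \<epsilon>.
           frenet \<Gamma> differentiable (at p) \<and>
           c \<le> \<bar>det (jacobian (frenet \<Gamma>) (at p))\<bar> \<and> \<bar>det (jacobian (frenet \<Gamma>) (at p))\<bar> \<le> C \<and>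
           onorm (frechet_derivative (frenet \<Gamma>) (at p)) \<le> C) \<and>
        (\<forall>x \<in> frenet \<Gamma> ` {p. p $ 1 \<in> {-\<epsilon><..<\<epsilon>} \<and> p $ 2 \<in> {lo \<Gamma><..<hi \<Gamma>}}.
           frenet_inv \<Gamma> \<epsilon> differentiable (at x) \<and>
           c \<le> \<bar>det (jacobian (frenet_inv \<Gamma> \<epsilon>) (at x))\<bar> \<and>
           \<bar>det (jacobian (frenet_inv \<Gamma> \<epsilon>) (at x))\<bar> \<le> C \<and>
           onorm (frechet_derivative (frenet_inv \<Gamma> \<epsilon>) (at x)) \<le> C))"


section \<open>The domain and the interface\<close>

definition planar_domain :: "point set \<Rightarrow> bool" where
  "planar_domain \<Omega> \<longleftrightarrow> open \<Omega> \<and> connected \<Omega> \<and> \<Omega> \<noteq> {}"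

definition interface_geometry ::
  "nat \<Rightarrow> point set \<Rightarrow> point set \<Rightarrow> point set \<Rightarrow> curve \<Rightarrow> curve \<Rightarrow> real \<Rightarrow> bool" where
  "interface_geometry k \<Omega> \<Omega>m \<Omega>p \<Gamma>b \<Gamma>i \<epsilon>0 \<longleftrightarrow>
     planar_domain \<Omega> \<and> bounded \<Omega> \<and> frontier \<Omega> = curve_image \<Gamma>b \<and>
     planar_domain \<Omega>m \<and> planar_domain \<Omega>p \<and>
     \<Omega> = \<Omega>m \<union> curve_image \<Gamma>i \<union> \<Omega>p \<and>
     \<Omega>m \<inter> \<Omega>p = {} \<and> \<Omega>m \<inter> curve_image \<Gamma>i = {} \<and> \<Omega>p \<inter> curve_image \<Gamma>i = {} \<and>
     regular_closed_curve k \<Gamma>b \<and> regular_closed_curve k \<Gamma>i \<and>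
     0 < \<epsilon>0 \<and> frenet_admissible \<Gamma>b \<epsilon>0 \<and> frenet_admissible \<Gamma>i \<epsilon>0 \<and>
     (\<forall>\<epsilon>. 0 < \<epsilon> \<and> \<epsilon> \<le> \<epsilon>0 \<longrightarrow> frenet_nbhd \<Gamma>b \<epsilon> \<inter> frenet_nbhd \<Gamma>i \<epsilon> = {})"


section \<open>Curved elements\<close>

text \<open>
  \<open>Curved \<Gamma> \<alpha> \<beta> c\<close> is the triangle with vertices \<open>par \<Gamma> \<alpha>\<close>, \<open>par \<Gamma> \<beta>\<close>, \<open>c\<close> whose designated edge,
  joining the first two vertices, is replaced by the arc \<open>par \<Gamma> ` {\<alpha>..\<beta>}\<close>.
\<close>

datatype element =
    Straight point point point
  | Curved curve real real point

fun vertices :: "element \<Rightarrow> point set" where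
  "vertices (Straight p q r) = {p, q, r}"
| "vertices (Curved \<Gamma> \<alpha> \<beta> c) = {par \<Gamma> \<alpha>, par \<Gamma> \<beta>, c}"

text \<open>The underlying straight triangle.\<close>

definition straight_triangle :: "element \<Rightarrow> point set" where
  "straight_triangle K = convex hull (vertices K)"

definition arc_path :: "curve \<Rightarrow> real \<Rightarrow> real \<Rightarrow> real \<Rightarrow> point" where
  "arc_path \<Gamma> \<alpha> \<beta> t = par \<Gamma> (\<alpha> + t * (\<beta> - \<alpha>))"

fun edge_paths :: "element \<Rightarrow> (real \<Rightarrow> point) list" where
  "edge_paths (Straight p q r) = [linepath p q, linepath q r, linepath r p]"
| "edge_paths (Curved \<Gamma> \<alpha> \<beta> c) =
     [arc_path \<Gamma> \<alpha> \<beta>, linepath (par \<Gamma> \<beta>) c, linepath c (par \<Gamma> \<alpha>)]"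

definition element_boundary :: "element \<Rightarrow> point set" where
  "element_boundary K = (\<Union>\<gamma>\<in>set (edge_paths K). path_image \<gamma>)"

text \<open>The closed point set occupied by an element.\<close>

definition region :: "element \<Rightarrow> point set" where
  "region K = element_boundary K \<union> inside (element_boundary K)"

fun is_element :: "element \<Rightarrow> bool" where
  "is_element (Straight p q r) \<longleftrightarrow> \<not> collinear {p, q, r}"
| "is_element (Curved \<Gamma> \<alpha> \<beta> c) \<longleftrightarrow>
     \<not> collinear {par \<Gamma> \<alpha>, par \<Gamma> \<beta>, c} \<and> \<alpha> < \<beta> \<and> \<beta> < \<alpha> + period \<Gamma> \<and>
     simple_path (arc_path \<Gamma> \<alpha> \<beta> +++ linepath (par \<Gamma> \<beta>) c +++ linepath c (par \<Gamma> \<alpha>))"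

definition inradius :: "point set \<Rightarrow> real" where
  "inradius S = Sup {r. 0 < r \<and> (\<exists>x. ball x r \<subseteq> S)}"


section \<open>Interface-fitted curved meshes\<close>

definition fits :: "curve \<Rightarrow> point \<Rightarrow> point \<Rightarrow> bool" where
  "fits \<Gamma> p q \<longleftrightarrow> p \<in> curve_image \<Gamma> \<and> q \<in> curve_image \<Gamma>"

text \<open>
  A mesh is the finite set of its elements. The underlying straight triangles form a conforming
  triangulation with vertices in the closed domain, whose boundary edges (those of a single triangle)
  fit the outer boundary; the curved elements tile the domain exactly.
\<close>

definition curved_mesh :: "point set \<Rightarrow> curve \<Rightarrow> curve \<Rightarrow> element set \<Rightarrow> bool" where
  "curved_mesh \<Omega> \<Gamma>b \<Gamma>i T \<longleftrightarrow>
     finite T \<and> T \<noteq> {} \<and> (\<forall>K\<in>T. is_element K) \<and>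
     (\<forall>\<Gamma> \<alpha> \<beta> c. Curved \<Gamma> \<alpha> \<beta> c \<in> T \<longrightarrow> \<Gamma> = \<Gamma>b \<or> \<Gamma> = \<Gamma>i) \<and>
     (\<forall>K\<in>T. vertices K \<subseteq> closure \<Omega>) \<and>
     (\<forall>K\<in>T. \<forall>K'\<in>T. K \<noteq> K' \<longrightarrow>
        vertices K \<noteq> vertices K' \<and>
        straight_triangle K \<inter> straight_triangle K' = convex hull (vertices K \<inter> vertices K')) \<and>
     (\<forall>K\<in>T. \<forall>p\<in>vertices K. \<forall>q\<in>vertices K.
        p \<noteq> q \<and> (\<forall>K'\<in>T. {p, q} \<subseteq> vertices K' \<longrightarrow> K' = K) \<longrightarrow> fits \<Gamma>b p q) \<and>
     (\<Union>K\<in>T. region K) = closure \<Omega> \<and>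
     (\<forall>K\<in>T. \<forall>K'\<in>T. K \<noteq> K' \<longrightarrow> interior (region K) \<inter> interior (region K') = {})"

definition interface_fitted :: "curve \<Rightarrow> element set \<Rightarrow> bool" where
  "interface_fitted \<Gamma>i T \<longleftrightarrow>
     (\<forall>K\<in>T. curve_image \<Gamma>i \<inter> interior (straight_triangle K) \<noteq> {} \<longrightarrow>
        (\<exists>p\<in>vertices K. \<exists>q\<in>vertices K. p \<noteq> q \<and> fits \<Gamma>i p q))"

definition h_el :: "element \<Rightarrow> real" where
  "h_el K = diameter (region K)"

definition h_mesh :: "element set \<Rightarrow> real" where
  "h_mesh T = Max (h_el ` T)"

definition shape_regular :: "element set set \<Rightarrow> bool" where
  "shape_regular \<T> \<longleftrightarrow>
     (\<exists>Csh. \<forall>T\<in>\<T>. \<forall>K\<in>T.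
        diameter (straight_triangle K) / inradius (straight_triangle K) \<le> Csh \<and>
        h_el K / inradius (region K) \<le> Csh)"

definition quasi_uniform :: "element set set \<Rightarrow> bool" where
  "quasi_uniform \<T> \<longleftrightarrow> (\<exists>C. \<forall>T\<in>\<T>. \<forall>K\<in>T. h_mesh T \<le> C * h_el K)"

definition eventually_in_frenet_nbhd :: "real \<Rightarrow> element set set \<Rightarrow> bool" where
  "eventually_in_frenet_nbhd \<epsilon>0 \<T> \<longleftrightarrow>
     (\<exists>\<epsilon>. 0 < \<epsilon> \<and> \<epsilon> \<le> \<epsilon>0 \<and>
        (\<exists>h1>0. \<forall>T\<in>\<T>. h_mesh T \<le> h1 \<longrightarrow>
           (\<forall>\<Gamma> \<alpha> \<beta> c. Curved \<Gamma> \<alpha> \<beta> c \<in> T \<longrightarrow>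
              region (Curved \<Gamma> \<alpha> \<beta> c) \<subseteq> frenet_nbhd \<Gamma> \<epsilon>)))"

definition quasi_uniform_curved_family ::
  "point set \<Rightarrow> curve \<Rightarrow> curve \<Rightarrow> real \<Rightarrow> element set set \<Rightarrow> bool" where
  "quasi_uniform_curved_family \<Omega> \<Gamma>b \<Gamma>i \<epsilon>0 \<T> \<longleftrightarrow>
     (\<forall>T\<in>\<T>. curved_mesh \<Omega> \<Gamma>b \<Gamma>i T \<and> interface_fitted \<Gamma>i T) \<and>
     shape_regular \<T> \<and> quasi_uniform \<T> \<and> eventually_in_frenet_nbhd \<epsilon>0 \<T>"


section \<open>Sobolev functions and traces on elements\<close>

definition L2_on :: "point set \<Rightarrow> (point \<Rightarrow> 'b::euclidean_space) \<Rightarrow> bool" where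
  "L2_on U f \<longleftrightarrow>
     f \<in> borel_measurable (lebesgue_on U) \<and> integrable (lebesgue_on U) (\<lambda>x. (norm (f x))\<^sup>2)"

definition L2_norm_on :: "point set \<Rightarrow> (point \<Rightarrow> 'b::euclidean_space) \<Rightarrow> real" where
  "L2_norm_on U f = sqrt (LINT x|lebesgue_on U. (norm (f x))\<^sup>2)"

definition grad :: "(point \<Rightarrow> real) \<Rightarrow> point \<Rightarrow> real^2" where
  "grad \<phi> x = (\<chi> i. frechet_derivative \<phi> (at x) (axis i 1))"

definition test_function :: "point set \<Rightarrow> (point \<Rightarrow> real) \<Rightarrow> bool" where
  "test_function U \<phi> \<longleftrightarrow>
     smooth \<phi> \<and> compact (closure {x. \<phi> x \<noteq> 0}) \<and> closure {x. \<phi> x \<noteq> 0} \<subseteq> U"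

definition is_weak_grad :: "point set \<Rightarrow> (point \<Rightarrow> real) \<Rightarrow> (point \<Rightarrow> real^2) \<Rightarrow> bool" where
  "is_weak_grad U v G \<longleftrightarrow>
     (\<forall>\<phi> i. test_function U \<phi> \<longrightarrow>
        (LINT x|lebesgue_on U. v x * grad \<phi> x $ i) = - (LINT x|lebesgue_on U. G x $ i * \<phi> x))"

definition H1_on :: "point set \<Rightarrow> (point \<Rightarrow> real) set" where
  "H1_on U = {v. L2_on U v \<and> (\<exists>G. L2_on U G \<and> is_weak_grad U v G)}"

definition weak_grad :: "point set \<Rightarrow> (point \<Rightarrow> real) \<Rightarrow> point \<Rightarrow> real^2" where
  "weak_grad U v = (SOME G. L2_on U G \<and> is_weak_grad U v G)"

definition H1_seminorm_on :: "point set \<Rightarrow> (point \<Rightarrow> real) \<Rightarrow> real" where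
  "H1_seminorm_on U v = L2_norm_on U (weak_grad U v)"

abbreviation "elem_int K \<equiv> interior (region K)"

text \<open>The boundary integrals are with respect to arc length along the edges.\<close>

definition L2_bdry :: "element \<Rightarrow> (point \<Rightarrow> real) \<Rightarrow> bool" where
  "L2_bdry K w \<longleftrightarrow>
     (\<forall>\<gamma>\<in>set (edge_paths K).
        (\<lambda>t. w (\<gamma> t)) \<in> borel_measurable (lebesgue_on {0..1}) \<and>
        integrable (lebesgue_on {0..1}) (\<lambda>t. (w (\<gamma> t))\<^sup>2 * norm (vector_derivative \<gamma> (at t))))"

definition L2_norm_bdry :: "element \<Rightarrow> (point \<Rightarrow> real) \<Rightarrow> real" where
  "L2_norm_bdry K w =
     sqrt (\<Sum>\<gamma>\<leftarrow>edge_paths K.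
       LINT t|lebesgue_on {0..1}. (w (\<gamma> t))\<^sup>2 * norm (vector_derivative \<gamma> (at t)))"

text \<open>
  The trace is the extension by continuity, from functions smooth up to the boundary to
  \<open>H\<^sup>1\<close>, of the restriction to the boundary; it is determined up to null sets of the boundary.
\<close>

definition has_trace :: "element \<Rightarrow> (point \<Rightarrow> real) \<Rightarrow> (point \<Rightarrow> real) \<Rightarrow> bool" where
  "has_trace K v w \<longleftrightarrow>
     L2_bdry K w \<and>
     (\<exists>\<phi>::nat \<Rightarrow> point \<Rightarrow> real.
        (\<forall>n. smooth (\<phi> n)) \<and>
        (\<lambda>n. L2_norm_on (elem_int K) (\<lambda>x. \<phi> n x - v x)) \<longlonglongrightarrow> 0 \<and>
        (\<lambda>n. L2_norm_on (elem_int K) (\<lambda>x. grad (\<phi> n) x - weak_grad (elem_int K) v x)) \<longlonglongrightarrow> 0 \<and>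
        (\<lambda>n. L2_norm_bdry K (\<lambda>x. \<phi> n x - w x)) \<longlonglongrightarrow> 0)"

definition trace_of :: "element \<Rightarrow> (point \<Rightarrow> real) \<Rightarrow> point \<Rightarrow> real" where
  "trace_of K v = (SOME w. has_trace K v w)"

end

theory Submission
  imports Defs
begin

text \<open>
  On a fine mesh every element is a triangle whose edges are \<open>C\<^sup>1\<close>-close to straight, since the arcs
  are short. The straight triangle contains a ball of radius \<open>\<rho> \<sim> h\<close>, and every point \<open>y\<close> of the
  ball with half that radius sees each edge \<open>\<gamma>\<close> from the inner side:
  \<open>\<gamma>' \<times> (y - \<gamma>)\<close> keeps its sign and is at least a multiple of \<open>h |\<gamma>'|\<close>. Hence each ray from \<open>y\<close>
  meets the boundary once, and the element is star-shaped with respect to the ball.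

  For smooth \<open>\<phi>\<close> and the centre \<open>x\<^sub>0\<close> of the ball, integrate
  \<open>d/dr (r\<^sup>2 \<phi>(x\<^sub>0 + r (\<gamma>(t) - x\<^sub>0))\<^sup>2)\<close> over \<open>0 \<le> r \<le> 1\<close> and then over \<open>t\<close>: the map
  \<open>(t, r) \<mapsto> x\<^sub>0 + r (\<gamma>(t) - x\<^sub>0)\<close> is injective with Jacobian comparable to \<open>r h |\<gamma>'|\<close>, which
  gives the inequality with a uniform constant. For \<open>v \<in> H\<^sup>1\<close>, contracting towards \<open>x\<^sub>0\<close> and then
  mollifying approximates \<open>v\<close> by functions smooth on the whole plane; by the inequality their
  restrictions to the boundary form a Cauchy sequence, whose limit is the trace.
\<close>

text \<open>Star-shapedness is wanted about a whole ball and not just about its centre: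
  \<open>has_trace\<close> asks for approximants smooth on the entire plane, and the contraction
  towards the centre by a factor \<open>l\<close> opens a margin of size
  \<open>(1 - l) * r / 2\<close> around each contracted point because every point of the ball sees
  the whole boundary. That margin is what the mollifier uses up. The trace inequality itself is
  proved from the centre alone. Visibility of an edge is the sign of a cross product, so no angle is
  ever defined; an inverse height \<kappa> records how well the edge is seen. The product
  \<open>\<kappa> * h_el K\<close> is scale invariant, and it is the one number through which the
  shape of an element enters the constant. The weight r^2 in the radial integral removes the value
  at the centre and supplies the factor r of the Jacobian. The weak gradient and the trace are both
  picked by \<open>SOME\<close>, so the existence of a trace is a separate claim and the inequality
  is proved for every admissible trace.\<close>

definition cross2 :: "real^2 \<Rightarrow> real^2 \<Rightarrow> real" where
  "cross2 u w = u$1 * w$2 - u$2 * w$1"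

lemma cross2_add_left: "cross2 (u + v) w = cross2 u w + cross2 v w"
  and cross2_add_right: "cross2 w (u + v) = cross2 w u + cross2 w v"
  and cross2_diff_left: "cross2 (u - v) w = cross2 u w - cross2 v w"
  and cross2_diff_right: "cross2 w (u - v) = cross2 w u - cross2 w v"
  and cross2_scaleR_left: "cross2 (r *\<^sub>R u) w = r * cross2 u w"
  and cross2_scaleR_right: "cross2 w (r *\<^sub>R u) = r * cross2 w u"
  and cross2_self: "cross2 u u = 0"
  and cross2_swap: "cross2 u w = - cross2 w u"
  by (simp_all add: cross2_def algebra_simps)

lemmas cross2_simps = cross2_add_left cross2_add_right cross2_diff_left cross2_diff_right
  cross2_scaleR_left cross2_scaleR_right cross2_self

lemma cross2_inner_lagrange: "(cross2 u w)\<^sup>2 + (u \<bullet> w)\<^sup>2 = (norm u)\<^sup>2 * (norm w)\<^sup>2"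
  unfolding power2_norm_eq_inner inner_vec_def sum_2 cross2_def inner_real_def by algebra

lemma abs_cross2_le: "\<bar>cross2 u w\<bar> \<le> norm u * norm w"
proof -
  note cross2_inner_lagrange[of u w]
  then have "(cross2 u w)\<^sup>2 \<le> (norm u * norm w)\<^sup>2"
    by (simp add: power_mult_distrib) (metis le_add_same_cancel1 zero_le_power2)
  then show ?thesis by (metis abs_le_square_iff abs_of_nonneg mult_nonneg_nonneg norm_ge_zero)
qed

lemma has_real_derivative_cross2_right:
  assumes "(f has_vector_derivative f') F"
  shows "((\<lambda>t. cross2 u (f t)) has_real_derivative cross2 u f') F"
proof -
  have "bounded_linear (cross2 u)"
    by (rule bounded_linear_intro[where K="norm u"])
      (use abs_cross2_le[of u] in \<open>simp_all add: cross2_simps mult.commute\<close>)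
  from bounded_linear.has_vector_derivative[OF this assms]
  show ?thesis by (simp add: has_real_derivative_iff_has_vector_derivative)
qed

section \<open>Regions star-shaped about a point\<close>

text \<open>With an empty inside the complement would be the outside, which is connected for a
  bounded set in dimension at least two; Jordan-Brouwer separation forbids this.\<close>

lemma inside_nonempty_sphere_image:
  fixes S :: "'a::euclidean_space set"
  assumes "S homeomorphic sphere (a::'a) r" "0 < r" "2 \<le> DIM('a)"
  shows "inside S \<noteq> {}"
proof
  assume "inside S = {}"
  then have "- S = outside S"
    using union_with_inside[of S] by (metis outside_inside sup_bot.right_neutral)
  moreover have "bounded S"
    using assms(1) by (meson compact_imp_bounded compact_sphere homeomorphic_compactness)
  ultimately have "connected (- S)"
    using connected_outside assms(3) by metis
  with Jordan_Brouwer_separation[OF assms(1,2)] show False by blast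
qed

text \<open>By \<open>single\<close>, a ray from y meets S at most once. A point x \<noteq> y inside
  S must meet S further out on its ray, so it lies before the hit; conversely the segment before a
  hit avoids S and stays in the component of y. Hence the inside is the union of these half-open
  segments, and a step beyond a hit leaves it.\<close>

lemma inside_radial:
  fixes S :: "'a::euclidean_space set"
  assumes S: "S homeomorphic sphere (a::'a) r" "0 < r" "2 \<le> DIM('a)"
    and y: "y \<notin> S"
    and single: "\<And>p q s. p \<in> S \<Longrightarrow> q \<in> S \<Longrightarrow> 0 < s \<Longrightarrow> q - y = s *\<^sub>R (p - y) \<Longrightarrow> p = q"
  shows "inside S = {y + r *\<^sub>R (p - y) | p r. p \<in> S \<and> 0 \<le> r \<and> r < 1}"
    and "interior (S \<union> inside S) = inside S"
proof -
  have "compact S"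
    using S(1) by (meson compact_sphere homeomorphic_compactness)
  then have clo: "closed S" and bou: "bounded S" by (auto simp: compact_eq_bounded_closed)
  \<comment> \<open>The outward ray from x is connected and unbounded, so it cannot stay in the
    bounded component of x.\<close>
  have hit: "\<exists>p r. p \<in> S \<and> 0 \<le> r \<and> r < 1 \<and> x = y + r *\<^sub>R (p - y)"
    if x: "x \<in> inside S" "x \<noteq> y" for x
  proof -
    define R where "R = (\<lambda>s. y + s *\<^sub>R (x - y)) ` {1..}"
    have "R \<inter> S \<noteq> {}"
    proof
      assume "R \<inter> S = {}"
      moreover have "connected R" unfolding R_def
        by (intro connected_continuous_image continuous_intros) simp
      moreover have "x \<in> R" unfolding R_def by (rule image_eqI[of _ _ 1]) auto
      ultimately have "R \<subseteq> connected_component_set (- S) x"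
        by (intro connected_component_maximal) auto
      moreover have "bounded (connected_component_set (- S) x)"
        using x(1) by (simp add: inside_def)
      ultimately have "bounded R" by (rule bounded_subset[rotated])
      then obtain B where B: "\<And>z. z \<in> R \<Longrightarrow> norm z \<le> B" by (auto simp: bounded_iff)
      \<comment> \<open>Makes the displacement from y as long as
        \<open>norm (x - y) + \<bar>B\<bar> + norm y\<close>, too long for a set bounded by
        B.\<close>
      define s where "s = (norm (x - y) + \<bar>B\<bar> + norm y) / norm (x - y)"
      have pos: "norm (x - y) > 0" using x by simp
      have "s \<ge> 1" unfolding s_def le_divide_eq_1_pos[OF pos] by simp
      then have "norm (y + s *\<^sub>R (x - y)) \<le> B" by (intro B) (auto simp: R_def)
      moreover have "norm (s *\<^sub>R (x - y)) = norm (x - y) + \<bar>B\<bar> + norm y"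
      proof -
        have "norm (s *\<^sub>R (x - y)) = s * norm (x - y)" using \<open>s \<ge> 1\<close> by simp
        also have "s * norm (x - y) = norm (x - y) + \<bar>B\<bar> + norm y"  using pos by (simp add: s_def)
        finally show ?thesis .
      qed
      moreover have "norm (s *\<^sub>R (x - y)) \<le> norm (y + s *\<^sub>R (x - y)) + norm y"
        by (metis add.commute add_diff_cancel_left' norm_triangle_ineq4)
      ultimately show False using pos by linarith
    qed
    then obtain s where s: "s \<ge> 1" "y + s *\<^sub>R (x - y) \<in> S" by (auto simp: R_def)
    have "x \<notin> S" using x(1) by (simp add: inside_def)
    then have "s \<noteq> 1" using s(2) by auto
    then have "s > 1" using s by simp
    then show ?thesis using s(2)
      by (intro exI[of _ "y + s *\<^sub>R (x - y)"] exI[of _ "1/s"]) (auto simp: )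
  qed
  have seg: "y + r *\<^sub>R (p - y) \<notin> S" if "p \<in> S" "0 \<le> r" "r < 1" for p r
  proof (cases "r = 0")
    case False
    show ?thesis
    proof
      assume A: "y + r *\<^sub>R (p - y) \<in> S"
      from single[OF \<open>p \<in> S\<close> A, of r] that False have "p = y + r *\<^sub>R (p - y)" by auto
      then have "(1 - r) *\<^sub>R (p - y) = 0" by (simp add: algebra_simps)
      with that y show False by auto
    qed
  qed (use y in auto)
  \<comment> \<open>The half-open segment avoids S, so its points are inside together with y or not
    at all; a single inside point, placed on such a segment by \<open>hit\<close>, then decides for
    y.\<close>
  have iff: "y \<in> inside S \<longleftrightarrow> y + r *\<^sub>R (p - y) \<in> inside S" if "p \<in> S" "0 \<le> r" "r < 1" for p r
  proof -
    let ?L = "(\<lambda>r. y + r *\<^sub>R (p - y)) ` {0..<1}"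
    have "connected ?L"
      by (intro connected_continuous_image continuous_intros) simp
    moreover have "?L \<subseteq> - S" using seg[OF \<open>p \<in> S\<close>] by auto
    moreover have "y \<in> ?L" by (rule image_eqI[of _ _ 0]) auto
    moreover have "y + r *\<^sub>R (p - y) \<in> ?L" using that by auto
    ultimately have "connected_component (- S) y (y + r *\<^sub>R (p - y))"
      unfolding connected_component_def by blast
    then show ?thesis by (metis inside_same_component connected_component_sym)
  qed
  obtain x where x: "x \<in> inside S" using inside_nonempty_sphere_image[OF S] by blast
  have yin: "y \<in> inside S"
  proof (cases "x = y")
    case False
    from hit[OF x this] iff x show ?thesis by blast
  qed (use x in simp)
  have "S \<noteq> {}" using x bou by auto
  then obtain p0 where "p0 \<in> S" by blast
  show eq: "inside S = {y + r *\<^sub>R (p - y) | p r. p \<in> S \<and> 0 \<le> r \<and> r < 1}" (is "_ = ?R")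
  proof
    show "inside S \<subseteq> ?R"
    proof
      fix x assume x: "x \<in> inside S"
      show "x \<in> ?R"
      proof (cases "x = y")
        case True
        have "x = y + 0 *\<^sub>R (p0 - y)" using True by simp
        then show ?thesis using \<open>p0 \<in> S\<close>
          by (intro CollectI exI[of _ p0] exI[of _ "0::real"]) auto
      next
        case False from hit[OF x this] show ?thesis by blast
      qed
    qed
  qed (use iff yin in auto)
  show "interior (S \<union> inside S) = inside S"
  proof
    have "open (inside S)" using clo by (rule open_inside)
    then show "inside S \<subseteq> interior (S \<union> inside S)" by (simp add: interior_maximal)
    show "interior (S \<union> inside S) \<subseteq> inside S"
    proof
      fix p assume p: "p \<in> interior (S \<union> inside S)"
      show "p \<in> inside S"
      proof (rule ccontr)
        assume "p \<notin> inside S"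
        then have "p \<in> S" using p interior_subset by blast
        obtain e where e: "e > 0" "ball p e \<subseteq> S \<union> inside S"
          using p by (meson mem_interior)
        have pos: "norm (p - y) > 0" using \<open>p \<in> S\<close> y by auto
        \<comment> \<open>A step of length e/2 past p stays in the ball around p, hence in S or
          inside S; either would put a boundary point other than p on the ray.\<close>
        define t where "t = 1 + e / (2 * norm (p - y))"
        have t: "t > 1" using e pos by (simp add: t_def)
        have off: "y + t *\<^sub>R (p - y) - p = (t - 1) *\<^sub>R (p - y)" by (simp add: algebra_simps)
        then have "norm (y + t *\<^sub>R (p - y) - p) = e/2" using pos e by (simp add: t_def)
        then have "y + t *\<^sub>R (p - y) \<in> ball p e" using e by (simp add: dist_norm norm_minus_commute)
        then consider "y + t *\<^sub>R (p - y) \<in> S" | "y + t *\<^sub>R (p - y) \<in> inside S" using e by blast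
        then show False
        proof cases
          case 1
          from single[OF \<open>p \<in> S\<close> this, of t] t have "p = y + t *\<^sub>R (p - y)" by auto
          then have "(t - 1) *\<^sub>R (p - y) = 0" by (metis off diff_self)
          with t pos show False by auto
        next
          case 2
          then obtain q r where q: "q \<in> S" "0 \<le> r" "r < 1" "y + t *\<^sub>R (p - y) = y + r *\<^sub>R (q - y)"
            unfolding eq by blast
          then have "(1 / t) *\<^sub>R (t *\<^sub>R (p - y)) = (1 / t) *\<^sub>R (r *\<^sub>R (q - y))" by simp
          then have pq: "p - y = (r / t) *\<^sub>R (q - y)" using t by simp
          then have "r \<noteq> 0" using pos by auto
          then have "0 < r / t" using q(2) t by simp
          then have "q = p" by (rule single[OF q(1) \<open>p \<in> S\<close> _ pq])
          with q(4) have "(t - r) *\<^sub>R (p - y) = 0" by (simp add: scaleR_left_diff_distrib)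
          then have "t = r" using pos by auto
          with t q(3) show False by simp
        qed
      qed
    qed
  qed
qed

text \<open>With |s| = 1 the last condition says that the line through \<open>\<gamma> t\<close>
  with the direction of the tangent at u passes y at distance at least 1/\<kappa>, on the side given
  by s. The parameters t and u are independent: pairing every point with every tangent is what makes
  the cross products of chords monotone in \<open>visible_edge_cross2_less\<close>.\<close>

definition visible_edge :: "real \<Rightarrow> point \<Rightarrow> real \<Rightarrow> (real \<Rightarrow> point) \<Rightarrow> bool" where
  "visible_edge s y \<kappa> \<gamma> \<longleftrightarrow>
     (\<forall>t\<in>{0..1}. \<gamma> differentiable (at t)) \<and>
     continuous_on {0..1} (\<lambda>t. vector_derivative \<gamma> (at t)) \<and>
     (\<forall>t\<in>{0..1}. \<forall>u\<in>{0..1}. 0 < norm (vector_derivative \<gamma> (at u)) \<and>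
        norm (vector_derivative \<gamma> (at u)) \<le> \<kappa> * (s * cross2 (\<gamma> t - y) (vector_derivative \<gamma> (at u))))"

lemma visible_edge_cross2_pos:
  assumes "visible_edge s y \<kappa> \<gamma>" "0 < \<kappa>" "t \<in> {0..1}" "u \<in> {0..1}"
  shows "0 < s * cross2 (\<gamma> t - y) (vector_derivative \<gamma> (at u))"
proof -
  have "0 < norm (vector_derivative \<gamma> (at u))"
    "norm (vector_derivative \<gamma> (at u)) \<le> \<kappa> * (s * cross2 (\<gamma> t - y) (vector_derivative \<gamma> (at u)))"
    using assms unfolding visible_edge_def by blast+
  then have "0 < \<kappa> * (s * cross2 (\<gamma> t - y) (vector_derivative \<gamma> (at u)))" by linarith
  then show ?thesis using \<open>0 < \<kappa>\<close> by (simp add: zero_less_mult_iff)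
qed

text \<open>For fixed t the cross product with \<open>\<gamma> r - y\<close> vanishes at r = t and
  is strictly monotone in r. So the edge turns about y in one direction, by less than a half
  turn.\<close>

lemma visible_edge_cross2_less:
  assumes "visible_edge s y \<kappa> \<gamma>" "0 < \<kappa>" "t \<in> {0..1}" "u \<in> {0..1}" "t < u"
  shows "0 < s * cross2 (\<gamma> t - y) (\<gamma> u - y)"
proof -
  have der: "(\<gamma> has_vector_derivative vector_derivative \<gamma> (at r)) (at r)" if "r \<in> {0..1}" for r
    using assms that unfolding visible_edge_def by (simp add: vector_derivative_works)
  have "\<exists>D. ((\<lambda>r. s * cross2 (\<gamma> t - y) (\<gamma> r - y)) has_real_derivative D) (at r) \<and> 0 < D"
    if "t \<le> r" "r \<le> u" for r
  proof (intro exI conjI)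
    have r: "r \<in> {0..1}" using that assms by auto
    have "((\<lambda>r. \<gamma> r - y) has_vector_derivative vector_derivative \<gamma> (at r)) (at r)"
      using has_vector_derivative_diff[OF der[OF r] has_vector_derivative_const[of y]] by simp
    from DERIV_cmult[OF has_real_derivative_cross2_right[OF this], of s "\<gamma> t - y"]
    show "((\<lambda>r. s * cross2 (\<gamma> t - y) (\<gamma> r - y)) has_real_derivative
        s * cross2 (\<gamma> t - y) (vector_derivative \<gamma> (at r))) (at r)" .
    show "0 < s * cross2 (\<gamma> t - y) (vector_derivative \<gamma> (at r))"
      by (rule visible_edge_cross2_pos[OF assms(1,2,3) r])
  qed
  from DERIV_pos_imp_increasing[OF \<open>t < u\<close> this]
  show ?thesis by (simp add: cross2_self)
qed

lemma visible_edge_not_center: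
  assumes "visible_edge s y \<kappa> \<gamma>" "0 < \<kappa>" "t \<in> {0..1}"
  shows "\<gamma> t \<noteq> y"
proof
  assume "\<gamma> t = y"
  with visible_edge_cross2_pos[OF assms assms(3)] show False by (simp add: cross2_def)
qed

text \<open>Collinear vectors have cross product zero, which the strict sign excludes for distinct
  parameters. The sign of r is free, so even the whole line through y meets the edge only
  once.\<close>

lemma visible_edge_single:
  assumes "visible_edge s y \<kappa> \<gamma>" "0 < \<kappa>" "t \<in> {0..1}" "u \<in> {0..1}" "\<gamma> u - y = r *\<^sub>R (\<gamma> t - y)"
  shows "t = u"
proof (rule ccontr)
  have "cross2 (\<gamma> u - y) (\<gamma> t - y) = 0" unfolding assms(5) by (simp add: cross2_scaleR_left cross2_self)
  moreover assume "t \<noteq> u"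
  then have "t < u \<or> u < t" by linarith
  then have "0 < s * cross2 (\<gamma> t - y) (\<gamma> u - y) \<or> 0 < s * cross2 (\<gamma> u - y) (\<gamma> t - y)"
    using visible_edge_cross2_less[OF assms(1,2,3,4)] visible_edge_cross2_less[OF assms(1,2,4,3)] by blast
  ultimately show False using cross2_swap[of "\<gamma> t - y" "\<gamma> u - y"] by simp
qed

text \<open>The shared corner b lies between the two points in the sense of rotation about y, so
  both cross products with b have the sign of s or vanish. If the points are on one ray, the two are
  negative multiples of each other; hence both vanish and both points are b.\<close>

lemma visible_edge_consecutive:
  assumes "visible_edge s y \<kappa> \<gamma>" "visible_edge s y \<kappa> \<delta>" "0 < \<kappa>" "\<gamma> 1 = \<delta> 0"
    "t \<in> {0..1}" "u \<in> {0..1}" "0 < r" "\<delta> u - y = r *\<^sub>R (\<gamma> t - y)"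
  shows "\<gamma> t = \<delta> u"
proof -
  let ?b = "\<gamma> 1 - y"
  have 01: "0 \<in> {0..1::real}" "1 \<in> {0..1::real}" by auto
  have 1: "0 < s * cross2 (\<gamma> t - y) ?b" if "t \<noteq> 1"
  proof -
    have "t < 1" using that assms(5) by simp
    then show ?thesis by (rule visible_edge_cross2_less[OF assms(1,3,5) 01(2)])
  qed
  have 2: "0 < s * cross2 ?b (\<delta> u - y)" if "u \<noteq> 0"
  proof -
    have "0 < u" using that assms(6) by simp
    then show ?thesis unfolding assms(4) by (rule visible_edge_cross2_less[OF assms(2,3) 01(1) assms(6)])
  qed
  have 3: "s * cross2 ?b (\<delta> u - y) = 0" if "u = 0"
    unfolding that assms(4) cross2_self by simp
  have 4: "s * cross2 (\<gamma> t - y) ?b = 0" if "t = 1"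
    unfolding that cross2_self by simp
  have "s * cross2 ?b (\<delta> u - y) = s * (r * - cross2 (\<gamma> t - y) ?b)"
    unfolding assms(8) cross2_scaleR_right by (subst cross2_swap) (rule refl)
  also have "\<dots> = - (r * (s * cross2 (\<gamma> t - y) ?b))" by simp
  finally have eq: "s * cross2 ?b (\<delta> u - y) = - (r * (s * cross2 (\<gamma> t - y) ?b))" .
  have nonneg: "0 \<le> s * cross2 ?b (\<delta> u - y)" using 2 3 by fastforce
  have "t = 1"
  proof (rule ccontr)
    assume "t \<noteq> 1"
    from mult_pos_pos[OF assms(7) 1[OF this]] eq nonneg show False by linarith
  qed
  moreover have "u = 0"
  proof (rule ccontr)
    assume "u \<noteq> 0"
    from 2[OF this] eq 4[OF \<open>t = 1\<close>] show False by simp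
  qed
  ultimately show ?thesis using assms(4) by simp
qed

text \<open>In a cycle of three edges any two different ones are consecutive in one of the two
  orders, and inverting the ratio r exchanges the roles of p and q.\<close>

lemma visible_triangle_single:
  assumes v: "visible_edge s y \<kappa> g1" "visible_edge s y \<kappa> g2" "visible_edge s y \<kappa> g3" and "0 < \<kappa>"
    and j: "g1 1 = g2 0" "g2 1 = g3 0" "g3 1 = g1 0"
    and S: "S = g1 ` {0..1} \<union> g2 ` {0..1} \<union> g3 ` {0..1}"
    and pq: "p \<in> S" "q \<in> S" "0 < r" "q - y = r *\<^sub>R (p - y)"
  shows "p = q"
proof -
  note single = visible_edge_single[OF _ \<open>0 < \<kappa>\<close>] 
  note cons = visible_edge_consecutive[OF _ _ \<open>0 < \<kappa>\<close>]
  have pq': "0 < 1 / r" "p - y = (1 / r) *\<^sub>R (q - y)" unfolding pq(4) using pq(3) by simp_all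
  have c11: "p = q" if "p \<in> g1 ` {0..1}" "q \<in> g1 ` {0..1}"
  proof -
    from that obtain t u where *: "t \<in> {0..1}" "u \<in> {0..1}" "p = g1 t" "q = g1 u" by auto
    show ?thesis unfolding *(3,4) using single[OF v(1) *(1,2) pq(4)[unfolded *(3,4)]] by simp
  qed
  have c12: "p = q" if "p \<in> g1 ` {0..1}" "q \<in> g2 ` {0..1}"
  proof -
    from that obtain t u where *: "t \<in> {0..1}" "u \<in> {0..1}" "p = g1 t" "q = g2 u" by auto
    show ?thesis unfolding *(3,4)
      by (rule cons[OF v(1,2) j(1) *(1,2) pq(3) pq(4)[unfolded *(3,4)]])
  qed
  have c21: "p = q" if "p \<in> g2 ` {0..1}" "q \<in> g1 ` {0..1}"
  proof -
    from that obtain t u where *: "t \<in> {0..1}" "u \<in> {0..1}" "p = g2 t" "q = g1 u" by auto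
    show ?thesis unfolding *(3,4)
      by (rule cons[OF v(1,2) j(1) *(2,1) pq'(1) pq'(2)[unfolded *(3,4)], symmetric])
  qed
  have c22: "p = q" if "p \<in> g2 ` {0..1}" "q \<in> g2 ` {0..1}"
  proof -
    from that obtain t u where *: "t \<in> {0..1}" "u \<in> {0..1}" "p = g2 t" "q = g2 u" by auto
    show ?thesis unfolding *(3,4) using single[OF v(2) *(1,2) pq(4)[unfolded *(3,4)]] by simp
  qed
  have c23: "p = q" if "p \<in> g2 ` {0..1}" "q \<in> g3 ` {0..1}"
  proof -
    from that obtain t u where *: "t \<in> {0..1}" "u \<in> {0..1}" "p = g2 t" "q = g3 u" by auto
    show ?thesis unfolding *(3,4)
      by (rule cons[OF v(2,3) j(2) *(1,2) pq(3) pq(4)[unfolded *(3,4)]])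
  qed
  have c32: "p = q" if "p \<in> g3 ` {0..1}" "q \<in> g2 ` {0..1}"
  proof -
    from that obtain t u where *: "t \<in> {0..1}" "u \<in> {0..1}" "p = g3 t" "q = g2 u" by auto
    show ?thesis unfolding *(3,4)
      by (rule cons[OF v(2,3) j(2) *(2,1) pq'(1) pq'(2)[unfolded *(3,4)], symmetric])
  qed
  have c33: "p = q" if "p \<in> g3 ` {0..1}" "q \<in> g3 ` {0..1}"
  proof -
    from that obtain t u where *: "t \<in> {0..1}" "u \<in> {0..1}" "p = g3 t" "q = g3 u" by auto
    show ?thesis unfolding *(3,4) using single[OF v(3) *(1,2) pq(4)[unfolded *(3,4)]] by simp
  qed
  have c31: "p = q" if "p \<in> g3 ` {0..1}" "q \<in> g1 ` {0..1}"
  proof -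
    from that obtain t u where *: "t \<in> {0..1}" "u \<in> {0..1}" "p = g3 t" "q = g1 u" by auto
    show ?thesis unfolding *(3,4)
      by (rule cons[OF v(3,1) j(3) *(1,2) pq(3) pq(4)[unfolded *(3,4)]])
  qed
  have c13: "p = q" if "p \<in> g1 ` {0..1}" "q \<in> g3 ` {0..1}"
  proof -
    from that obtain t u where *: "t \<in> {0..1}" "u \<in> {0..1}" "p = g1 t" "q = g3 u" by auto
    show ?thesis unfolding *(3,4)
      by (rule cons[OF v(3,1) j(3) *(2,1) pq'(1) pq'(2)[unfolded *(3,4)], symmetric])
  qed
  show ?thesis
    using pq(1,2) c11 c12 c13 c21 c22 c23 c31 c32 c33 unfolding S Un_iff by satx
qed

lemma homeomorphic_simple_loop_sphere:
  fixes \<gamma> :: "real \<Rightarrow> real^2"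
  assumes "simple_path \<gamma>" "pathfinish \<gamma> = pathstart \<gamma>"
  shows "path_image \<gamma> homeomorphic sphere (0::real^2) 1"
proof -
  have "path_image \<gamma> homeomorphic sphere (0::complex) 1"
    using homeomorphic_simple_path_image_circle[OF assms, of 1 0] by simp
  also have "sphere (0::complex) 1 homeomorphic sphere (0::real^2) 1"
    by (rule homeomorphic_spheres_gen) auto
  finally show ?thesis .
qed




text \<open>The witness is the barycentric coordinate of z at c: the signed area over the base from
  a to b is proportional to it.\<close>

lemma triangle_edge_side:
  fixes a b c :: "real^2"
  assumes "z \<in> convex hull {a, b, c}"
  obtains w where "0 \<le> w" "cross2 (b - a) (z - a) = w * cross2 (b - a) (c - a)"
proof -
  from assms obtain u v w where "0 \<le> u" "0 \<le> v" "0 \<le> w" and uvw: "u + v + w = 1"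
    and z: "z = u *\<^sub>R a + v *\<^sub>R b + w *\<^sub>R c" by (auto simp: convex_hull_3)
  have u: "u = 1 - v - w" using uvw by simp
  have "z - a = v *\<^sub>R (b - a) + w *\<^sub>R (c - a)" unfolding z u by (simp add: algebra_simps)
  then have "cross2 (b - a) (z - a) = w * cross2 (b - a) (c - a)"
    by (simp only: cross2_add_right[of _ "v *\<^sub>R _"] cross2_scaleR_right cross2_self)
  with \<open>0 \<le> w\<close> show ?thesis by (rule that)
qed

text \<open>The inner-side property of the edge is applied to the lowest point of the ball around \<open>y\<close>.\<close>

lemma triangle_edge_height:
  fixes a b c :: "real^2"
  assumes ball: "ball x0 \<rho> \<subseteq> convex hull {a, b, c}" and "0 < \<rho>"
    and s: "s = sgn (cross2 (b - a) (c - a))" and s1: "\<bar>s\<bar> = 1" and y: "y \<in> ball x0 (\<rho>/2)"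
  shows "norm (b - a) * (\<rho>/2) \<le> s * cross2 (a - y) (b - a)"
proof (cases "b = a")
  case False
  then have d: "0 < norm (b - a)" by simp
  have pos: "0 \<le> s * cross2 (b - a) (z - a)" if z: "z \<in> convex hull {a,b,c}" for z
  proof -
    from z obtain w where w: "0 \<le> w" "cross2 (b - a) (z - a) = w * cross2 (b - a) (c - a)"
      by (rule triangle_edge_side)
    have "0 \<le> s * cross2 (b - a) (c - a)" unfolding s sgn_real_def by simp
    with w(1) have "0 \<le> w * (s * cross2 (b - a) (c - a))" by (rule mult_nonneg_nonneg)
    then show ?thesis unfolding w(2) by (simp only: mult.left_commute)
  qed
  \<comment> \<open>\<open>b - a\<close> turned by a right angle: of all directions this one changes
    the cross product with \<open>b - a\<close> fastest.\<close>
  define J :: "real^2" where "J = vector [-(b-a)$2, (b-a)$1]"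
  have J1: "norm J = norm (b - a)"
  proof -
    have "(norm J)\<^sup>2 = (norm (b - a))\<^sup>2"
      unfolding power2_norm_eq_inner J_def by (simp add: inner_vec_def sum_2 algebra_simps)
    then show ?thesis by simp
  qed
  have J2: "cross2 (b - a) J = norm (b - a) * norm (b - a)"
    unfolding power2_eq_square[symmetric] power2_norm_eq_inner J_def
    by (simp add: inner_vec_def sum_2 cross2_def algebra_simps)
  \<comment> \<open>Scaled to a displacement of length \<rho>/2; the sign s directs it from y
    towards the edge.\<close>
  define k where "k = s * (\<rho> / 2) / norm (b - a)"
  define z where "z = y - k *\<^sub>R J"
  have "ball y (\<rho>/2) \<subseteq> ball x0 \<rho>"
  proof
    fix z assume "z \<in> ball y (\<rho>/2)"
    then show "z \<in> ball x0 \<rho>" using y dist_triangle[of x0 z y] by simp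
  qed
  with ball have "ball y (\<rho>/2) \<subseteq> convex hull {a,b,c}" by (rule order_trans[rotated])
  \<comment> \<open>The lowest point lies on the sphere bounding the ball, so the inclusion has to
    be extended to the closed ball.\<close>
  moreover have "closed (convex hull {a,b,c})"
    by (rule compact_imp_closed[OF finite_imp_compact_convex_hull]) simp
  ultimately have "closure (ball y (\<rho>/2)) \<subseteq> convex hull {a,b,c}" by (rule closure_minimal)
  then have sub: "cball y (\<rho>/2) \<subseteq> convex hull {a,b,c}" using \<open>0 < \<rho>\<close> by simp
  have "norm (k *\<^sub>R J) = \<rho>/2"
    unfolding norm_scaleR J1 k_def abs_divide abs_mult s1 using d \<open>0 < \<rho>\<close> by simp
  then have "z \<in> cball y (\<rho>/2)" by (simp add: z_def dist_norm)
  with sub pos have "0 \<le> s * cross2 (b - a) (z - a)" by blast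
  moreover have "z - a = (y - a) - k *\<^sub>R J" by (simp add: z_def)
  then have "cross2 (b - a) (z - a) = cross2 (b - a) (y - a) - k * cross2 (b - a) J"
    by (simp only: cross2_diff_right[of "b - a" "y - a"] cross2_scaleR_right)
  moreover have "k * cross2 (b - a) J = s * (norm (b - a) * (\<rho>/2))"
    unfolding J2 k_def using d by simp
  ultimately have "s * s * (norm (b - a) * (\<rho>/2)) \<le> s * cross2 (b - a) (y - a)"
    by (simp add: right_diff_distrib)
  moreover have "s * s = 1" using s1 by (metis abs_mult_self_eq mult_1)
  moreover have "cross2 (b - a) (y - a) = cross2 (a - y) (b - a)"
    by (simp add: cross2_def algebra_simps)
  ultimately show ?thesis by simp
qed (simp add: cross2_def)

text \<open>With \<open>\<gamma>' = (b - a) + e'\<close> and \<open>\<gamma> = a + t (b - a) + e\<close>, the errors \<open>e, e'\<close> cost at most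
  \<open>4 \<eta> D\<close> of the height \<open>\<rho>/2\<close> of the straight edge over \<open>y\<close>.\<close>

lemma near_straight_visible_edge:
  fixes \<gamma> :: "real \<Rightarrow> real^2"
  assumes der: "\<And>t. t \<in> {0..1} \<Longrightarrow> (\<gamma> has_vector_derivative \<gamma>' t) (at t)"
    and cont: "continuous_on {0..1} \<gamma>'"
    and near: "\<And>t. t \<in> {0..1} \<Longrightarrow> norm (\<gamma>' t - (b - a)) \<le> \<eta> * norm (b - a)"
    and ends: "\<gamma> 0 = a" "\<gamma> 1 = b" and "a \<noteq> b"
    and height: "norm (b - a) * (\<rho>/2) \<le> s * cross2 (a - y) (b - a)" and s: "\<bar>s\<bar> = 1"
    and D: "norm (a - y) \<le> D" "norm (b - a) \<le> D"
    and \<eta>: "0 \<le> \<eta>" "\<eta> \<le> 1/2" "16 * \<eta> * D \<le> \<rho>" and "0 < \<rho>"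
  shows "visible_edge s y (8 / \<rho>) \<gamma>"
    and "\<And>t. t \<in> {0..1} \<Longrightarrow> norm (\<gamma> t - a) \<le> 2 * D"
proof -
  let ?d = "b - a"
  have vd: "vector_derivative \<gamma> (at t) = \<gamma>' t" if "t \<in> {0..1}" for t
    using der[OF that] by (rule vector_derivative_at)
  have D0: "0 \<le> D" using norm_ge_zero[of ?d] D(2) by linarith
  have d: "0 < norm ?d" using \<open>a \<noteq> b\<close> by simp
  \<comment> \<open>Mean value inequality for \<gamma> minus the linear part
    \<open>t *\<^sub>R (b - a)\<close>: the bound on e' passes to e.\<close>
  have dev: "norm (\<gamma> t - a - t *\<^sub>R ?d) \<le> \<eta> * norm ?d" if t: "t \<in> {0..1}" for t
  proof -
    have "norm ((\<gamma> t - t *\<^sub>R ?d) - (\<gamma> 0 - 0 *\<^sub>R ?d)) \<le> (\<eta> * norm ?d) * norm (t - 0)"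
    proof (rule differentiable_bound[where S="{0..1}" and f'="\<lambda>r h. h *\<^sub>R (\<gamma>' r - ?d)"])
      fix r :: real assume r: "r \<in> {0..1}"
      show "((\<lambda>t. \<gamma> t - t *\<^sub>R ?d) has_derivative (\<lambda>h. h *\<^sub>R (\<gamma>' r - ?d))) (at r within {0..1})"
      proof -
        have "((\<lambda>t. t *\<^sub>R ?d) has_derivative (\<lambda>h. h *\<^sub>R ?d)) (at r)"
          by (intro has_derivative_scaleR_left has_derivative_ident)
        from has_derivative_diff[OF der[OF r, unfolded has_vector_derivative_def] this]
        show ?thesis unfolding scaleR_diff_right by (rule has_derivative_at_withinI)
      qed
      show "onorm (\<lambda>h. h *\<^sub>R (\<gamma>' r - ?d)) \<le> \<eta> * norm ?d"
      proof (rule onorm_le)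
        fix h :: real
        show "norm (h *\<^sub>R (\<gamma>' r - ?d)) \<le> \<eta> * norm ?d * norm h"
          using mult_left_mono[OF near[OF r], of "\<bar>h\<bar>"] by (simp add: mult.commute)
      qed
    qed (use t in auto)
    also have "\<dots> \<le> \<eta> * norm ?d * 1" using t \<eta> by (intro mult_left_mono) auto
    also have "\<gamma> t - t *\<^sub>R ?d - (\<gamma> 0 - 0 *\<^sub>R ?d) = \<gamma> t - a - t *\<^sub>R ?d" by (simp add: ends)
    finally show ?thesis by simp
  qed
  \<comment> \<open>Half of the height survives: by \<open>16 * \<eta> * D \<le> \<rho>\<close> the
    errors stay below \<open>norm (b - a) * (\<rho>/4)\<close>.\<close>
  have main: "norm ?d * (\<rho>/4) \<le> s * cross2 (\<gamma> t - y) (\<gamma>' u)" if t: "t \<in> {0..1}" and u: "u \<in> {0..1}" for t u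
  proof -
    define e e' where "e = \<gamma> t - a - t *\<^sub>R ?d" and "e' = \<gamma>' u - ?d"
    have e: "norm e \<le> \<eta> * norm ?d" "norm e' \<le> \<eta> * norm ?d"
      using dev[OF t] near[OF u] by (auto simp: e_def e'_def)
    have "cross2 (\<gamma> t - y) (\<gamma>' u) = cross2 ((a - y) + t *\<^sub>R ?d + e) (?d + e')"
      by (simp add: e_def e'_def)
    also have "\<dots> = cross2 (a - y) ?d + (cross2 (a - y) e' + t * cross2 ?d e' + cross2 e ?d + cross2 e e')"
      unfolding cross2_def by (simp add: algebra_simps)
    finally have eq: "s * cross2 (\<gamma> t - y) (\<gamma>' u) = s * cross2 (a - y) ?d
       + s * (cross2 (a - y) e' + t * cross2 ?d e' + cross2 e ?d + cross2 e e')"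
      by (simp add: algebra_simps)
    have c1: "\<bar>cross2 (a - y) e'\<bar> \<le> D * (\<eta> * norm ?d)"
      using D e by (intro order.trans[OF abs_cross2_le] mult_mono) (use D0 in auto)
    have "\<bar>cross2 ?d e'\<bar> \<le> D * (\<eta> * norm ?d)"
      using D e by (intro order.trans[OF abs_cross2_le] mult_mono) (use D0 in auto)
    moreover have "\<bar>t * cross2 ?d e'\<bar> \<le> 1 * \<bar>cross2 ?d e'\<bar>"
      using t unfolding abs_mult by (intro mult_right_mono) auto
    ultimately have c2: "\<bar>t * cross2 ?d e'\<bar> \<le> D * (\<eta> * norm ?d)" by simp
    have c3: "\<bar>cross2 e ?d\<bar> \<le> D * (\<eta> * norm ?d)"
      using D e by (subst cross2_swap, subst abs_minus_cancel)
        (intro order.trans[OF abs_cross2_le] mult_mono; use D0 in simp)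
    have "\<eta> * norm ?d \<le> 1/2 * norm ?d" using \<eta>(2) by (rule mult_right_mono) simp
    then have "norm e \<le> D" using e(1) D(2) d by linarith
    then have c4: "\<bar>cross2 e e'\<bar> \<le> D * (\<eta> * norm ?d)"
      using e by (intro order.trans[OF abs_cross2_le] mult_mono) (use D0 in auto)
    have "\<bar>s * (cross2 (a - y) e' + t * cross2 ?d e' + cross2 e ?d + cross2 e e')\<bar> \<le> 4 * (D * (\<eta> * norm ?d))"
      unfolding abs_mult s using c1 c2 c3 c4 by simp
    moreover have "4 * (D * (\<eta> * norm ?d)) \<le> norm ?d * (\<rho>/4)"
    proof -
      have "(16 * \<eta> * D) * norm ?d \<le> \<rho> * norm ?d" using \<eta>(3) by (rule mult_right_mono) simp
      then show ?thesis by (simp add: algebra_simps)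
    qed
    ultimately show ?thesis using height eq by (simp add: abs_le_iff)
  qed
  have up: "norm (\<gamma>' u) \<le> 2 * norm ?d" and lo: "0 < norm (\<gamma>' u)" if u: "u \<in> {0..1}" for u
  proof -
    have "norm (\<gamma>' u - ?d) \<le> 1/2 * norm ?d"
      using near[OF u] \<eta>(2) mult_right_mono[OF \<eta>(2), of "norm ?d"] by simp
    then show "norm (\<gamma>' u) \<le> 2 * norm ?d" "0 < norm (\<gamma>' u)"
      using norm_triangle_ineq2[of "\<gamma>' u" ?d] norm_triangle_ineq2[of ?d "\<gamma>' u"]
        norm_minus_commute[of "\<gamma>' u" ?d] d by linarith+
  qed
  \<comment> \<open>8/\<rho> is the speed bound \<open>2 * norm (b - a)\<close> divided by the
    surviving height \<open>norm (b - a) * (\<rho>/4)\<close>.\<close>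
  show "visible_edge s y (8 / \<rho>) \<gamma>"
    unfolding visible_edge_def
  proof (intro conjI ballI)
    show "\<gamma> differentiable at t" if "t \<in> {0..1}" for t
      using der[OF that] by (rule differentiableI_vector)
    show "continuous_on {0..1} (\<lambda>t. vector_derivative \<gamma> (at t))"
      using cont by (rule continuous_on_eq) (simp add: vd)
    fix t u :: real assume tu: "t \<in> {0..1}" "u \<in> {0..1}"
    show "0 < norm (vector_derivative \<gamma> (at u))" using lo tu vd by simp
    have "norm (\<gamma>' u) \<le> 2 * norm ?d" using up tu by simp
    also have "\<dots> = 8 / \<rho> * (norm ?d * (\<rho>/4))" using \<open>0 < \<rho>\<close> by simp
    also have "\<dots> \<le> 8 / \<rho> * (s * cross2 (\<gamma> t - y) (\<gamma>' u))"
      using \<open>0 < \<rho>\<close> main[OF tu] by (intro mult_left_mono) auto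
    finally show "norm (vector_derivative \<gamma> (at u))
        \<le> 8 / \<rho> * (s * cross2 (\<gamma> t - y) (vector_derivative \<gamma> (at u)))" using vd tu by simp
  qed
  show "norm (\<gamma> t - a) \<le> 2 * D" if t: "t \<in> {0..1}" for t
  proof -
    have "norm (\<gamma> t - a) \<le> norm (\<gamma> t - a - t *\<^sub>R ?d) + norm (t *\<^sub>R ?d)"
      by (metis diff_add_cancel norm_triangle_ineq)
    also have "\<dots> \<le> \<eta> * norm ?d + 1 * norm ?d"
      using dev[OF t] t mult_right_mono[of t 1 "norm ?d"] by simp
    also have "\<dots> \<le> norm ?d + norm ?d"
      using mult_right_mono[OF \<eta>(2), of "norm ?d"] d by linarith
    finally show ?thesis using D by simp
  qed
qed

section \<open>Short arcs are nearly straight\<close>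

lemma Ck_on_imp_continuous_on: "Ck_on k S f \<Longrightarrow> continuous_on S f"
  by (cases k) (auto intro!: continuous_at_imp_continuous_on differentiable_imp_continuous_within)

lemma Ck_on_has_vector_derivative:
  fixes f :: "real \<Rightarrow> 'b::real_normed_vector"
  assumes "Ck_on (Suc k) UNIV f"
  shows "(f has_vector_derivative vector_derivative f (at t)) (at t)"
    and "continuous_on UNIV (\<lambda>t. vector_derivative f (at t))"
proof -
  have "f differentiable (at t)" for t using assms by simp
  then show der: "(f has_vector_derivative vector_derivative f (at t)) (at t)" for t
    by (simp add: vector_derivative_works)
  have "frechet_derivative f (at t) 1 = vector_derivative f (at t)" for t
    using frechet_derivative_at[OF der[of t, unfolded has_vector_derivative_def], symmetric] by simp
  moreover have "continuous_on UNIV (\<lambda>x. frechet_derivative f (at x) 1)"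
    using assms Ck_on_imp_continuous_on[of k UNIV "\<lambda>x. frechet_derivative f (at x) 1"] by simp
  ultimately show "continuous_on UNIV (\<lambda>t. vector_derivative f (at t))" by simp
qed

lemma periodic_of_int:
  fixes f :: "real \<Rightarrow> 'b"
  assumes "\<And>t. f (t + P) = f t"
  shows "f (t + of_int n * P) = f t"
proof -
  interpret periodic_fun_simple f P by standard (rule assms)
  show ?thesis by (rule plus_of_int)
qed

lemma reduce_mod_period:
  fixes t a P :: real
  assumes "0 < P"
  obtains n :: int where "t - of_int n * P \<in> {a..<a + P}"
proof
  let ?n = "\<lfloor>(t - a) / P\<rfloor>"
  have "of_int ?n * P \<le> t - a"
    using assms by (simp add: pos_le_divide_eq[symmetric])
  moreover have "t - a < (of_int ?n + 1) * P"
    using assms by (simp add: pos_divide_less_eq[symmetric])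
  ultimately show "t - of_int ?n * P \<in> {a..<a + P}" by (simp add: algebra_simps)
qed

text \<open>The distance is continuous and periodic in s and, by injectivity on a period, never
  zero; compactness bounds it below. Thus an arc that stays close to its starting point has a short
  parameter interval, although the curve returns.\<close>

lemma regular_closed_curve_separated:
  assumes \<Gamma>: "regular_closed_curve k \<Gamma>" and \<delta>: "0 < \<delta>" "\<delta> < period \<Gamma>"
  obtains h where "0 < h" "\<And>s. h < dist (par \<Gamma> s) (par \<Gamma> (s + \<delta>))"
proof -
  let ?P = "period \<Gamma>" and ?f = "\<lambda>s. dist (par \<Gamma> s) (par \<Gamma> (s + \<delta>))"
  have lohi: "lo \<Gamma> < hi \<Gamma>" and per: "\<And>t. par \<Gamma> (t + ?P) = par \<Gamma> t"
    and inj: "inj_on (par \<Gamma>) {lo \<Gamma>..<hi \<Gamma>}" and C: "Ck_on k UNIV (par \<Gamma>)"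
    using \<Gamma> by (auto simp: regular_closed_curve_def)
  note perZ = periodic_of_int[where f="par \<Gamma>", OF per]
  have cont: "continuous_on UNIV (par \<Gamma>)" using C by (rule Ck_on_imp_continuous_on)
  have "continuous_on {lo \<Gamma>..hi \<Gamma>} ?f"
    by (intro continuous_intros continuous_on_compose2[OF cont]) auto
  moreover have "{lo \<Gamma>..hi \<Gamma>} \<noteq> {}" using lohi by simp
  ultimately obtain s0 where s0: "\<And>s. s \<in> {lo \<Gamma>..hi \<Gamma>} \<Longrightarrow> ?f s0 \<le> ?f s"
    using continuous_attains_inf[OF compact_Icc, of "lo \<Gamma>" "hi \<Gamma>" ?f] by blast
  have f0: "0 < ?f s0"
  proof (rule ccontr)
    assume "\<not> 0 < ?f s0"
    then have eq: "par \<Gamma> s0 = par \<Gamma> (s0 + \<delta>)" by simp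
    obtain n where n: "s0 - of_int n * ?P \<in> {lo \<Gamma>..<lo \<Gamma> + ?P}"
      using lohi by (elim reduce_mod_period[of ?P s0 "lo \<Gamma>", rotated]) simp
    obtain l where l: "s0 + \<delta> - of_int l * ?P \<in> {lo \<Gamma>..<lo \<Gamma> + ?P}"
      using lohi by (elim reduce_mod_period[of ?P "s0 + \<delta>" "lo \<Gamma>", rotated]) simp
    have "par \<Gamma> (s0 - of_int n * ?P) = par \<Gamma> (s0 + \<delta> - of_int l * ?P)"
      using perZ[of s0 "- n"] perZ[of "s0 + \<delta>" "- l"] eq by simp
    then have "s0 - of_int n * ?P = s0 + \<delta> - of_int l * ?P"
      using n l by (intro inj_onD[OF inj]) auto
    \<comment> \<open>Injectivity on one period leaves only shifts by whole periods, which 0 <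
      \<delta> < period excludes.\<close>
    then have d: "\<delta> = of_int (l - n) * ?P" by (simp add: algebra_simps)
    have P: "0 < ?P" using lohi by simp
    from d \<delta>(1) P have "0 < real_of_int (l - n)" by (simp add: zero_less_mult_iff)
    then have "1 \<le> l - n" by auto
    then have "1 \<le> real_of_int (l - n)" by (simp only: of_int_1_le_iff)
    then have "?P \<le> \<delta>" unfolding d using P mult_right_mono[of 1 "real_of_int (l - n)" ?P] by simp
    with \<delta>(2) show False by simp
  qed
  show ?thesis
  proof
    show "0 < ?f s0 / 2" using f0 by simp
    fix s
    obtain n where n: "s - of_int n * ?P \<in> {lo \<Gamma>..<lo \<Gamma> + ?P}"
      using lohi by (elim reduce_mod_period[of ?P s "lo \<Gamma>", rotated]) simp
    have "?f s0 \<le> ?f (s - of_int n * ?P)" using n by (intro s0) auto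
    also have "\<dots> = ?f s"
      using perZ[of s "- n"] perZ[of "s + \<delta>" "- n"] by (simp add: algebra_simps)
    finally show "?f s0 / 2 < ?f s" using f0 by linarith
  qed
qed

lemma arc_path_has_vector_derivative:
  assumes "\<And>t. (par \<Gamma> has_vector_derivative dpar \<Gamma> t) (at t)"
  shows "(arc_path \<Gamma> \<alpha> \<beta> has_vector_derivative (\<beta> - \<alpha>) *\<^sub>R dpar \<Gamma> (\<alpha> + t * (\<beta> - \<alpha>))) (at t)"
proof -
  have "((\<lambda>t. \<alpha> + t * (\<beta> - \<alpha>)) has_real_derivative (\<beta> - \<alpha>)) (at t)"
    by (auto intro!: derivative_eq_intros)
  then have "((\<lambda>t. \<alpha> + t * (\<beta> - \<alpha>)) has_vector_derivative (\<beta> - \<alpha>)) (at t)"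
    by (simp add: has_real_derivative_iff_has_vector_derivative)
  from vector_diff_chain_at[OF this assms] show ?thesis
    by (simp add: arc_path_def[abs_def] o_def)
qed

text \<open>The hypothesis is on distances because those are what the mesh size controls; separation
  turns it into a bound on \<beta> - \<alpha>. Uniform continuity then makes the derivative nearly
  constant on the arc, and the mean value inequality compares it with the secant. The least speed M
  converts the absolute error into one relative to the secant.\<close>

lemma short_arc_derivative:
  assumes \<Gamma>: "regular_closed_curve (Suc k) \<Gamma>" and "0 < \<eta>"
  obtains h where "0 < h"
    "\<And>\<alpha> \<beta> t. \<alpha> < \<beta> \<Longrightarrow> \<beta> < \<alpha> + period \<Gamma> \<Longrightarrow> (\<And>s. s \<in> {\<alpha>..\<beta>} \<Longrightarrow> dist (par \<Gamma> \<alpha>) (par \<Gamma> s) \<le> h) \<Longrightarrow>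
       t \<in> {0..1} \<Longrightarrow>
       norm ((\<beta> - \<alpha>) *\<^sub>R dpar \<Gamma> (\<alpha> + t * (\<beta> - \<alpha>)) - (par \<Gamma> \<beta> - par \<Gamma> \<alpha>)) \<le> \<eta> * norm (par \<Gamma> \<beta> - par \<Gamma> \<alpha>)"
proof -
  let ?P = "period \<Gamma>"
  have lohi: "lo \<Gamma> < hi \<Gamma>" and per: "\<And>t. par \<Gamma> (t + ?P) = par \<Gamma> t"
    and C: "Ck_on (Suc k) UNIV (par \<Gamma>)" and nz: "\<And>t. dpar \<Gamma> t \<noteq> 0"
    using \<Gamma> by (auto simp: regular_closed_curve_def dpar_def)
  have P: "0 < ?P" using lohi by simp
  have der: "(par \<Gamma> has_vector_derivative dpar \<Gamma> t) (at t)" for t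
    using Ck_on_has_vector_derivative(1)[OF C] by (simp add: dpar_def)
  have cont: "continuous_on UNIV (dpar \<Gamma>)"
    using Ck_on_has_vector_derivative(2)[OF C] by (simp add: dpar_def[abs_def])
  have dper: "dpar \<Gamma> (t + ?P) = dpar \<Gamma> t" for t
  proof -
    have "((\<lambda>t. t + ?P) has_vector_derivative 1) (at t)"
      by (auto intro!: derivative_eq_intros)
    from vector_diff_chain_at[OF this der]
    have "((\<lambda>t. par \<Gamma> (t + ?P)) has_vector_derivative dpar \<Gamma> (t + ?P)) (at t)" by (simp add: o_def)
    then have "(par \<Gamma> has_vector_derivative dpar \<Gamma> (t + ?P)) (at t)" unfolding per .
    then show ?thesis using der vector_derivative_unique_at by blast
  qed
  note perZ = periodic_of_int[where f="dpar \<Gamma>", OF dper]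
  \<comment> \<open>Two periods: an arc that starts in the first and is shorter than a period ends
    in the second at the latest.\<close>
  have "continuous_on {lo \<Gamma>..hi \<Gamma> + ?P} (\<lambda>t. norm (dpar \<Gamma> t))"
    by (intro continuous_intros continuous_on_subset[OF cont]) auto
  moreover have "{lo \<Gamma>..hi \<Gamma> + ?P} \<noteq> {}" using lohi by simp
  ultimately obtain t0 where t0: "\<And>t. t \<in> {lo \<Gamma>..hi \<Gamma> + ?P} \<Longrightarrow> norm (dpar \<Gamma> t0) \<le> norm (dpar \<Gamma> t)"
    using continuous_attains_inf[OF compact_Icc, of "lo \<Gamma>" "hi \<Gamma> + ?P" "\<lambda>t. norm (dpar \<Gamma> t)"] by blast
  define M where "M = norm (dpar \<Gamma> t0)"
  have M: "0 < M" using nz by (simp add: M_def)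
  \<comment> \<open>Solves \<open>\<mu> * (1 + \<eta>) = \<eta> * M\<close>: for secant d and
    parameter length w, \<open>w * M \<le> norm d + \<mu> * w\<close> then yields
    \<open>\<mu> * w \<le> \<eta> * norm d\<close>.\<close>
  define \<mu> where "\<mu> = \<eta> * M / (1 + \<eta>)"
  have \<mu>: "0 < \<mu>" "\<mu> * (1 + \<eta>) = \<eta> * M" using M \<open>0 < \<eta>\<close> by (auto simp: \<mu>_def)
  have "uniformly_continuous_on {lo \<Gamma>..hi \<Gamma> + ?P} (dpar \<Gamma>)"
    by (intro compact_uniformly_continuous continuous_on_subset[OF cont]) auto
  then obtain \<delta>0 where \<delta>0: "0 < \<delta>0"
    "\<And>s t. s \<in> {lo \<Gamma>..hi \<Gamma> + ?P} \<Longrightarrow> t \<in> {lo \<Gamma>..hi \<Gamma> + ?P} \<Longrightarrow> dist t s < \<delta>0 \<Longrightarrow> dist (dpar \<Gamma> t) (dpar \<Gamma> s) < \<mu>"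
    unfolding uniformly_continuous_on_def using \<mu>(1) by metis
  \<comment> \<open>Half a period keeps \<delta> a genuine shift, as the separation lemma requires;
    halving makes both inequalities strict.\<close>
  define \<delta> where "\<delta> = min (\<delta>0/2) (?P/2)"
  have \<delta>: "0 < \<delta>" "\<delta> < ?P" "\<delta> < \<delta>0" using \<delta>0(1) P by (auto simp: \<delta>_def min_def)
  obtain h where h: "0 < h" "\<And>s. h < dist (par \<Gamma> s) (par \<Gamma> (s + \<delta>))"
    using regular_closed_curve_separated[OF \<Gamma> \<delta>(1,2)] by blast
  show ?thesis
  proof (rule that[OF h(1)])
    fix \<alpha> \<beta> t :: real
    assume ab: "\<alpha> < \<beta>" "\<beta> < \<alpha> + ?P" and small: "\<And>s. s \<in> {\<alpha>..\<beta>} \<Longrightarrow> dist (par \<Gamma> \<alpha>) (par \<Gamma> s) \<le> h"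
      and t: "t \<in> {0..1}"
    let ?w = "\<beta> - \<alpha>" and ?d = "par \<Gamma> \<beta> - par \<Gamma> \<alpha>"
    have short: "?w < \<delta>"
    proof (rule ccontr)
      assume "\<not> ?w < \<delta>"
      then have "\<alpha> + \<delta> \<in> {\<alpha>..\<beta>}" using \<delta> by auto
      from small[OF this] h(2)[of \<alpha>] show False by simp
    qed
    obtain n where n: "\<alpha> - of_int n * ?P \<in> {lo \<Gamma>..<lo \<Gamma> + ?P}"
      using P by (elim reduce_mod_period[of ?P \<alpha> "lo \<Gamma>", rotated])
    have red: "s - of_int n * ?P \<in> {lo \<Gamma>..hi \<Gamma> + ?P}" "dpar \<Gamma> (s - of_int n * ?P) = dpar \<Gamma> s"
      if "s \<in> {\<alpha>..\<beta>}" for s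
      using that n short \<delta>(2) perZ[of s "- n"] by auto
    have var: "norm (dpar \<Gamma> r - dpar \<Gamma> s) \<le> \<mu>" if "r \<in> {\<alpha>..\<beta>}" "s \<in> {\<alpha>..\<beta>}" for r s
    proof -
      have "dist (r - of_int n * ?P) (s - of_int n * ?P) < \<delta>0"
        using that short \<delta>(3) unfolding dist_real_def atLeastAtMost_iff by linarith
      from \<delta>0(2)[OF red(1)[OF that(2)] red(1)[OF that(1)] this]
      show ?thesis unfolding red(2)[OF that(1)] red(2)[OF that(2)] dist_norm by (rule less_imp_le)
    qed
    define \<tau> where "\<tau> = \<alpha> + t * ?w"
    have "0 \<le> t * ?w" "t * ?w \<le> 1 * ?w" using t ab by (auto intro!: mult_right_mono)
    then have \<tau>: "\<tau> \<in> {\<alpha>..\<beta>}" by (simp add: \<tau>_def)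
    \<comment> \<open>Subtracting the linear function with slope \<open>dpar \<Gamma> \<tau>\<close>
      leaves a derivative of size at most \<mu>.\<close>
    have "norm ((par \<Gamma> \<beta> - \<beta> *\<^sub>R dpar \<Gamma> \<tau>) - (par \<Gamma> \<alpha> - \<alpha> *\<^sub>R dpar \<Gamma> \<tau>)) \<le> \<mu> * norm (\<beta> - \<alpha>)"
    proof (rule differentiable_bound[where S="{\<alpha>..\<beta>}" and f'="\<lambda>r h. h *\<^sub>R (dpar \<Gamma> r - dpar \<Gamma> \<tau>)"])
      fix r :: real assume r: "r \<in> {\<alpha>..\<beta>}"
      show "((\<lambda>r. par \<Gamma> r - r *\<^sub>R dpar \<Gamma> \<tau>) has_derivative (\<lambda>h. h *\<^sub>R (dpar \<Gamma> r - dpar \<Gamma> \<tau>))) (at r within {\<alpha>..\<beta>})"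
      proof -
        have "((\<lambda>r. r *\<^sub>R dpar \<Gamma> \<tau>) has_derivative (\<lambda>h. h *\<^sub>R dpar \<Gamma> \<tau>)) (at r)"
          by (intro has_derivative_scaleR_left has_derivative_ident)
        from has_derivative_diff[OF der[of r, unfolded has_vector_derivative_def] this]
        show ?thesis unfolding scaleR_diff_right by (rule has_derivative_at_withinI)
      qed
      show "onorm (\<lambda>h. h *\<^sub>R (dpar \<Gamma> r - dpar \<Gamma> \<tau>)) \<le> \<mu>"
      proof (rule onorm_le)
        fix h :: real
        show "norm (h *\<^sub>R (dpar \<Gamma> r - dpar \<Gamma> \<tau>)) \<le> \<mu> * norm h"
          using mult_left_mono[OF var[OF r \<tau>], of "\<bar>h\<bar>"] by (simp add: mult.commute)
      qed
    qed (use ab in auto)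
    also have "(par \<Gamma> \<beta> - \<beta> *\<^sub>R dpar \<Gamma> \<tau>) - (par \<Gamma> \<alpha> - \<alpha> *\<^sub>R dpar \<Gamma> \<tau>) = ?d - ?w *\<^sub>R dpar \<Gamma> \<tau>"
      by (simp add: algebra_simps)
    finally have near: "norm (?d - ?w *\<^sub>R dpar \<Gamma> \<tau>) \<le> \<mu> * ?w" using ab by simp
    have "norm (?w *\<^sub>R dpar \<Gamma> \<tau>) = ?w * norm (dpar \<Gamma> (\<tau> - of_int n * ?P))"
      using ab red(2)[OF \<tau>] by simp
    moreover have "\<dots> \<ge> ?w * M" unfolding M_def
      using t0[OF red(1)[OF \<tau>]] ab by (intro mult_left_mono) auto
    ultimately have "?w * M \<le> norm ?d + \<mu> * ?w"
      using near norm_triangle_ineq2[of "?w *\<^sub>R dpar \<Gamma> \<tau>" ?d]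
      by (simp add: norm_minus_commute)
    then have "\<eta> * (?w * M) \<le> \<eta> * (norm ?d + \<mu> * ?w)" using \<open>0 < \<eta>\<close> by (intro mult_left_mono) auto
    moreover have "\<eta> * (?w * M) = ?w * (\<mu> * (1 + \<eta>))" unfolding \<mu>(2) by simp
    ultimately have "\<mu> * ?w \<le> \<eta> * norm ?d" by (simp add: algebra_simps)
    with near show "norm (?w *\<^sub>R dpar \<Gamma> (\<alpha> + t * ?w) - ?d) \<le> \<eta> * norm ?d"
      unfolding \<tau>_def by (simp add: norm_minus_commute)
  qed
qed


section \<open>Elements are uniformly star-shaped\<close>

text \<open>By the Lagrange identity a vanishing cross product is equality in Cauchy-Schwarz, that
  is, collinearity.\<close>

lemma cross2_nonzero_of_not_collinear:
  assumes "\<not> collinear {a, b, c}"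
  shows "cross2 (b - a) (c - a) \<noteq> 0"
proof
  assume "cross2 (b - a) (c - a) = 0"
  then have "((b - a) \<bullet> (c - a))\<^sup>2 = (norm (b - a) * norm (c - a))\<^sup>2"
    using cross2_inner_lagrange[of "b - a" "c - a"] by (simp add: power_mult_distrib)
  then have "\<bar>(b - a) \<bullet> (c - a)\<bar> = norm (b - a) * norm (c - a)"
    by - (rule power2_eq_imp_eq, simp_all)
  then have "collinear {0, b - a, c - a}" by (simp add: norm_cauchy_schwarz_equal)
  then have "collinear {b, a, c}" by (subst collinear_3) (simp_all add: NO_MATCH_def)
  moreover have "{b, a, c} = {a, b, c}" by auto
  ultimately show False using assms by simp
qed

text \<open>One orientation s and one inverse height \<kappa> serve all edges and all viewpoints of
  the ball; the common s is what allows consecutive edges to be compared.\<close>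

definition star_element :: "element \<Rightarrow> point \<Rightarrow> real \<Rightarrow> real \<Rightarrow> real \<Rightarrow> bool" where
  "star_element K x0 r s \<kappa> \<longleftrightarrow> 0 < r \<and> \<bar>s\<bar> = 1 \<and> 0 < \<kappa> \<and>
     (\<forall>y\<in>ball x0 r. \<forall>\<gamma>\<in>set (edge_paths K). visible_edge s y \<kappa> \<gamma>)"

section \<open>Element boundaries as Jordan curves\<close>

lemma simple_path_triangle:
  fixes a b c :: "'a::euclidean_space"
  assumes nc: "\<not> collinear {a, b, c}"
  shows "simple_path (linepath a b +++ linepath b c +++ linepath c a)"
proof -
  have ne: "a \<noteq> b" "b \<noteq> c" "c \<noteq> a" using nc by (auto simp: collinear_3_eq_affine_dependent)
  have "{b, c, a} = {a, b, c}" "{c, a, b} = {a, b, c}" by auto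
  then have nc': "\<not> collinear {b, c, a}" "\<not> collinear {c, a, b}" using nc by simp_all
  have i1: "closed_segment a b \<inter> closed_segment b c = {b}"
    by (rule Int_closed_segment[OF disjI2[OF nc]])
  have i2: "closed_segment b c \<inter> closed_segment c a = {c}"
    by (rule Int_closed_segment[OF disjI2[OF nc'(1)]])
  have i3: "closed_segment c a \<inter> closed_segment a b = {a}"
    by (rule Int_closed_segment[OF disjI2[OF nc'(2)]])
  have arc: "arc (linepath b c +++ linepath c a)"
  proof (rule arc_join)
    show "path_image (linepath b c) \<inter> path_image (linepath c a) \<subseteq> {pathstart (linepath c a)}"
      using i2 by simp
  qed (use ne in \<open>simp_all add: arc_linepath\<close>)
  show ?thesis
  proof (rule simple_path_join_loop[OF _ arc])
    have "path_image (linepath b c +++ linepath c a) = closed_segment b c \<union> closed_segment c a"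
      by (simp add: path_image_join)
    then show "path_image (linepath a b) \<inter> path_image (linepath b c +++ linepath c a)
        \<subseteq> {pathstart (linepath a b), pathstart (linepath b c +++ linepath c a)}"
      using i1 i3 by simp blast
  qed (use ne in \<open>simp_all add: arc_linepath\<close>)
qed

text \<open>Brings straight and curved elements to one form, a closed chain of three paths, so that
  the arguments on rays and traces need no case distinction.\<close>

lemma edge_paths_three:
  obtains g1 g2 g3 where "edge_paths K = [g1, g2, g3]" "g1 1 = g2 0" "g2 1 = g3 0" "g3 1 = g1 0"
    "element_boundary K = g1 ` {0..1} \<union> g2 ` {0..1} \<union> g3 ` {0..1}"
proof (cases K)
  case (Straight p q r)
  show ?thesis
    by (rule that[of "linepath p q" "linepath q r" "linepath r p"])
      (simp_all add: Straight linepath_def element_boundary_def path_image_def Un_assoc)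
next
  case (Curved \<Gamma> \<alpha> \<beta> c)
  show ?thesis
    by (rule that[of "arc_path \<Gamma> \<alpha> \<beta>" "linepath (par \<Gamma> \<beta>) c" "linepath c (par \<Gamma> \<alpha>)"])
      (simp_all add: Curved linepath_def arc_path_def element_boundary_def path_image_def Un_assoc)
qed

lemma element_boundary_homeomorphic_sphere:
  assumes "is_element K"
  shows "element_boundary K homeomorphic sphere (0::real^2) 1"
proof (cases K)
  case (Straight p q r)
  have "simple_path (linepath p q +++ linepath q r +++ linepath r p)"
    using assms Straight by (intro simple_path_triangle) simp
  from homeomorphic_simple_loop_sphere[OF this] show ?thesis
    by (simp add: Straight element_boundary_def path_image_join Un_assoc)
next
  case (Curved \<Gamma> \<alpha> \<beta> c)
  have e: "pathstart (arc_path \<Gamma> \<alpha> \<beta>) = par \<Gamma> \<alpha>" "pathfinish (arc_path \<Gamma> \<alpha> \<beta>) = par \<Gamma> \<beta>"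
    by (simp_all add: pathstart_def pathfinish_def arc_path_def)
  have "simple_path (arc_path \<Gamma> \<alpha> \<beta> +++ linepath (par \<Gamma> \<beta>) c +++ linepath c (par \<Gamma> \<alpha>))"
    using assms Curved by simp
  from homeomorphic_simple_loop_sphere[OF this] show ?thesis using e
    by (simp add: Curved element_boundary_def path_image_join Un_assoc)
qed

lemma bounded_region:
  assumes "is_element K"
  shows "bounded (region K)"
proof -
  have "compact (element_boundary K)"
    using element_boundary_homeomorphic_sphere[OF assms] homeomorphic_compactness compact_sphere by blast
  then show ?thesis unfolding region_def
    by (simp add: bounded_inside compact_imp_bounded)
qed

text \<open>Rays from every y of the ball meet the boundary once, so the radial description holds
  about each such y; this is star-shapedness with respect to the ball. It also identifies the
  interior of the closed region with the inside of its Jordan curve.\<close>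

lemma star_element_region:
  assumes K: "is_element K" and star: "star_element K x0 r s \<kappa>" and y: "y \<in> ball x0 r"
  shows "elem_int K = {y + t *\<^sub>R (p - y) | p t. p \<in> element_boundary K \<and> 0 \<le> t \<and> t < 1}"
    and "elem_int K = inside (element_boundary K)"
proof -
  obtain g1 g2 g3 where g: "edge_paths K = [g1, g2, g3]" "g1 1 = g2 0" "g2 1 = g3 0" "g3 1 = g1 0"
    "element_boundary K = g1 ` {0..1} \<union> g2 ` {0..1} \<union> g3 ` {0..1}"
    by (rule edge_paths_three)
  have \<kappa>: "0 < \<kappa>" and v: "visible_edge s y \<kappa> g1" "visible_edge s y \<kappa> g2" "visible_edge s y \<kappa> g3"
    using star y g(1) by (auto simp: star_element_def)
  have y: "y \<notin> element_boundary K"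
    unfolding g(5) using visible_edge_not_center[OF v(1) \<kappa>] visible_edge_not_center[OF v(2) \<kappa>]
      visible_edge_not_center[OF v(3) \<kappa>] by blast
  have single: "p = q" if "p \<in> element_boundary K" "q \<in> element_boundary K" "0 < u" "q - y = u *\<^sub>R (p - y)" for p q u
    by (rule visible_triangle_single[OF v \<kappa> g(2-5) that])
  note rad = inside_radial[OF element_boundary_homeomorphic_sphere[OF K] _ _ y single]
  show 2: "elem_int K = inside (element_boundary K)"
    unfolding region_def by (rule rad(2)) auto
  show "elem_int K = {y + t *\<^sub>R (p - y) | p t. p \<in> element_boundary K \<and> 0 \<le> t \<and> t < 1}"
    unfolding 2 by (rule rad(1)) auto
qed

text \<open>C^1 distance from the affine parameterization, relative to the chord. The derivative is
  two-sided also at 0 and 1, since both kinds of edge path extend beyond their end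
  parameters.\<close>

definition near_straight :: "real \<Rightarrow> (real \<Rightarrow> point) \<Rightarrow> point \<Rightarrow> point \<Rightarrow> bool" where
  "near_straight \<eta> g p q \<longleftrightarrow> g 0 = p \<and> g 1 = q \<and>
     (\<exists>g'. (\<forall>t\<in>{0..1}. (g has_vector_derivative g' t) (at t) \<and> norm (g' t - (q - p)) \<le> \<eta> * norm (q - p)) \<and>
           continuous_on {0..1} g')"

lemma near_straight_linepath:
  assumes "0 \<le> \<eta>"
  shows "near_straight \<eta> (linepath p q) p q"
proof -
  have "(linepath p q has_vector_derivative q - p) (at t)" for t
    by (rule has_vector_derivative_linepath_within)
  moreover have "norm ((q - p) - (q - p)) \<le> \<eta> * norm (q - p)" using assms by simp
  ultimately have "(\<forall>t\<in>{0..1}. (linepath p q has_vector_derivative (\<lambda>_. q - p) t) (at t) \<and>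
      norm ((\<lambda>_. q - p) t - (q - p)) \<le> \<eta> * norm (q - p)) \<and> continuous_on {0..1} (\<lambda>_::real. q - p)"
    by (auto intro: continuous_on_const)
  then show ?thesis unfolding near_straight_def
    by (intro conjI exI[of _ "\<lambda>_. q - p"]) (simp_all add: linepath_def)
qed

lemma short_arc_near_straight:
  assumes \<Gamma>: "regular_closed_curve (Suc k) \<Gamma>" and "0 < \<eta>"
  shows "\<exists>h>0. \<forall>\<alpha> \<beta>. \<alpha> < \<beta> \<longrightarrow> \<beta> < \<alpha> + period \<Gamma> \<longrightarrow> (\<forall>s\<in>{\<alpha>..\<beta>}. dist (par \<Gamma> \<alpha>) (par \<Gamma> s) \<le> h) \<longrightarrow>
       near_straight \<eta> (arc_path \<Gamma> \<alpha> \<beta>) (par \<Gamma> \<alpha>) (par \<Gamma> \<beta>)"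
proof (rule short_arc_derivative[OF assms], intro exI conjI allI impI)
  fix h \<alpha> \<beta> :: real
  assume near: "\<And>\<alpha> \<beta> t. \<alpha> < \<beta> \<Longrightarrow> \<beta> < \<alpha> + period \<Gamma> \<Longrightarrow> (\<And>s. s \<in> {\<alpha>..\<beta>} \<Longrightarrow> dist (par \<Gamma> \<alpha>) (par \<Gamma> s) \<le> h) \<Longrightarrow>
       t \<in> {0..1} \<Longrightarrow>
       norm ((\<beta> - \<alpha>) *\<^sub>R dpar \<Gamma> (\<alpha> + t * (\<beta> - \<alpha>)) - (par \<Gamma> \<beta> - par \<Gamma> \<alpha>)) \<le> \<eta> * norm (par \<Gamma> \<beta> - par \<Gamma> \<alpha>)"
    and ab: "\<alpha> < \<beta>" "\<beta> < \<alpha> + period \<Gamma>" and small: "\<forall>s\<in>{\<alpha>..\<beta>}. dist (par \<Gamma> \<alpha>) (par \<Gamma> s) \<le> h"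
  have "Ck_on (Suc k) UNIV (par \<Gamma>)" using \<Gamma> by (simp add: regular_closed_curve_def)
  note C1 = Ck_on_has_vector_derivative[OF this, folded dpar_def]
  let ?g' = "\<lambda>t. (\<beta> - \<alpha>) *\<^sub>R dpar \<Gamma> (\<alpha> + t * (\<beta> - \<alpha>))"
  have "(arc_path \<Gamma> \<alpha> \<beta> has_vector_derivative ?g' t) (at t)" for t
    by (rule arc_path_has_vector_derivative[OF C1(1)])
  moreover have "norm (?g' t - (par \<Gamma> \<beta> - par \<Gamma> \<alpha>)) \<le> \<eta> * norm (par \<Gamma> \<beta> - par \<Gamma> \<alpha>)" if "t \<in> {0..1}" for t
    by (rule near[OF ab bspec[OF small] that])
  moreover have "continuous_on {0..1} ?g'"
    by (intro continuous_intros continuous_on_compose2[OF C1(2)]) auto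
  moreover have "arc_path \<Gamma> \<alpha> \<beta> 0 = par \<Gamma> \<alpha>" "arc_path \<Gamma> \<alpha> \<beta> 1 = par \<Gamma> \<beta>"
    by (simp_all add: arc_path_def)
  ultimately show "near_straight \<eta> (arc_path \<Gamma> \<alpha> \<beta>) (par \<Gamma> \<alpha>) (par \<Gamma> \<beta>)"
    unfolding near_straight_def by (intro conjI exI[of _ ?g'] ballI)
qed

text \<open>One inscribed ball of radius \<rho> measures everything. Shape regularity gives D \<le>
  2 C \<rho>, so \<eta> \<le> 1/(32 C) suffices for visibility from the ball of radius \<rho>/2 with
  \<kappa> = 8/\<rho>. The element has diameter at most 6 D \<le> 12 C \<rho>, whence 96 C = 8 * 12
  C.\<close>

lemma near_straight_star_element:
  assumes edges: "edge_paths K = [g1, g2, g3]" and tri: "straight_triangle K = convex hull {a, b, c}"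
    and nc: "\<not> collinear {a, b, c}"
    and near: "near_straight \<eta> g1 a b" "near_straight \<eta> g2 b c" "near_straight \<eta> g3 c a"
    and K: "is_element K"
    and shape: "diameter (straight_triangle K) / inradius (straight_triangle K) \<le> C" and C: "1 \<le> C"
    and \<eta>: "0 \<le> \<eta>" "32 * C * \<eta> \<le> 1"
  shows "\<exists>x0 r s \<kappa>. star_element K x0 r s \<kappa> \<and> \<kappa> * h_el K \<le> 96 * C"
proof -
  let ?T = "convex hull {a, b, c}"
  define D where "D = diameter ?T"
  have bT: "bounded ?T" by (simp add: bounded_convex_hull)
  have "a \<noteq> b" "a \<noteq> c" "b \<noteq> c" "\<not> affine_dependent {a, b, c}"
    using nc by (auto simp: collinear_3_eq_affine_dependent)
  then have "interior ?T \<noteq> {}"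
    by (subst interior_convex_hull_eq_empty) auto
  then obtain x e where e: "0 < e" "ball x e \<subseteq> ?T" by (metis ex_in_conv mem_interior)
  let ?R = "{r. 0 < r \<and> (\<exists>x. ball x r \<subseteq> ?T)}"
  have leD: "norm (p - q) \<le> D" if "p \<in> ?T" "q \<in> ?T" for p q
    using diameter_bounded_bound[OF bT that] by (simp add: D_def dist_norm)
  \<comment> \<open>A ball of radius r contains two points at distance r, so r is at most the
    diameter of the triangle.\<close>
  have bdd: "bdd_above ?R"
  proof (rule bdd_aboveI)
    fix r assume "r \<in> ?R"
    then obtain x where r: "0 < r" "ball x r \<subseteq> ?T" by blast
    define u :: point where "u = (r/2) *\<^sub>R axis 1 1"
    have u: "norm u = r/2" using r(1) by (simp add: u_def norm_axis_1)
    have "x + u \<in> ?T" "x - u \<in> ?T" using r u by (auto simp: dist_norm)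
    then have "norm ((x + u) - (x - u)) \<le> D" by (rule leD)
    moreover have "(x + u) - (x - u) = 2 *\<^sub>R u" by (simp add: scaleR_2)
    ultimately show "r \<le> D" using u by simp
  qed
  have "e \<in> ?R" using e by blast
  then have "e \<le> Sup ?R" using bdd by (rule cSup_upper)
  then have inr: "0 < Sup ?R" using e(1) by linarith
  then have "Sup ?R / 2 < Sup ?R" by simp
  moreover have "?R \<noteq> {}" using \<open>e \<in> ?R\<close> by blast
  \<comment> \<open>The inradius is a supremum, so a ball of more than half of it is taken; this
    costs the factor 2 in D \<le> 2 C \<rho>.\<close>
  ultimately obtain \<rho> where "\<rho> \<in> ?R" and half: "Sup ?R / 2 < \<rho>"
    by (rule less_cSupE)
  then obtain x0 where \<rho>: "0 < \<rho>" "ball x0 \<rho> \<subseteq> ?T" by blast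
  have "D \<le> C * Sup ?R"
    using shape inr by (simp add: tri inradius_def D_def pos_divide_le_eq)
  also have "\<dots> \<le> C * (2 * \<rho>)" using half C by (intro mult_left_mono) auto
  finally have D\<rho>: "D \<le> 2 * C * \<rho>" by simp
  have "32 * C * \<eta> * \<rho> \<le> 1 * \<rho>" using \<eta>(2) \<rho>(1) by (intro mult_right_mono) auto
  moreover have "16 * \<eta> * D \<le> 16 * \<eta> * (2 * C * \<rho>)" using D\<rho> \<eta>(1) by (intro mult_left_mono) auto
  ultimately have \<eta>D: "16 * \<eta> * D \<le> \<rho>" by (simp add: algebra_simps)
  have "32 * 1 * \<eta> \<le> 32 * C * \<eta>" using C \<eta>(1) by (intro mult_right_mono) auto
  then have \<eta>2: "\<eta> \<le> 1/2" using \<eta> by linarith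
  define s where "s = sgn (cross2 (b - a) (c - a))"
  have s1: "\<bar>s\<bar> = 1" using cross2_nonzero_of_not_collinear[OF nc] by (simp add: s_def sgn_real_def)
  \<comment> \<open>Orientation is invariant under cyclic relabelling, so the same s serves all
    three edges.\<close>
  have cyc: "cross2 (c - b) (a - b) = cross2 (b - a) (c - a)" "cross2 (a - c) (b - c) = cross2 (b - a) (c - a)"
    by (simp_all add: cross2_def algebra_simps)
  have perm: "{b, c, a} = {a, b, c}" "{c, a, b} = {a, b, c}" by auto
  have height: "norm (q - p) * (\<rho>/2) \<le> s * cross2 (p - y) (q - p)"
    if "(g, p, q) \<in> {(g1, a, b), (g2, b, c), (g3, c, a)}" "y \<in> ball x0 (\<rho>/2)" for g p q y
    using that(1) triangle_edge_height[OF \<rho>(2,1) s_def s1 that(2)]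
      triangle_edge_height[of x0 \<rho> b c a s y] triangle_edge_height[of x0 \<rho> c a b s y] \<rho> s1 that(2)
    unfolding cyc perm s_def[symmetric] by auto
  have vT: "a \<in> ?T" "b \<in> ?T" "c \<in> ?T" by (auto intro: hull_inc)
  have main: "visible_edge s y (8 / \<rho>) g \<and> (\<forall>t\<in>{0..1}. norm (g t - p) \<le> 2 * D)"
    if g: "(g, p, q) \<in> {(g1, a, b), (g2, b, c), (g3, c, a)}" and y: "y \<in> ball x0 (\<rho>/2)" for g p q y
  proof -
    from g near have "near_straight \<eta> g p q" by auto
    then obtain g' where g': "\<And>t. t \<in> {0..1} \<Longrightarrow> (g has_vector_derivative g' t) (at t)"
      "\<And>t. t \<in> {0..1} \<Longrightarrow> norm (g' t - (q - p)) \<le> \<eta> * norm (q - p)"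
      "continuous_on {0..1} g'" "g 0 = p" "g 1 = q" unfolding near_straight_def by blast
    have "y \<in> ball x0 \<rho>" using y \<rho>(1) by auto
    then have yT: "y \<in> ?T" using \<rho>(2) by blast
    have pq: "p \<in> ?T" "q \<in> ?T" "p \<noteq> q"
      using g vT \<open>a \<noteq> b\<close> \<open>a \<noteq> c\<close> \<open>b \<noteq> c\<close> by auto
    note ns = near_straight_visible_edge[OF g'(1,3,2,4,5) pq(3) height[OF g y] s1
        leD[OF pq(1) yT] leD[OF pq(2,1)] \<eta>(1) \<eta>2 \<eta>D \<rho>(1)]
    show ?thesis using ns by blast
  qed
  have star: "star_element K x0 (\<rho>/2) s (8/\<rho>)"
    unfolding star_element_def using \<rho>(1) s1 edges main[of g1 a b] main[of g2 b c] main[of g3 c a] by auto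
  have x0: "x0 \<in> ball x0 (\<rho>/2)" using \<rho>(1) by simp
  have x0T: "x0 \<in> ?T" using \<rho> by auto
  note reg = star_element_region[OF K star x0]
  \<comment> \<open>At most 2 D from the point to the start of its edge, and D from there to the
    centre.\<close>
  have bd: "norm (p - x0) \<le> 3 * D" if p: "p \<in> element_boundary K" for p
  proof -
    from p obtain g where "g \<in> set (edge_paths K)" "p \<in> path_image g"
      unfolding element_boundary_def by blast
    then obtain t where gt: "g \<in> {g1, g2, g3}" "t \<in> {0..1}" "p = g t"
      unfolding edges path_image_def by auto
    then obtain a' b' where g: "(g, a', b') \<in> {(g1, a, b), (g2, b, c), (g3, c, a)}" by blast
    note t = gt(2,3)
    have "norm (g t - a') \<le> 2 * D" using main[OF g x0] t by blast
    moreover have "norm (a' - x0) \<le> D" using g vT x0T by (intro leD) auto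
    ultimately show ?thesis using norm_triangle_ineq[of "g t - a'" "a' - x0"] t by simp
  qed
  have "norm (p - x0) \<le> 3 * D" if "p \<in> region K" for p
  proof (cases "p \<in> element_boundary K")
    case False
    then have "p \<in> elem_int K" using that reg(2) by (simp add: region_def)
    then obtain q t where q: "q \<in> element_boundary K" "0 \<le> t" "t < 1" "p = x0 + t *\<^sub>R (q - x0)"
      unfolding reg(1) by blast
    have "norm (p - x0) = t * norm (q - x0)" using q by simp
    also have "\<dots> \<le> 1 * norm (q - x0)" using q by (intro mult_right_mono) auto
    finally show ?thesis using bd[OF q(1)] by simp
  qed (rule bd)
  note r3 = this
  have "norm (p - q) \<le> 6 * D" if "p \<in> region K" "q \<in> region K" for p q
    using norm_triangle_ineq4[of "p - x0" "q - x0"] r3[OF that(1)] r3[OF that(2)] by simp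
  moreover have "0 \<le> D" unfolding D_def using bT by (rule diameter_ge_0)
  ultimately have "h_el K \<le> 6 * D" unfolding h_el_def by (intro diameter_le) auto
  then have "h_el K \<le> 12 * C * \<rho>" using D\<rho> by linarith
  then have "8 / \<rho> * h_el K \<le> 8 / \<rho> * (12 * C * \<rho>)" using \<rho>(1) by (intro mult_left_mono) auto
  then have "8 / \<rho> * h_el K \<le> 96 * C" using \<rho>(1) by simp
  with star show ?thesis by blast
qed


text \<open>An arc lies in its element, so its points are within h_K \<le> h of its start; once h is
  below the thresholds of both curves the arc is near-straight. The tolerance \<eta> depends only on
  the shape constant, and so does the final 96 C.\<close>

lemma mesh_elements_star:
  assumes geo: "interface_geometry (Suc k) \<Omega> \<Omega>m \<Omega>p \<Gamma>b \<Gamma>i \<epsilon>0"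
    and fam: "quasi_uniform_curved_family \<Omega> \<Gamma>b \<Gamma>i \<epsilon>0 \<T>"
  obtains h0 C where "0 < h0"
    "\<And>T K. T \<in> \<T> \<Longrightarrow> h_mesh T \<le> h0 \<Longrightarrow> K \<in> T \<Longrightarrow>
       is_element K \<and> (\<exists>x0 r s \<kappa>. star_element K x0 r s \<kappa> \<and> \<kappa> * h_el K \<le> C)"
proof -
  have reg: "regular_closed_curve (Suc k) \<Gamma>b" "regular_closed_curve (Suc k) \<Gamma>i"
    using geo by (auto simp: interface_geometry_def)
  obtain C0 where C0: "\<And>T K. T \<in> \<T> \<Longrightarrow> K \<in> T \<Longrightarrow>
      diameter (straight_triangle K) / inradius (straight_triangle K) \<le> C0"
    using fam unfolding quasi_uniform_curved_family_def shape_regular_def by blast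
  \<comment> \<open>Raised to at least 1, so that 1/(32 C) also meets the absolute bound \<eta>
    \<le> 1/2.\<close>
  define C where "C = max 1 C0"
  have C: "1 \<le> C" by (simp add: C_def)
  define \<eta> where "\<eta> = 1 / (32 * C)"
  have \<eta>: "0 < \<eta>" "32 * C * \<eta> \<le> 1" using C by (auto simp: \<eta>_def)
  obtain hb where hb: "0 < hb"
    "\<forall>\<alpha> \<beta>. \<alpha> < \<beta> \<longrightarrow> \<beta> < \<alpha> + period \<Gamma>b \<longrightarrow> (\<forall>s\<in>{\<alpha>..\<beta>}. dist (par \<Gamma>b \<alpha>) (par \<Gamma>b s) \<le> hb) \<longrightarrow>
       near_straight \<eta> (arc_path \<Gamma>b \<alpha> \<beta>) (par \<Gamma>b \<alpha>) (par \<Gamma>b \<beta>)"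
    using short_arc_near_straight[OF reg(1) \<eta>(1)] by (elim exE conjE)
  obtain hi where hi: "0 < hi"
    "\<forall>\<alpha> \<beta>. \<alpha> < \<beta> \<longrightarrow> \<beta> < \<alpha> + period \<Gamma>i \<longrightarrow> (\<forall>s\<in>{\<alpha>..\<beta>}. dist (par \<Gamma>i \<alpha>) (par \<Gamma>i s) \<le> hi) \<longrightarrow>
       near_straight \<eta> (arc_path \<Gamma>i \<alpha> \<beta>) (par \<Gamma>i \<alpha>) (par \<Gamma>i \<beta>)"
    using short_arc_near_straight[OF reg(2) \<eta>(1)] by (elim exE conjE)
  show ?thesis
  proof (rule that[of "min hb hi" "96 * C"])
    fix T K assume T: "T \<in> \<T>" "h_mesh T \<le> min hb hi" and KT: "K \<in> T"
    have mesh: "curved_mesh \<Omega> \<Gamma>b \<Gamma>i T" using fam T(1) by (simp add: quasi_uniform_curved_family_def)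
    have K: "is_element K" and fin: "finite T"
      and edges_of: "\<forall>\<Gamma> \<alpha> \<beta> c. Curved \<Gamma> \<alpha> \<beta> c \<in> T \<longrightarrow> \<Gamma> = \<Gamma>b \<or> \<Gamma> = \<Gamma>i"
      using mesh[unfolded curved_mesh_def] KT by simp_all
    have "h_el K \<le> h_mesh T" unfolding h_mesh_def using fin KT by (intro Max_ge) auto
    with T(2) have hK: "h_el K \<le> hb" "h_el K \<le> hi" by auto
    have shape: "diameter (straight_triangle K) / inradius (straight_triangle K) \<le> C"
      using C0[OF T(1) KT] by (simp add: C_def)
    have "\<exists>x0 r s \<kappa>. star_element K x0 r s \<kappa> \<and> \<kappa> * h_el K \<le> 96 * C"
    proof (cases K)
      case (Straight p q r)
      show ?thesis
      proof (rule near_straight_star_element[OF _ _ _ _ _ _ K shape C less_imp_le[OF \<eta>(1)] \<eta>(2)])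
        show "edge_paths K = [linepath p q, linepath q r, linepath r p]" by (simp add: Straight)
        show "straight_triangle K = convex hull {p, q, r}" by (simp add: Straight straight_triangle_def)
        show "\<not> collinear {p, q, r}" using K Straight by simp
      qed (rule near_straight_linepath[OF less_imp_le[OF \<eta>(1)]])+
    next
      case (Curved \<Gamma> \<alpha> \<beta> c)
      have \<Gamma>: "\<Gamma> = \<Gamma>b \<or> \<Gamma> = \<Gamma>i" using edges_of KT Curved by blast
      have ab: "\<alpha> < \<beta>" "\<beta> < \<alpha> + period \<Gamma>" using K Curved by auto
      have inK: "par \<Gamma> s \<in> region K" if s: "s \<in> {\<alpha>..\<beta>}" for s
      proof -
        have "par \<Gamma> s = arc_path \<Gamma> \<alpha> \<beta> ((s - \<alpha>) / (\<beta> - \<alpha>))" "(s - \<alpha>) / (\<beta> - \<alpha>) \<in> {0..1}"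
          using s ab by (auto simp: arc_path_def)
        then have "par \<Gamma> s \<in> path_image (arc_path \<Gamma> \<alpha> \<beta>)"
          unfolding path_image_def by (rule image_eqI)
        then show ?thesis by (simp add: region_def element_boundary_def Curved)
      qed
      have small: "dist (par \<Gamma> \<alpha>) (par \<Gamma> s) \<le> h_el K" if "s \<in> {\<alpha>..\<beta>}" for s
        unfolding h_el_def using that ab by (intro diameter_bounded_bound bounded_region K inK) auto
      have smallb: "\<forall>s\<in>{\<alpha>..\<beta>}. dist (par \<Gamma> \<alpha>) (par \<Gamma> s) \<le> hb"
        and smalli: "\<forall>s\<in>{\<alpha>..\<beta>}. dist (par \<Gamma> \<alpha>) (par \<Gamma> s) \<le> hi"
        using small hK by fastforce+
      have arc: "near_straight \<eta> (arc_path \<Gamma> \<alpha> \<beta>) (par \<Gamma> \<alpha>) (par \<Gamma> \<beta>)"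
        using \<Gamma>
      proof
        assume "\<Gamma> = \<Gamma>b"
        show ?thesis by (rule hb(2)[folded \<open>\<Gamma> = \<Gamma>b\<close>, rule_format, OF ab bspec[OF smallb]])
      next
        assume "\<Gamma> = \<Gamma>i"
        show ?thesis by (rule hi(2)[folded \<open>\<Gamma> = \<Gamma>i\<close>, rule_format, OF ab bspec[OF smalli]])
      qed
      show ?thesis
      proof (rule near_straight_star_element[OF _ _ _ arc _ _ K shape C less_imp_le[OF \<eta>(1)] \<eta>(2)])
        show "edge_paths K = [arc_path \<Gamma> \<alpha> \<beta>, linepath (par \<Gamma> \<beta>) c, linepath c (par \<Gamma> \<alpha>)]" by (simp add: Curved)
        show "straight_triangle K = convex hull {par \<Gamma> \<alpha>, par \<Gamma> \<beta>, c}" by (simp add: Curved straight_triangle_def)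
        show "\<not> collinear {par \<Gamma> \<alpha>, par \<Gamma> \<beta>, c}" using K Curved by simp
      qed (rule near_straight_linepath[OF less_imp_le[OF \<eta>(1)]])+
    qed
    with K show "is_element K \<and> (\<exists>x0 r s \<kappa>. star_element K x0 r s \<kappa> \<and> \<kappa> * h_el K \<le> 96 * C)" by blast
  qed (use hb(1) hi(1) in auto)
qed

section \<open>The trace inequality for smooth functions\<close>

text \<open>The polar map and its determinant live on \<open>real^2\<close>, iterated integrals on
  pairs. The map g identifies the two planes, carries boxes to boxes and preserves their
  content.\<close>

lemma integral_cbox_vec2:
  fixes f :: "real^2 \<Rightarrow> real"
  assumes cont: "continuous_on (cbox 0 1) f"
  shows "integral (cbox 0 1) f = integral {0..1} (\<lambda>t. integral {0..1} (\<lambda>r. f (vector [t, r])))"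
    and "(\<lambda>t. integral {0..1} (\<lambda>r. f (vector [t, r]))) integrable_on {0..1}"
proof -
  define g :: "real \<times> real \<Rightarrow> real^2" where "g p = (\<chi> i. if i = 1 then fst p else snd p)" for p
  define k :: "real^2 \<Rightarrow> real \<times> real" where "k x = (x$1, x$2)" for x
  have g12: "g p $ 1 = fst p" "g p $ 2 = snd p" for p by (simp_all add: g_def)
  have kg: "k (g p) = p" for p by (simp add: k_def g12)
  have gk: "g (k x) = x" for x by (simp add: vec_eq_iff forall_2 g12 k_def)
  have gv: "g (t, r) = vector [t, r]" for t r by (simp add: vec_eq_iff forall_2 g12)
  have contg: "continuous_on UNIV g"
  proof -
    have "continuous_on UNIV (\<lambda>p::real \<times> real. if i = 1 then fst p else snd p)" for i :: 2
      by (cases "i = 1") (simp_all add: continuous_on_fst continuous_on_snd continuous_on_id)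
    then show ?thesis unfolding g_def by (rule continuous_on_vec_lambda)
  qed
  have gimg: "g ` cbox u v = cbox (g u) (g v)" for u v
  proof
    show "g ` cbox u v \<subseteq> cbox (g u) (g v)"
      by (auto simp: cbox_interval less_eq_vec_def forall_2 g12 less_eq_prod_def)
    show "cbox (g u) (g v) \<subseteq> g ` cbox u v"
    proof
      fix x assume "x \<in> cbox (g u) (g v)"
      then have "k x \<in> cbox u v"
        by (cases u; cases v) (auto simp: mem_box_cart forall_2 g12 cbox_Pair_eq k_def)
      then show "x \<in> g ` cbox u v" by (metis gk imageI)
    qed
  qed
  have kimg: "k ` cbox u v = cbox (k u) (k v)" for u v
    using gimg[of "k u" "k v"] by (simp add: gk image_image kg flip: gimg) (metis (no_types, lifting) image_cong image_ident image_image kg gimg gk)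
  have content: "measure lborel (g ` cbox u v) = 1 * measure lborel (cbox u v)" for u v
  proof (cases "cbox u v = {}")
    case False
    obtain u1 u2 v1 v2 where uv: "u = (u1, u2)" "v = (v1, v2)" by (metis surj_pair)
    have le: "u1 \<le> v1" "u2 \<le> v2" using False by (auto simp: uv cbox_Pair_eq)
    have ne: "cbox (g u) (g v) \<noteq> {}" using False gimg[of u v] by auto
    have "measure lborel (g ` cbox u v) = (\<Prod>i\<in>UNIV. g v $ i - g u $ i)"
      unfolding gimg using ne by (rule content_cbox_cart)
    also have "\<dots> = (v1 - u1) * (v2 - u2)" by (simp add: UNIV_2 g12 uv)
    also have "\<dots> = measure lborel (cbox u v)" using le by (simp add: uv content_Pair)
    finally show ?thesis by simp
  qed simp
  have c0: "g (0, 0) = 0" "g (1, 1) = 1" by (simp_all add: vec_eq_iff forall_2 g12)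
  have "continuous_on (cbox (0, 0) (1, 1)) (\<lambda>p. f (g p))"
    by (rule continuous_on_compose2[OF cont continuous_on_subset[OF contg]])
      (use gimg[of "(0,0)" "(1,1)"] c0 in auto)
  then have cont': "continuous_on (cbox (0, 0) (1, 1)) (\<lambda>(t, r). f (vector [t, r]))"
    by (simp add: gv[symmetric] case_prod_beta)
  have "((\<lambda>p. f (g p)) has_integral (1 / 1) *\<^sub>R integral (cbox 0 1) f) (k ` cbox 0 1)"
  proof (rule has_integral_twiddle[OF _ kg gk _ _ _ content])
    show "isCont g x" for x using contg by (cases x) (simp add: continuous_on_eq_continuous_at)
    show "\<exists>w z. g ` cbox u v = cbox w z" for u v using gimg by blast
    show "\<exists>w z. k ` cbox u v = cbox w z" for u v using kimg by blast
    show "(f has_integral integral (cbox 0 1) f) (cbox 0 1)"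
      using cont by (intro integrable_integral integrable_continuous)
  qed simp
  moreover have "k ` cbox 0 1 = cbox (0, 0) (1, 1)" unfolding kimg by (simp add: k_def)
  ultimately have "integral (cbox 0 1) f = integral (cbox (0, 0) (1, 1)) (\<lambda>p. f (g p))"
    by (simp add: integral_unique)
  also have "(\<lambda>p. f (g p)) = (\<lambda>(t, r). f (vector [t, r]))"
    by (auto simp: gv fun_eq_iff)
  also have "integral (cbox (0, 0) (1, 1)) (\<lambda>(t, r). f (vector [t, r]))
      = integral (cbox 0 1) (\<lambda>t. integral (cbox 0 1) (\<lambda>r. f (vector [t, r])))"
    using integral_prod_continuous[OF cont'] by simp
  finally show "integral (cbox 0 1) f = integral {0..1} (\<lambda>t. integral {0..1} (\<lambda>r. f (vector [t, r])))" by simp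
  show "(\<lambda>t. integral {0..1} (\<lambda>r. f (vector [t, r]))) integrable_on {0..1}"
    using integral_integrable_2dim[OF cont'] by simp
qed

text \<open>Integrating the derivative along the ray leaves only the end value, since the weight r^2
  vanishes at y. Both terms of the derivative keep a factor r, the one that the polar Jacobian
  provides.\<close>

lemma square_le_radial_integral:
  fixes \<phi> :: "point \<Rightarrow> real"
  assumes der: "\<And>x. (\<phi> has_derivative (\<lambda>h. g x \<bullet> h)) (at x)" and cont: "continuous_on UNIV g"
    and w: "norm w \<le> D"
  shows "(\<phi> (y + w))\<^sup>2 \<le> integral {0..1} (\<lambda>r. r * (2 * (\<phi> (y + r *\<^sub>R w))\<^sup>2 + 2 * D * \<bar>\<phi> (y + r *\<^sub>R w)\<bar> * norm (g (y + r *\<^sub>R w))))"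
proof -
  have c\<phi>: "continuous_on UNIV \<phi>"
    using der by (meson continuous_at_imp_continuous_on has_derivative_continuous)
  let ?p = "\<lambda>r. y + r *\<^sub>R w"
  let ?F = "\<lambda>r. 2 * r * (\<phi> (?p r))\<^sup>2 + r\<^sup>2 * (2 * \<phi> (?p r) * (g (?p r) \<bullet> w))"
  have d1: "((\<lambda>r. \<phi> (?p r)) has_real_derivative (g (?p r) \<bullet> w)) (at r)" for r
  proof -
    have "(?p has_derivative (\<lambda>h. h *\<^sub>R w)) (at r)"
      by (auto intro!: derivative_eq_intros)
    from diff_chain_at[OF this der] have "((\<lambda>r. \<phi> (?p r)) has_derivative (\<lambda>h. g (?p r) \<bullet> (h *\<^sub>R w))) (at r)"
      by (simp add: o_def)
    then show ?thesis by (simp add: has_field_derivative_def mult.commute[of _ "g (?p r) \<bullet> w"])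
  qed
  have d2: "((\<lambda>r. r\<^sup>2 * (\<phi> (?p r))\<^sup>2) has_real_derivative ?F r) (at r)" for r
    by (rule derivative_eq_intros d1 refl | simp add: algebra_simps power2_eq_square)+
  have "((\<lambda>r. ?F r) has_integral (1\<^sup>2 * (\<phi> (?p 1))\<^sup>2 - 0\<^sup>2 * (\<phi> (?p 0))\<^sup>2)) {0..1}"
    by (rule fundamental_theorem_of_calculus)
      (use d2 in \<open>auto simp: has_real_derivative_iff_has_vector_derivative[symmetric] intro: has_field_derivative_at_within\<close>)
  then have eq: "(?F has_integral (\<phi> (y + w))\<^sup>2) {0..1}" by simp
  have "continuous_on {0..1} (\<lambda>r. r * (2 * (\<phi> (?p r))\<^sup>2 + 2 * D * \<bar>\<phi> (?p r)\<bar> * norm (g (?p r))))"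
    by (intro continuous_intros continuous_on_compose2[OF c\<phi>] continuous_on_compose2[OF cont]) auto
  then have int: "(\<lambda>r. r * (2 * (\<phi> (?p r))\<^sup>2 + 2 * D * \<bar>\<phi> (?p r)\<bar> * norm (g (?p r)))) integrable_on {0..1}"
    by (rule integrable_continuous_real)
  show ?thesis
  proof (rule has_integral_le[OF eq integrable_integral[OF int]])
    fix r :: real assume r: "r \<in> {0..1}"
    let ?f = "\<phi> (?p r)" and ?g = "g (?p r)"
    have "?f * (?g \<bullet> w) \<le> \<bar>?f\<bar> * (norm ?g * D)"
    proof -
      have "?f * (?g \<bullet> w) \<le> \<bar>?f\<bar> * \<bar>?g \<bullet> w\<bar>" by (metis abs_ge_self abs_mult)
      also have "\<dots> \<le> \<bar>?f\<bar> * (norm ?g * norm w)" by (intro mult_left_mono Cauchy_Schwarz_ineq2) auto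
      also have "\<dots> \<le> \<bar>?f\<bar> * (norm ?g * D)" using w by (intro mult_left_mono) auto
      finally show ?thesis .
    qed
    then have "r\<^sup>2 * (2 * (?f * (?g \<bullet> w))) \<le> r\<^sup>2 * (2 * (\<bar>?f\<bar> * (norm ?g * D)))"
      by (intro mult_left_mono) auto
    \<comment> \<open>One factor r is given up on [0, 1], so that both terms carry exactly the r of
      the Jacobian.\<close>
    also have "\<dots> \<le> r * (2 * (\<bar>?f\<bar> * (norm ?g * D)))"
    proof (rule mult_right_mono)
      show "r\<^sup>2 \<le> r" using r by (simp add: power2_eq_square mult_left_le)
      have "0 \<le> D" using w norm_ge_zero[of w] by linarith
      then show "0 \<le> 2 * (\<bar>?f\<bar> * (norm ?g * D))" by simp
    qed
    finally show "?F r \<le> r * (2 * ?f\<^sup>2 + 2 * D * \<bar>?f\<bar> * norm ?g)" by (simp add: algebra_simps)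
  qed
qed

text \<open>Polar coordinates about y. The open unit square is used because the side r = 0 collapses
  to y. The image is a sector that may be smaller than U, hence an inequality, for nonnegative
  H.\<close>

lemma integral_sector_le:
  fixes H :: "point \<Rightarrow> real"
  assumes vis: "visible_edge s y \<kappa> \<gamma>" "0 < \<kappa>"
    and contH: "continuous_on UNIV H" and nonneg: "\<And>x. 0 \<le> H x"
    and U: "\<And>t r. t \<in> {0<..<1} \<Longrightarrow> r \<in> {0<..<1} \<Longrightarrow> y + r *\<^sub>R (\<gamma> t - y) \<in> U"
    and int: "H integrable_on U"
  defines "F \<equiv> \<lambda>p::real^2. \<bar>p$2 * cross2 (\<gamma> (p$1) - y) (vector_derivative \<gamma> (at (p$1)))\<bar> * H (y + p$2 *\<^sub>R (\<gamma> (p$1) - y))"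
  shows "continuous_on (cbox 0 1) F" and "integral (cbox 0 1) F \<le> integral U H"
proof -
  let ?\<gamma>' = "\<lambda>t. vector_derivative \<gamma> (at t)"
  let ?\<Phi> = "\<lambda>p::real^2. y + p$2 *\<^sub>R (\<gamma> (p$1) - y)"
  let ?\<Phi>' = "\<lambda>p h::real^2. h$2 *\<^sub>R (\<gamma> (p$1) - y) + p$2 *\<^sub>R (h$1 *\<^sub>R ?\<gamma>' (p$1))"
  have dif: "(\<gamma> has_vector_derivative ?\<gamma>' t) (at t)" if "t \<in> {0..1}" for t
    using vis(1) that by (simp add: visible_edge_def vector_derivative_works)
  then have c\<gamma>: "continuous_on {0..1} \<gamma>"
    by (meson continuous_at_imp_continuous_on has_vector_derivative_continuous)
  have c\<gamma>': "continuous_on {0..1} ?\<gamma>'" using vis(1) by (simp add: visible_edge_def)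
  show contF: "continuous_on (cbox 0 1) F"
    unfolding F_def cross2_def
    by (intro continuous_intros continuous_on_compose2[OF contH] continuous_on_compose2[OF c\<gamma>]
        continuous_on_compose2[OF c\<gamma>']) (auto simp: mem_box_cart)
  have der: "(?\<Phi> has_derivative ?\<Phi>' p) (at p within box 0 1)" if p: "p \<in> box 0 1" for p
  proof -
    have "p$1 \<in> {0..1}" using p by (auto simp: mem_box_cart intro: less_imp_le)
    from dif[OF this] have "(\<gamma> has_derivative (\<lambda>h. h *\<^sub>R ?\<gamma>' (p$1))) (at (p$1))"
      by (simp add: has_vector_derivative_def)
    moreover have "((\<lambda>p::real^2. p$1) has_derivative (\<lambda>h. h$1)) (at p)"
      by (intro bounded_linear_imp_has_derivative bounded_linear_vec_nth)
    ultimately have g: "((\<lambda>p. \<gamma> (p$1)) has_derivative (\<lambda>h. h$1 *\<^sub>R ?\<gamma>' (p$1))) (at p)"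
      using diff_chain_at by (fastforce simp: o_def)
    have p2: "((\<lambda>p::real^2. p$2) has_derivative (\<lambda>h. h$2)) (at p)"
      by (intro bounded_linear_imp_has_derivative bounded_linear_vec_nth)
    have "((\<lambda>p. \<gamma> (p$1) - y) has_derivative (\<lambda>h. h$1 *\<^sub>R ?\<gamma>' (p$1))) (at p)"
      using has_derivative_diff[OF g has_derivative_const[of y]] by simp
    from has_derivative_add[OF has_derivative_const[of y] has_derivative_scaleR[OF p2 this]]
    have "(?\<Phi> has_derivative ?\<Phi>' p) (at p)" by (simp add: add.commute)
    then show ?thesis by (rule has_derivative_at_withinI)
  qed
  have det: "det (matrix (?\<Phi>' p)) = - (p$2 * cross2 (\<gamma> (p$1) - y) (?\<gamma>' (p$1)))" for p
    by (simp add: det_2 matrix_def axis_def cross2_def algebra_simps)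
  \<comment> \<open>Equal images lie on one line through y, which meets the edge once, so t agrees;
    then r agrees, as the edge avoids y.\<close>
  have inj: "inj_on ?\<Phi> (box 0 1)"
  proof (rule inj_onI)
    fix p q :: "real^2" assume pq: "p \<in> box 0 1" "q \<in> box 0 1" and eq: "?\<Phi> p = ?\<Phi> q"
    have p: "0 < p$1" "p$1 < 1" "0 < p$2" "p$2 < 1" using pq by (auto simp: mem_box_cart)
    have q: "0 < q$1" "q$1 < 1" "0 < q$2" "q$2 < 1" using pq by (auto simp: mem_box_cart)
    have eq': "p$2 *\<^sub>R (\<gamma> (p$1) - y) = q$2 *\<^sub>R (\<gamma> (q$1) - y)" using eq by simp
    then have "(1 / q$2) *\<^sub>R (p$2 *\<^sub>R (\<gamma> (p$1) - y)) = (1 / q$2) *\<^sub>R (q$2 *\<^sub>R (\<gamma> (q$1) - y))" by simp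
    then have "\<gamma> (q$1) - y = (p$2 / q$2) *\<^sub>R (\<gamma> (p$1) - y)" using q by simp
    then have 1: "p$1 = q$1"
      by (rule visible_edge_single[OF vis, rotated 2]) (use p q in auto)
    have "\<gamma> (q$1) \<noteq> y" by (rule visible_edge_not_center[OF vis]) (use q in auto)
    with eq' 1 have "p$2 = q$2" by simp
    with 1 show "p = q" by (simp add: vec_eq_iff forall_2)
  qed
  \<comment> \<open>Scalars are wrapped in \<open>real^1\<close>, the kind of value that the change
    of variables theorem speaks of.\<close>
  have Fbox: "(\<lambda>p. vec (F p) :: real^1) absolutely_integrable_on box 0 1"
  proof -
    have "(\<lambda>p. vec (F p) :: real^1) absolutely_integrable_on cbox 0 1"
      using contF by (intro absolutely_integrable_continuous) (simp add: vec_def continuous_on_vec_lambda)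
    then show ?thesis
      by (rule set_integrable_subset) (auto simp: box_subset_cbox)
  qed
  have FH: "\<bar>det (matrix (?\<Phi>' p))\<bar> *\<^sub>R vec (H (?\<Phi> p)) = (vec (F p) :: real^1)" for p
    unfolding det F_def by (simp add: vec_eq_iff)
  have "(\<lambda>x. vec (H x) :: real^1) absolutely_integrable_on ?\<Phi> ` box 0 1 \<and>
      integral (?\<Phi> ` box 0 1) (\<lambda>x. vec (H x) :: real^1) = integral (box 0 1) (\<lambda>p. vec (F p) :: real^1)"
    using has_absolute_integral_change_of_variables[where S="box 0 1" and g="?\<Phi>" and g'="?\<Phi>'"
        and f="\<lambda>x. vec (H x) :: real^1" and b="integral (box 0 1) (\<lambda>p. vec (F p) :: real^1)", OF _ der inj] Fbox
    unfolding FH by simp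
  then have ai: "(\<lambda>x. vec (H x) :: real^1) integrable_on ?\<Phi> ` box 0 1"
    and eq: "integral (?\<Phi> ` box 0 1) (\<lambda>x. vec (H x) :: real^1) = integral (box 0 1) (\<lambda>p. vec (F p) :: real^1)"
    by (auto simp: absolutely_integrable_on_def)
  have comp: "(\<lambda>x::real^1. x$1) \<circ> (\<lambda>x. vec (k x)) = k" for k :: "point \<Rightarrow> real" by (auto simp: o_def)
  have bl: "bounded_linear (\<lambda>x::real^1. x$1)" by (rule bounded_linear_vec_nth)
  have HI: "H integrable_on ?\<Phi> ` box 0 1"
    using integrable_linear[OF ai bl] unfolding comp .
  have eqH: "integral (?\<Phi> ` box 0 1) H = integral (box 0 1) F"
    using arg_cong[OF eq, of "\<lambda>x. x$1"]
      integral_linear[OF ai bl] integral_linear[OF _ bl, of "\<lambda>p. vec (F p)" "box 0 1"] Fbox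
    unfolding comp by (simp add: absolutely_integrable_on_def)
  have "integral (cbox 0 1) F = integral (box 0 1) F"
    by (simp add: integral_open_interval)
  also have "\<dots> \<le> integral U H" unfolding eqH[symmetric]
  proof (rule integral_subset_le[OF _ HI int])
    show "?\<Phi> ` box 0 1 \<subseteq> U" using U by (auto simp: mem_box_cart)
  qed (use nonneg in simp)
  finally show "integral (cbox 0 1) F \<le> integral U H" .
qed

text \<open>The radial bound at \<open>\<gamma> t\<close> is multiplied by the visibility estimate
  \<open>norm (\<gamma>' t) \<le> \<kappa> * J t\<close>; Fubini on the unit square recognizes the
  result as \<kappa> times the sector integral.\<close>

lemma visible_edge_trace:
  fixes \<phi> :: "point \<Rightarrow> real"
  assumes vis: "visible_edge s y \<kappa> \<gamma>" "0 < \<kappa>" and s: "\<bar>s\<bar> = 1"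
    and der: "\<And>x. (\<phi> has_derivative (\<lambda>h. g x \<bullet> h)) (at x)" and cont: "continuous_on UNIV g"
    and D: "\<And>t. t \<in> {0..1} \<Longrightarrow> norm (\<gamma> t - y) \<le> D"
    and U: "\<And>t r. t \<in> {0<..<1} \<Longrightarrow> r \<in> {0<..<1} \<Longrightarrow> y + r *\<^sub>R (\<gamma> t - y) \<in> U"
    and int: "(\<lambda>x. 2 * (\<phi> x)\<^sup>2 + 2 * D * \<bar>\<phi> x\<bar> * norm (g x)) integrable_on U"
  shows "integral {0..1} (\<lambda>t. (\<phi> (\<gamma> t))\<^sup>2 * norm (vector_derivative \<gamma> (at t)))
     \<le> \<kappa> * integral U (\<lambda>x. 2 * (\<phi> x)\<^sup>2 + 2 * D * \<bar>\<phi> x\<bar> * norm (g x))"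
proof -
  let ?\<gamma>' = "\<lambda>t. vector_derivative \<gamma> (at t)"
  define H where "H = (\<lambda>x. 2 * (\<phi> x)\<^sup>2 + 2 * D * \<bar>\<phi> x\<bar> * norm (g x))"
  define J where "J t = \<bar>cross2 (\<gamma> t - y) (?\<gamma>' t)\<bar>" for t
  have c\<phi>: "continuous_on UNIV \<phi>"
    using der by (meson continuous_at_imp_continuous_on has_derivative_continuous)
  have dif: "(\<gamma> has_vector_derivative ?\<gamma>' t) (at t)" if "t \<in> {0..1}" for t
    using vis(1) that by (simp add: visible_edge_def vector_derivative_works)
  then have c\<gamma>: "continuous_on {0..1} \<gamma>"
    by (meson continuous_at_imp_continuous_on has_vector_derivative_continuous)
  have c\<gamma>': "continuous_on {0..1} ?\<gamma>'" using vis(1) by (simp add: visible_edge_def)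
  have "norm (\<gamma> 0 - y) \<le> D" by (rule D) simp
  then have "0 \<le> D" by (rule order_trans[OF norm_ge_zero])
  then have nonneg: "0 \<le> H x" for x by (simp add: H_def)
  have contH: "continuous_on UNIV H" unfolding H_def by (intro continuous_intros c\<phi> cont)
  let ?F = "\<lambda>p::real^2. \<bar>p$2 * cross2 (\<gamma> (p$1) - y) (?\<gamma>' (p$1))\<bar> * H (y + p$2 *\<^sub>R (\<gamma> (p$1) - y))"
  note sec = integral_sector_le[OF vis contH nonneg U int[folded H_def]]
  note fub = integral_cbox_vec2[OF sec(1)]
  have inner: "integral {0..1} (\<lambda>r. ?F (vector [t, r])) = J t * integral {0..1} (\<lambda>r. r * H (y + r *\<^sub>R (\<gamma> t - y)))" for t
  proof -
    have "integral {0..1} (\<lambda>r. ?F (vector [t, r])) = integral {0..1} (\<lambda>r. J t * (r * H (y + r *\<^sub>R (\<gamma> t - y))))"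
      by (rule integral_cong) (simp add: J_def abs_mult)
    then show ?thesis by simp
  qed
  have contL: "continuous_on {0..1} (\<lambda>t. (\<phi> (\<gamma> t))\<^sup>2 * norm (?\<gamma>' t))"
    by (intro continuous_intros continuous_on_compose2[OF c\<phi> c\<gamma>] c\<gamma>') auto
  have "integral {0..1} (\<lambda>t. (\<phi> (\<gamma> t))\<^sup>2 * norm (?\<gamma>' t)) \<le> integral {0..1} (\<lambda>t. \<kappa> * integral {0..1} (\<lambda>r. ?F (vector [t, r])))"
  proof (rule integral_le)
    show "(\<lambda>t. (\<phi> (\<gamma> t))\<^sup>2 * norm (?\<gamma>' t)) integrable_on {0..1}"
      using contL by (rule integrable_continuous_real)
    show "(\<lambda>t. \<kappa> * integral {0..1} (\<lambda>r. ?F (vector [t, r]))) integrable_on {0..1}"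
      using integrable_cmul[OF fub(2), of \<kappa>] by simp
    fix t :: real assume t: "t \<in> {0..1}"
    have 1: "(\<phi> (\<gamma> t))\<^sup>2 \<le> integral {0..1} (\<lambda>r. r * H (y + r *\<^sub>R (\<gamma> t - y)))"
      using square_le_radial_integral[OF der cont D[OF t], of y] by (simp add: H_def)
    have "norm (?\<gamma>' t) \<le> \<kappa> * (s * cross2 (\<gamma> t - y) (?\<gamma>' t))"
      using vis(1) t by (simp add: visible_edge_def)
    also have "\<dots> \<le> \<kappa> * J t"
      unfolding J_def using vis(2) s abs_ge_self[of "s * cross2 (\<gamma> t - y) (?\<gamma>' t)"]
      by (intro mult_left_mono) (simp_all add: abs_mult)
    finally have 2: "norm (?\<gamma>' t) \<le> \<kappa> * J t" .
    have "(\<phi> (\<gamma> t))\<^sup>2 * norm (?\<gamma>' t) \<le> integral {0..1} (\<lambda>r. r * H (y + r *\<^sub>R (\<gamma> t - y))) * (\<kappa> * J t)"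
      using 1 2 order_trans[OF zero_le_power2 1] by (intro mult_mono) auto
    then show "(\<phi> (\<gamma> t))\<^sup>2 * norm (?\<gamma>' t) \<le> \<kappa> * integral {0..1} (\<lambda>r. ?F (vector [t, r]))"
      unfolding inner by (simp add: algebra_simps)
  qed
  also have "\<dots> = \<kappa> * integral {0..1} (\<lambda>t. integral {0..1} (\<lambda>r. ?F (vector [t, r])))"
    by (rule integral_mult_right)
  also have "\<dots> = \<kappa> * integral (cbox 0 1) ?F" by (simp only: fub(1))
  also have "\<dots> \<le> \<kappa> * integral U H" using sec(2) vis(2) by (intro mult_left_mono) auto
  finally show "integral {0..1} (\<lambda>t. (\<phi> (\<gamma> t))\<^sup>2 * norm (?\<gamma>' t))
     \<le> \<kappa> * integral U (\<lambda>x. 2 * (\<phi> x)\<^sup>2 + 2 * D * \<bar>\<phi> x\<bar> * norm (g x))"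
    unfolding H_def .
qed

section \<open>Smooth functions\<close>

text \<open>\<open>Ck_on\<close> passes to another function at each level, so the induction on k
  runs over a class P closed under directional derivatives; no higher derivative is ever
  computed.\<close>

lemma smooth_coinduct:
  assumes "P f"
    and "\<And>f. P f \<Longrightarrow> (\<forall>x. f differentiable (at x)) \<and> (\<forall>v. P (\<lambda>x. frechet_derivative f (at x) v))"
  shows "smooth f"
proof -
  have "\<forall>f. P f \<longrightarrow> Ck_on k UNIV f" for k
  proof (induction k)
    case 0
    show ?case
    proof (intro allI impI)
      fix f assume "P f"
      then have "\<forall>x. f differentiable (at x)" using assms(2) by blast
      then show "Ck_on 0 UNIV f"
        by (auto intro!: continuous_at_imp_continuous_on differentiable_imp_continuous_within)
    qed
  next
    case (Suc k)
    then show ?case using assms(2) by auto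
  qed
  then show ?thesis using assms(1) unfolding smooth_def by blast
qed

lemma smooth_differentiable: "smooth f \<Longrightarrow> f differentiable (at x)"
  unfolding smooth_def by (metis Ck_on.simps(2) UNIV_I)

lemma smooth_derivative: "smooth f \<Longrightarrow> smooth (\<lambda>x. frechet_derivative f (at x) v)"
  unfolding smooth_def by (metis Ck_on.simps(2))

lemma smooth_has_derivative: "smooth f \<Longrightarrow> (f has_derivative frechet_derivative f (at x)) (at x)"
  using smooth_differentiable frechet_derivative_works by blast

lemma smooth_continuous: "smooth f \<Longrightarrow> continuous_on S f"
  unfolding smooth_def by (metis Ck_on.simps(1) continuous_on_subset subset_UNIV)

section \<open>Closure properties of smooth functions\<close>

lemma Ck_on_SucD: "Ck_on (Suc k) UNIV f \<Longrightarrow> Ck_on k UNIV f"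
proof (induction k arbitrary: f)
  case 0
  from "0.prems" have "continuous_on UNIV f" by (rule Ck_on_imp_continuous_on)
  then show ?case by simp
next
  case (Suc k)
  have d: "\<forall>x. f differentiable (at x)" and c: "\<And>v. Ck_on (Suc k) UNIV (\<lambda>x. frechet_derivative f (at x) v)"
    using Suc.prems by (simp_all del: Ck_on.simps(2) add: Ck_on.simps(2)[of "Suc k"])
  show ?case unfolding Ck_on.simps(2) using d Suc.IH[OF c] by simp
qed

lemma Ck_on_add:
  "Ck_on k UNIV f \<Longrightarrow> Ck_on k UNIV g \<Longrightarrow> Ck_on k UNIV (\<lambda>x. f x + g x)"
proof (induction k arbitrary: f g)
  case 0
  then show ?case by (simp add: continuous_on_add)
next
  case (Suc k)
  have d: "(f has_derivative frechet_derivative f (at x)) (at x)" "(g has_derivative frechet_derivative g (at x)) (at x)" for x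
    using Suc.prems unfolding frechet_derivative_works[symmetric] by simp_all
  have e: "frechet_derivative (\<lambda>x. f x + g x) (at x) = (\<lambda>v. frechet_derivative f (at x) v + frechet_derivative g (at x) v)" for x
    by (rule frechet_derivative_at[OF has_derivative_add[OF d], symmetric])
  show ?case using Suc by (auto simp: e)
qed

lemma Ck_on_mult:
  fixes f g :: "'a::euclidean_space \<Rightarrow> real"
  shows "Ck_on k UNIV f \<Longrightarrow> Ck_on k UNIV g \<Longrightarrow> Ck_on k UNIV (\<lambda>x. f x * g x)"
proof (induction k arbitrary: f g)
  case 0
  then show ?case by (simp add: continuous_on_mult)
next
  case (Suc k)
  have d: "(f has_derivative frechet_derivative f (at x)) (at x)" "(g has_derivative frechet_derivative g (at x)) (at x)" for x
    using Suc.prems unfolding frechet_derivative_works[symmetric] by simp_all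
  have e: "frechet_derivative (\<lambda>x. f x * g x) (at x) = (\<lambda>v. f x * frechet_derivative g (at x) v + frechet_derivative f (at x) v * g x)" for x
    by (rule frechet_derivative_at[OF has_derivative_mult[OF d], symmetric])
  have "(\<lambda>x. f x * g x) differentiable (at x)" for x
    using has_derivative_mult[OF d] by (rule differentiableI)
  moreover have "Ck_on k UNIV (\<lambda>x. f x * frechet_derivative g (at x) v + frechet_derivative f (at x) v * g x)" for v
    using Suc.prems Ck_on_SucD[OF Suc.prems(1)] Ck_on_SucD[OF Suc.prems(2)]
    by (intro Ck_on_add Suc.IH) auto
  ultimately show ?case by (simp add: e)
qed

lemma Ck_on_const: "Ck_on k UNIV (\<lambda>_. c)"
proof (induction k arbitrary: c)
  case (Suc k)
  then show ?case by (simp add: frechet_derivative_const)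
qed simp

lemma smooth_add: "smooth f \<Longrightarrow> smooth g \<Longrightarrow> smooth (\<lambda>x. f x + g x)"
  by (simp add: smooth_def Ck_on_add)

lemma smooth_mult:
  fixes f g :: "'a::euclidean_space \<Rightarrow> real"
  shows "smooth f \<Longrightarrow> smooth g \<Longrightarrow> smooth (\<lambda>x. f x * g x)"
  by (simp add: smooth_def Ck_on_mult)

lemma smooth_const: "smooth (\<lambda>_. c)"
  by (simp add: smooth_def Ck_on_const)

text \<open>A directional derivative is again a smooth function composed with the same affine map,
  so these compositions form the invariant class.\<close>

lemma smooth_affine:
  fixes f :: "'b::euclidean_space \<Rightarrow> 'c::real_normed_vector"
  assumes "smooth f" and A: "bounded_linear A"
  shows "smooth (\<lambda>x. f (A x + b))"
proof (rule smooth_coinduct[where P="\<lambda>h. \<exists>f. smooth f \<and> h = (\<lambda>x. f (A x + b))"])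
  fix h assume "\<exists>f. smooth f \<and> h = (\<lambda>x. f (A x + b))"
  then obtain f where f: "smooth f" and h: "h = (\<lambda>x. f (A x + b))" by blast
  have "((\<lambda>x. A x + b) has_derivative A) (at x)" for x
    using has_derivative_add[OF bounded_linear_imp_has_derivative[OF A] has_derivative_const[of b]] by simp
  from diff_chain_at[OF this smooth_has_derivative[OF f]]
  have d: "(h has_derivative (\<lambda>v. frechet_derivative f (at (A x + b)) (A v))) (at x)" for x
    by (simp add: o_def h)
  then have "\<forall>x. h differentiable (at x)" by (metis differentiableI)
  moreover have "(\<lambda>x. frechet_derivative h (at x) v) = (\<lambda>x. frechet_derivative f (at (A x + b)) (A v))" for v
    using frechet_derivative_at[OF d, symmetric] by simp
  then have "\<exists>f. smooth f \<and> (\<lambda>x. frechet_derivative h (at x) v) = (\<lambda>x. f (A x + b))" for v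
    using smooth_derivative[OF f, of "A v"] by (intro exI[of _ "\<lambda>z. frechet_derivative f (at z) (A v)"]) simp
  ultimately show "(\<forall>x. h differentiable (at x)) \<and> (\<forall>v. \<exists>f. smooth f \<and> (\<lambda>x. frechet_derivative h (at x) v) = (\<lambda>x. f (A x + b)))"
    by blast
qed (use assms in blast)

text \<open>The classical exp(-1/t), divided by powers of t so that the derivatives of the family
  are linear combinations of its members.\<close>

definition flat :: "nat \<Rightarrow> real \<Rightarrow> real" where
  "flat n t = (if 0 < t then exp (- 1 / t) / t ^ n else 0)"

lemma flat_tendsto_0: "(flat n \<longlongrightarrow> 0) (at_right 0)"
proof -
  have "((\<lambda>t. (inverse t) ^ n / exp (inverse t)) \<longlongrightarrow> (0::real)) (at_right 0)"
    by (rule filterlim_compose[OF tendsto_power_div_exp_0 filterlim_inverse_at_top_right])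
  moreover have "\<forall>\<^sub>F t in at_right (0::real). (inverse t) ^ n / exp (inverse t) = flat n t"
    unfolding eventually_at_right_field
    by (rule exI[of _ 1]) (auto simp: flat_def exp_minus divide_simps power_inverse)
  ultimately show ?thesis by (rule Lim_transform_eventually)
qed

text \<open>Away from 0 this is calculus. At 0 the right difference quotient of
  \<open>flat n\<close> is \<open>flat (n + 1)\<close>, which tends to 0, and the left one is
  0.\<close>

lemma flat_has_derivative:
  "(flat n has_real_derivative (flat (n + 2) t - of_nat n * flat (n + 1) t)) (at t)"
proof (cases t "0::real" rule: linorder_cases)
  case less
  have "((\<lambda>_. 0) has_real_derivative 0) (at t)" by simp
  then have "(flat n has_real_derivative 0) (at t)"
    by (rule has_field_derivative_transform_within_open[where S="{..<0}"]) (use less in \<open>auto simp: flat_def\<close>)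
  then show ?thesis using less by (simp add: flat_def)
next
  case equal
  have "((\<lambda>h. (flat n (0 + h) - flat n 0) / h) \<longlongrightarrow> 0) (at (0::real))"
    unfolding filterlim_at_split
  proof
    show "((\<lambda>h. (flat n (0 + h) - flat n 0) / h) \<longlongrightarrow> 0) (at_right 0)"
    proof (rule Lim_transform_eventually[OF flat_tendsto_0[of "n + 1"]])
      show "\<forall>\<^sub>F h in at_right 0. flat (n + 1) h = (flat n (0 + h) - flat n 0) / h"
        unfolding eventually_at_right_field by (rule exI[of _ 1]) (auto simp: flat_def)
    qed
    show "((\<lambda>h. (flat n (0 + h) - flat n 0) / h) \<longlongrightarrow> 0) (at_left 0)"
    proof (rule Lim_transform_eventually[OF tendsto_const])
      show "\<forall>\<^sub>F h in at_left 0. 0 = (flat n (0 + h) - flat n 0) / h"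
        unfolding eventually_at_left_field by (rule exI[of _ "-1"]) (auto simp: flat_def)
    qed
  qed
  then have "(flat n has_real_derivative 0) (at 0)" by (simp add: DERIV_def)
  then show ?thesis using equal by (simp add: flat_def)
next
  case greater
  have "((\<lambda>t. exp (- 1 / t) / t ^ n) has_real_derivative
      (exp (- 1 / t) * (1 / t\<^sup>2) * t ^ n - exp (- 1 / t) * (of_nat n * t ^ (n - 1))) / (t ^ n * t ^ n)) (at t)"
    using greater by (auto intro!: derivative_eq_intros simp: power2_eq_square)
  moreover have "(exp (- 1 / t) * (1 / t\<^sup>2) * t ^ n - exp (- 1 / t) * (of_nat n * t ^ (n - 1))) / (t ^ n * t ^ n)
      = flat (n + 2) t - of_nat n * flat (n + 1) t"
    using greater by (cases n) (simp_all add: flat_def field_simps power2_eq_square)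
  ultimately have "((\<lambda>t. exp (- 1 / t) / t ^ n) has_real_derivative (flat (n + 2) t - of_nat n * flat (n + 1) t)) (at t)"
    by simp
  then show ?thesis
    by (rule has_field_derivative_transform_within_open[where S="{0<..}"]) (use greater in \<open>auto simp: flat_def\<close>)
qed

lemma smooth_flat: "smooth (flat n)"
proof -
  have "Ck_on k UNIV (flat n)" for k
  proof (induction k arbitrary: n)
    case 0
    have "isCont (flat n) t" for t using flat_has_derivative DERIV_isCont by blast
    then show ?case by (simp add: continuous_at_imp_continuous_on)
  next
    case (Suc k)
    have d: "(flat n has_derivative (\<lambda>v. (flat (n + 2) t - of_nat n * flat (n + 1) t) * v)) (at t)" for t
      using flat_has_derivative[of n t] by (simp add: has_field_derivative_def)
    have "frechet_derivative (flat n) (at t) v = flat (n + 2) t * v + flat (n + 1) t * (- of_nat n * v)" for t v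
      using frechet_derivative_at[OF d, symmetric] by (simp add: algebra_simps)
    moreover have "Ck_on k UNIV (\<lambda>t. flat (n + 2) t * v + flat (n + 1) t * (- of_nat n * v))" for v
      by (intro Ck_on_add Ck_on_mult Suc.IH Ck_on_const)
    moreover have "flat n differentiable (at t)" for t using d by (rule differentiableI)
    ultimately show ?case by simp
  qed
  then show ?thesis by (simp add: smooth_def)
qed

text \<open>A product of one-dimensional bumps vanishing off the square [-1, 1]^2, which lies in the
  ball of radius 2.\<close>

lemma smooth_bump_exists:
  obtains \<rho> :: "point \<Rightarrow> real" where "smooth \<rho>" "\<And>x. 0 \<le> \<rho> x" "\<And>x. 2 \<le> norm x \<Longrightarrow> \<rho> x = 0" "0 < \<rho> 0"
proof
  let ?\<rho> = "\<lambda>x::point. (flat 0 (1 - x$1) * flat 0 (1 + x$1)) * (flat 0 (1 - x$2) * flat 0 (1 + x$2))"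
  have s: "smooth (\<lambda>x::point. flat 0 (1 - x$i))" "smooth (\<lambda>x::point. flat 0 (1 + x$i))" for i
    using smooth_affine[OF smooth_flat bounded_linear_minus[OF bounded_linear_vec_nth], of 0 i 1]
      smooth_affine[OF smooth_flat bounded_linear_vec_nth, of 0 i 1] by (simp_all add: add.commute)
  show "smooth ?\<rho>" by (intro smooth_mult s)
  show "0 \<le> ?\<rho> x" for x by (simp add: flat_def)
  show "0 < ?\<rho> 0" by (simp add: flat_def)
  show "?\<rho> x = 0" if "2 \<le> norm x" for x :: point
  proof -
    have "norm x \<le> \<bar>x$1\<bar> + \<bar>x$2\<bar>" using norm_le_l1_cart[of x] by (simp add: sum_2)
    with that have "1 \<le> \<bar>x$1\<bar> \<or> 1 \<le> \<bar>x$2\<bar>" by linarith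
    then show ?thesis by (auto simp: flat_def abs_real_def split: if_splits)
  qed
qed

section \<open>Gradients, and uniform estimates for compactly supported functions\<close>

lemma grad_inner:
  assumes "smooth \<phi>"
  shows "frechet_derivative \<phi> (at x) h = grad \<phi> x \<bullet> h"
proof -
  have lin: "linear (frechet_derivative \<phi> (at x))"
    using smooth_has_derivative[OF assms] has_derivative_linear by blast
  have "h = h$1 *\<^sub>R axis 1 1 + h$2 *\<^sub>R axis 2 1"
    by (simp add: vec_eq_iff forall_2 axis_def)
  then have "frechet_derivative \<phi> (at x) h = frechet_derivative \<phi> (at x) (h$1 *\<^sub>R axis 1 1 + h$2 *\<^sub>R axis 2 1)"
    by simp
  also have "\<dots> = h$1 * frechet_derivative \<phi> (at x) (axis 1 1) + h$2 * frechet_derivative \<phi> (at x) (axis 2 1)"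
    by (simp add: linear_add[OF lin] linear_cmul[OF lin])
  also have "\<dots> = grad \<phi> x \<bullet> h" by (simp add: grad_def inner_vec_def sum_2)
  finally show ?thesis .
qed

lemma smooth_grad_has_derivative:
  "smooth \<phi> \<Longrightarrow> (\<phi> has_derivative (\<lambda>h. grad \<phi> x \<bullet> h)) (at x)"
proof -
  assume "smooth \<phi>"
  then have "frechet_derivative \<phi> (at x) = (\<lambda>h. grad \<phi> x \<bullet> h)" by (simp add: fun_eq_iff grad_inner)
  with smooth_has_derivative[OF \<open>smooth \<phi>\<close>, of x] show ?thesis by simp
qed

lemma smooth_grad_nth: "smooth \<phi> \<Longrightarrow> smooth (\<lambda>x. grad \<phi> x $ i)"
  by (simp add: grad_def smooth_derivative)

lemma smooth_grad_continuous: "smooth \<phi> \<Longrightarrow> continuous_on S (grad \<phi>)"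
proof -
  assume "smooth \<phi>"
  then have "continuous_on S (\<lambda>x. \<chi> i. grad \<phi> x $ i)"
    by (intro continuous_on_vec_lambda smooth_continuous smooth_grad_nth)
  then show ?thesis by simp
qed

lemma grad_unique:
  assumes "(\<phi> has_derivative (\<lambda>h. g \<bullet> h)) (at x)"
  shows "grad \<phi> x = g"
  using frechet_derivative_at[OF assms, symmetric] by (simp add: grad_def vec_eq_iff inner_axis)

lemma bounded_of_compact_support:
  fixes k :: "point \<Rightarrow> 'a::real_normed_vector"
  assumes "continuous_on UNIV k" "\<And>z. R < norm z \<Longrightarrow> k z = 0"
  obtains B where "\<And>z. norm (k z) \<le> B"
proof -
  have "compact (k ` cball 0 R)"
    by (intro compact_continuous_image continuous_on_subset[OF assms(1)]) auto
  then have "bounded (k ` cball 0 R)" by (rule compact_imp_bounded)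
  then obtain B where "\<forall>x\<in>k ` cball 0 R. norm x \<le> B" unfolding bounded_iff by (elim exE)
  then have B: "norm (k z) \<le> B" if "z \<in> cball 0 R" for z using that by simp
  have "norm (k z) \<le> \<bar>B\<bar>" for z
    using B[of z] assms(2)[of z] by (cases "norm z \<le> R") auto
  then show ?thesis by (rule that)
qed

lemma uniformly_continuous_of_compact_support:
  fixes k :: "point \<Rightarrow> 'a::real_normed_vector"
  assumes cont: "continuous_on UNIV k" and supp: "\<And>z. R < norm z \<Longrightarrow> k z = 0" and "0 < e"
  obtains d where "0 < d" "\<And>z w. dist z w < d \<Longrightarrow> dist (k z) (k w) < e"
proof -
  \<comment> \<open>The extra 1 is a safety margin: if two points are less than 1 apart and one lies
    beyond R + 1, both lie beyond R, where k vanishes.\<close>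
  have "uniformly_continuous_on (cball 0 (R + 1)) k"
    by (intro compact_uniformly_continuous continuous_on_subset[OF cont]) auto
  then have "\<exists>d>0. \<forall>x\<in>cball 0 (R + 1). \<forall>x'\<in>cball 0 (R + 1). dist x' x < d \<longrightarrow> dist (k x') (k x) < e"
    using \<open>0 < e\<close> unfolding uniformly_continuous_on_def by simp
  then obtain d where d: "0 < d"
    "\<forall>x\<in>cball 0 (R + 1). \<forall>x'\<in>cball 0 (R + 1). dist x' x < d \<longrightarrow> dist (k x') (k x) < e"
    by (elim exE conjE)
  show ?thesis
  proof (rule that[of "min d 1"])
    fix z w :: point assume zw: "dist z w < min d 1"
    show "dist (k z) (k w) < e"
    proof (cases "z \<in> cball 0 (R + 1) \<and> w \<in> cball 0 (R + 1)")
      case True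
      then show ?thesis using d(2)[rule_format, of w z] zw by simp
    next
      case False
      have "norm z \<le> norm w + dist z w" "norm w \<le> norm z + dist z w"
        using norm_triangle_ineq2[of z w] norm_triangle_ineq2[of w z] by (simp_all add: dist_norm norm_minus_commute)
      then have "R < norm z" "R < norm w" using False zw by auto
      then show ?thesis using supp \<open>0 < e\<close> by simp
    qed
  qed (use d in simp)
qed

lemma grad_support:
  assumes "smooth k" "\<And>z. R < norm z \<Longrightarrow> k z = 0" "R < norm z"
  shows "grad k z = 0"
proof (rule grad_unique)
  have o: "open {z::point. R < norm z}" by (intro open_Collect_less continuous_intros)
  have "((\<lambda>_. 0::real) has_derivative (\<lambda>h. 0 \<bullet> h)) (at z)" by simp
  then show "(k has_derivative (\<lambda>h. 0 \<bullet> h)) (at z)"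
    by (rule has_derivative_transform_within_open[OF _ o]) (use assms(2,3) in auto)
qed

text \<open>Uniform continuity of the gradient makes the remainder uniform in z, so that it can be
  integrated against a merely integrable density.\<close>

lemma smooth_uniform_linearization:
  assumes k: "smooth k" and supp: "\<And>z. R < norm z \<Longrightarrow> k z = 0" and "0 < e"
  obtains d where "0 < d" "\<And>z h. norm h < d \<Longrightarrow> \<bar>k (z + h) - k z - grad k z \<bullet> h\<bar> \<le> e * norm h"
proof -
  have gs: "grad k z = 0" if "R < norm z" for z by (rule grad_support[where R=R, OF k supp that])
  obtain d where d: "0 < d" "\<And>z w. dist z w < d \<Longrightarrow> dist (grad k z) (grad k w) < e"
    by (rule uniformly_continuous_of_compact_support[where R=R, OF smooth_grad_continuous[OF k] gs \<open>0 < e\<close>]) (assumption, rule that)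
  show ?thesis
  proof (rule that[OF d(1)])
    fix z h :: point assume h: "norm h < d"
    have "norm ((k (z + h) - grad k z \<bullet> (z + h)) - (k z - grad k z \<bullet> z)) \<le> e * norm (z + h - z)"
    proof (rule differentiable_bound[where S="ball z d" and f'="\<lambda>w v. (grad k w - grad k z) \<bullet> v"])
      fix w assume w: "w \<in> ball z d"
      have "((\<lambda>w. grad k z \<bullet> w) has_derivative (\<lambda>v. grad k z \<bullet> v)) (at w)"
        by (intro bounded_linear_imp_has_derivative bounded_linear_inner_right)
      from has_derivative_diff[OF smooth_grad_has_derivative[OF k] this]
      show "((\<lambda>w. k w - grad k z \<bullet> w) has_derivative (\<lambda>v. (grad k w - grad k z) \<bullet> v)) (at w within ball z d)"
        by (simp add: inner_diff_left has_derivative_at_withinI)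
      show "onorm (\<lambda>v. (grad k w - grad k z) \<bullet> v) \<le> e"
      proof (rule onorm_le)
        fix v :: point
        have "norm ((grad k w - grad k z) \<bullet> v) \<le> norm (grad k w - grad k z) * norm v"
          using Cauchy_Schwarz_ineq2 by simp
        also have "\<dots> \<le> e * norm v"
          using d(2)[of w z] w by (intro mult_right_mono) (auto simp: dist_norm norm_minus_commute)
        finally show "norm ((grad k w - grad k z) \<bullet> v) \<le> e * norm v" .
      qed
    qed (use h d(1) in \<open>auto simp: dist_norm\<close>)
    then show "\<bar>k (z + h) - k z - grad k z \<bullet> h\<bar> \<le> e * norm h"
      by (simp add: inner_add_right algebra_simps)
  qed
qed

section \<open>Convolution with a smooth kernel\<close>

lemma integrable_mult_bounded_continuous:
  fixes v :: "point \<Rightarrow> real" and k :: "point \<Rightarrow> real"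
  assumes v: "integrable (lebesgue_on U) v" and U: "U \<in> sets lebesgue"
    and k: "continuous_on UNIV k" "\<And>z. \<bar>k z\<bar> \<le> B"
  shows "integrable (lebesgue_on U) (\<lambda>y. v y * k y)"
proof (rule Bochner_Integration.integrable_bound)
  show "integrable (lebesgue_on U) (\<lambda>y. B * v y)" using v by simp
  have "k \<in> borel_measurable (lebesgue_on U)"
    by (rule continuous_imp_measurable_on_sets_lebesgue[OF continuous_on_subset[OF k(1)] U]) simp
  then show "(\<lambda>y. v y * k y) \<in> borel_measurable (lebesgue_on U)"
    using v by (intro borel_measurable_times) auto
  show "AE y in lebesgue_on U. norm (v y * k y) \<le> norm (B * v y)"
  proof (rule AE_I2)
    fix y
    have "\<bar>k y\<bar> \<le> \<bar>B\<bar>" using k(2)[of y] by linarith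
    then show "norm (v y * k y) \<le> norm (B * v y)"
      unfolding real_norm_def abs_mult mult.commute[of "\<bar>v y\<bar>"] by (rule mult_right_mono) simp
  qed
qed

lemma convolution_integrable:
  fixes v :: "point \<Rightarrow> real"
  assumes v: "integrable (lebesgue_on U) v" and U: "U \<in> sets lebesgue"
    and k: "continuous_on UNIV k" "\<And>z. R < norm z \<Longrightarrow> k z = 0"
  shows "integrable (lebesgue_on U) (\<lambda>y. v y * k (x - y))"
proof -
  obtain B where "\<And>z. norm (k z) \<le> B" by (rule bounded_of_compact_support[where R=R, OF k]) (assumption, rule that)
  then show ?thesis
    by (intro integrable_mult_bounded_continuous[OF v U, where B=B] continuous_on_compose2[OF k(1)] continuous_intros) auto
qed

text \<open>Differentiation under the integral: the uniform remainder of the kernel integrated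
  against |v| is at most e |h| N/(N + 1). Using N + 1 instead of N covers the case N = 0.\<close>

lemma convolution_has_derivative:
  fixes v :: "point \<Rightarrow> real"
  assumes v: "integrable (lebesgue_on U) v" and U: "U \<in> sets lebesgue"
    and k: "smooth k" "\<And>z. R < norm z \<Longrightarrow> k z = 0"
  shows "((\<lambda>x. LINT y|lebesgue_on U. v y * k (x - y)) has_derivative
      (\<lambda>h. (\<chi> i. LINT y|lebesgue_on U. v y * grad k (x - y) $ i) \<bullet> h)) (at x)"
proof -
  let ?F = "\<lambda>x. LINT y|lebesgue_on U. v y * k (x - y)"
  let ?g = "(\<chi> i. LINT y|lebesgue_on U. v y * grad k (x - y) $ i) :: point"
  have ik: "integrable (lebesgue_on U) (\<lambda>y. v y * k (x - y))" for x
    by (rule convolution_integrable[OF v U smooth_continuous[OF k(1)] k(2)])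
  have ig: "integrable (lebesgue_on U) (\<lambda>y. v y * grad k (x - y) $ i)" for i
    by (rule convolution_integrable[OF v U smooth_continuous[OF smooth_grad_nth[OF k(1)]], where R=R])
      (simp add: grad_support[OF k])
  define N where "N = (LINT y|lebesgue_on U. \<bar>v y\<bar>)"
  have N: "0 \<le> N" by (simp add: N_def)
  have gh: "?g \<bullet> h = (LINT y|lebesgue_on U. v y * (grad k (x - y) \<bullet> h))" 
    and igh: "integrable (lebesgue_on U) (\<lambda>y. v y * (grad k (x - y) \<bullet> h))" for h
  proof -
    have e: "v y * (grad k (x - y) \<bullet> h) = (v y * grad k (x - y) $ 1) * h$1 + (v y * grad k (x - y) $ 2) * h$2" for y
      by (simp add: inner_vec_def sum_2 algebra_simps)
    show "integrable (lebesgue_on U) (\<lambda>y. v y * (grad k (x - y) \<bullet> h))"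
      unfolding e using ig by (intro Bochner_Integration.integrable_add integrable_mult_left) auto
    show "?g \<bullet> h = (LINT y|lebesgue_on U. v y * (grad k (x - y) \<bullet> h))"
      unfolding e using ig by (simp add: inner_vec_def sum_2)
  qed
  show ?thesis
    unfolding has_derivative_at_alt
  proof (intro conjI allI impI)
    show "bounded_linear (\<lambda>h. ?g \<bullet> h)" by (rule bounded_linear_inner_right)
    fix e :: real assume "0 < e"
    then have eN: "0 < e / (N + 1)" using N by simp
    obtain d where d: "0 < d" "\<And>z h. norm h < d \<Longrightarrow> \<bar>k (z + h) - k z - grad k z \<bullet> h\<bar> \<le> e / (N + 1) * norm h"
      by (rule smooth_uniform_linearization[where R=R, OF k eN]) (assumption, rule that)
    show "\<exists>d>0. \<forall>y. norm (y - x) < d \<longrightarrow> norm (?F y - ?F x - ?g \<bullet> (y - x)) \<le> e * norm (y - x)"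
    proof (intro exI conjI allI impI)
      fix z assume z: "norm (z - x) < d"
      let ?h = "z - x"
      let ?r = "\<lambda>y. k ((x - y) + ?h) - k (x - y) - grad k (x - y) \<bullet> ?h"
      have "?F z - ?F x - ?g \<bullet> ?h = (LINT y|lebesgue_on U. v y * k (z - y) - v y * k (x - y) - v y * (grad k (x - y) \<bullet> ?h))"
        unfolding gh using ik igh by simp
      also have "\<dots> = (LINT y|lebesgue_on U. v y * ?r y)"
        by (rule Bochner_Integration.integral_cong) (simp_all add: algebra_simps)
      also have "norm \<dots> \<le> (LINT y|lebesgue_on U. e / (N + 1) * norm ?h * \<bar>v y\<bar>)"
      proof (rule order_trans[OF integral_norm_bound integral_mono])
        have "(\<lambda>y. v y * ?r y) = (\<lambda>y. v y * k (z - y) - v y * k (x - y) - v y * (grad k (x - y) \<bullet> ?h))"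
          by (simp add: fun_eq_iff algebra_simps)
        then show "integrable (lebesgue_on U) (\<lambda>y. norm (v y * ?r y))" using ik igh by simp
        show "integrable (lebesgue_on U) (\<lambda>y. e / (N + 1) * norm ?h * \<bar>v y\<bar>)" using v by simp
        fix y
        have "\<bar>v y\<bar> * \<bar>?r y\<bar> \<le> \<bar>v y\<bar> * (e / (N + 1) * norm ?h)"
          by (rule mult_left_mono[OF d(2)[OF z]]) simp
        then show "norm (v y * ?r y) \<le> e / (N + 1) * norm ?h * \<bar>v y\<bar>" by (simp add: abs_mult mult.commute)
      qed
      also have "\<dots> = (e * norm ?h) * (N / (N + 1))" by (simp add: N_def)
      also have "\<dots> \<le> (e * norm ?h) * 1"
        using N \<open>0 < e\<close> by (intro mult_left_mono) auto
      finally show "norm (?F z - ?F x - ?g \<bullet> (z - x)) \<le> e * norm (z - x)" by simp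
    qed (rule d(1))
  qed
qed

text \<open>Each derivative falls on the kernel, which stays smooth with support in the same ball; v
  is never differentiated.\<close>

lemma smooth_convolution:
  fixes v :: "point \<Rightarrow> real"
  assumes v: "integrable (lebesgue_on U) v" and U: "U \<in> sets lebesgue"
    and k: "smooth k" "\<And>z. R < norm z \<Longrightarrow> k z = 0"
  shows "smooth (\<lambda>x. LINT y|lebesgue_on U. v y * k (x - y))"
proof (rule smooth_coinduct[where P="\<lambda>f. \<exists>k. smooth k \<and> (\<forall>z. R < norm z \<longrightarrow> k z = 0) \<and> f = (\<lambda>x. LINT y|lebesgue_on U. v y * k (x - y))"])
  fix f assume "\<exists>k. smooth k \<and> (\<forall>z. R < norm z \<longrightarrow> k z = 0) \<and> f = (\<lambda>x. LINT y|lebesgue_on U. v y * k (x - y))"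
  then obtain k where k: "smooth k" "\<And>z. R < norm z \<Longrightarrow> k z = 0" and f: "f = (\<lambda>x. LINT y|lebesgue_on U. v y * k (x - y))"
    by blast
  note d = convolution_has_derivative[OF v U k, folded f]
  have dif: "\<forall>x. f differentiable (at x)" using differentiableI[OF d] by simp
  have "\<exists>k. smooth k \<and> (\<forall>z. R < norm z \<longrightarrow> k z = 0) \<and> (\<lambda>x. frechet_derivative f (at x) h) = (\<lambda>x. LINT y|lebesgue_on U. v y * k (x - y))" for h
  proof (intro exI conjI allI impI)
    let ?k = "\<lambda>z. frechet_derivative k (at z) h"
    show "smooth ?k" by (rule smooth_derivative[OF k(1)])
    show "?k z = 0" if "R < norm z" for z using grad_support[OF k that] by (simp add: grad_inner[OF k(1)])
    show "(\<lambda>x. frechet_derivative f (at x) h) = (\<lambda>x. LINT y|lebesgue_on U. v y * ?k (x - y))"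
    proof
      fix x
      have ig: "integrable (lebesgue_on U) (\<lambda>y. v y * grad k (x - y) $ i)" for i
        by (rule convolution_integrable[OF v U smooth_continuous[OF smooth_grad_nth[OF k(1)]], where R=R])
          (simp add: grad_support[OF k])
      have e: "v y * ?k (x - y) = (v y * grad k (x - y) $ 1) * h$1 + (v y * grad k (x - y) $ 2) * h$2" for y
        by (simp add: grad_inner[OF k(1)] inner_vec_def sum_2 algebra_simps)
      have "frechet_derivative f (at x) h = (\<chi> i. LINT y|lebesgue_on U. v y * grad k (x - y) $ i) \<bullet> h"
        by (rule fun_cong[OF frechet_derivative_at[OF d], symmetric])
      then show "frechet_derivative f (at x) h = (LINT y|lebesgue_on U. v y * ?k (x - y))"
        unfolding e using ig by (simp add: inner_vec_def sum_2)
    qed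
  qed
  note dv = this
  show "(\<forall>x. f differentiable (at x)) \<and> (\<forall>h. \<exists>k. smooth k \<and> (\<forall>z. R < norm z \<longrightarrow> k z = 0) \<and>
      (\<lambda>x. frechet_derivative f (at x) h) = (\<lambda>x. LINT y|lebesgue_on U. v y * k (x - y)))"
    by (rule conjI[OF dif allI[OF dv]])
next
  show "\<exists>k'. smooth k' \<and> (\<forall>z. R < norm z \<longrightarrow> k' z = 0) \<and>
      (\<lambda>x. LINT y|lebesgue_on U. v y * k (x - y)) = (\<lambda>x. LINT y|lebesgue_on U. v y * k' (x - y))"
    by (intro exI[of _ k] conjI allI impI refl k)
qed

section \<open>Approximation in \<open>L\<^sup>2\<close>\<close>

lemma square_diff_le: "(a - c)\<^sup>2 \<le> 2 * (a - b)\<^sup>2 + 2 * (b - c :: real)\<^sup>2"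
proof -
  have "0 \<le> ((a - b) - (b - c))\<^sup>2" by simp
  then show ?thesis by (simp add: power2_eq_square algebra_simps)
qed

lemma integrable_square_diff:
  fixes f g :: "'a \<Rightarrow> real"
  assumes "f \<in> borel_measurable M" "g \<in> borel_measurable M"
    "integrable M (\<lambda>x. (f x)\<^sup>2)" "integrable M (\<lambda>x. (g x)\<^sup>2)"
  shows "integrable M (\<lambda>x. (f x - g x)\<^sup>2)"
proof (rule Bochner_Integration.integrable_bound)
  show "integrable M (\<lambda>x. 2 * (f x)\<^sup>2 + 2 * (g x)\<^sup>2)" using assms by simp
  show "AE x in M. norm ((f x - g x)\<^sup>2) \<le> norm (2 * (f x)\<^sup>2 + 2 * (g x)\<^sup>2)"
    using square_diff_le[of _ _ 0] by (intro AE_I2) simp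
qed (use assms in simp)

lemma integral_square_diff_le:
  fixes f g h :: "'a \<Rightarrow> real"
  assumes "f \<in> borel_measurable M" "g \<in> borel_measurable M" "h \<in> borel_measurable M"
    "integrable M (\<lambda>x. (f x)\<^sup>2)" "integrable M (\<lambda>x. (g x)\<^sup>2)" "integrable M (\<lambda>x. (h x)\<^sup>2)"
  shows "(LINT x|M. (f x - h x)\<^sup>2) \<le> 2 * (LINT x|M. (f x - g x)\<^sup>2) + 2 * (LINT x|M. (g x - h x)\<^sup>2)"
proof -
  have i: "integrable M (\<lambda>x. (f x - g x)\<^sup>2)" "integrable M (\<lambda>x. (g x - h x)\<^sup>2)" "integrable M (\<lambda>x. (f x - h x)\<^sup>2)"
    using assms by (auto intro: integrable_square_diff)
  have "(LINT x|M. (f x - h x)\<^sup>2) \<le> (LINT x|M. 2 * (f x - g x)\<^sup>2 + 2 * (g x - h x)\<^sup>2)"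
    using i square_diff_le by (intro integral_mono) auto
  also have "\<dots> = 2 * (LINT x|M. (f x - g x)\<^sup>2) + 2 * (LINT x|M. (g x - h x)\<^sup>2)"
    using i by simp
  finally show ?thesis .
qed

lemma (in finite_measure) integrable_of_square:
  fixes f :: "'a \<Rightarrow> real"
  assumes "f \<in> borel_measurable M" "integrable M (\<lambda>x. (f x)\<^sup>2)"
  shows "integrable M f"
proof (rule Bochner_Integration.integrable_bound)
  show "integrable M (\<lambda>x. 1 + (f x)\<^sup>2)" using assms by simp
  show "AE x in M. norm (f x) \<le> norm (1 + (f x)\<^sup>2)"
  proof (rule AE_I2)
    fix x
    have "0 \<le> (\<bar>f x\<bar> - 1)\<^sup>2" by simp
    then have "2 * \<bar>f x\<bar> \<le> 1 + (f x)\<^sup>2" by (simp add: power2_eq_square algebra_simps)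
    then show "norm (f x) \<le> norm (1 + (f x)\<^sup>2)" by simp
  qed
qed (rule assms)

section \<open>Density of bounded continuous functions in L^2\<close>

definition clamp_real :: "real \<Rightarrow> real \<Rightarrow> real" where
  "clamp_real c x = max (- c) (min c x)"

text \<open>Two applications of dominated convergence: f is cut off at height n, with f^2 as
  dominating function, and the cut-off is then approximated almost everywhere by continuous
  functions. The squared triangle inequality doubles both errors, so d/4 is allowed for
  each.\<close>

lemma continuous_approx_L2:
  fixes f :: "point \<Rightarrow> real"
  assumes U: "U \<in> lmeasurable" and f: "f \<in> borel_measurable (lebesgue_on U)"
    and int: "integrable (lebesgue_on U) (\<lambda>x. (f x)\<^sup>2)" and "0 < d"
  shows "\<exists>g B. continuous_on UNIV g \<and> (\<forall>x. \<bar>g x\<bar> \<le> B) \<and> (LINT x|lebesgue_on U. (f x - g x)\<^sup>2) < d"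
proof -
  let ?M = "lebesgue_on U"
  have US: "U \<in> sets lebesgue" using U by (rule fmeasurableD)
  interpret finite_measure ?M using U by (rule finite_measure_lebesgue_on)
  have mc: "(\<lambda>x. clamp_real c (h x)) \<in> borel_measurable ?M" if "h \<in> borel_measurable ?M" for h :: "point \<Rightarrow> real" and c
    unfolding clamp_real_def using that by measurable
  let ?f = "\<lambda>n x. clamp_real (real n) (f x)"
  have "(\<lambda>n. LINT x|?M. (f x - ?f n x)\<^sup>2) \<longlonglongrightarrow> (LINT x|?M. 0)"
  proof (rule integral_dominated_convergence[OF _ _ int])
    show "AE x in ?M. (\<lambda>n. (f x - ?f n x)\<^sup>2) \<longlonglongrightarrow> 0"
    proof (rule AE_I2)
      fix x
      obtain N :: nat where N: "\<bar>f x\<bar> \<le> real N" using real_arch_simple by blast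
      have "(f x - ?f n x)\<^sup>2 = 0" if "N \<le> n" for n
        using N that by (auto simp: clamp_real_def)
      then show "(\<lambda>n. (f x - ?f n x)\<^sup>2) \<longlonglongrightarrow> 0"
        by (intro tendsto_eventually) (auto simp: eventually_sequentially)
    qed
    show "AE x in ?M. norm ((f x - ?f n x)\<^sup>2) \<le> (f x)\<^sup>2" for n
    proof (rule AE_I2)
      fix x
      have "\<bar>f x - ?f n x\<bar> \<le> \<bar>f x\<bar>" by (auto simp: clamp_real_def)
      then show "norm ((f x - ?f n x)\<^sup>2) \<le> (f x)\<^sup>2" by (simp add: abs_le_square_iff[symmetric])
    qed
    show "(\<lambda>x. (f x - ?f n x)\<^sup>2) \<in> borel_measurable ?M" for n using f mc[OF f] by measurable
  qed simp
  then have lim1: "(\<lambda>n. LINT x|?M. (f x - ?f n x)\<^sup>2) \<longlonglongrightarrow> 0" by simp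
  from order_tendstoD(2)[OF lim1, of "d/4"] \<open>0 < d\<close> obtain n where n: "(LINT x|?M. (f x - ?f n x)\<^sup>2) < d/4"
    by (auto simp: eventually_sequentially)
  define c where "c = real n"
  define F where "F x = ?f n x" for x
  have F: "F \<in> borel_measurable ?M" unfolding F_def by (rule mc[OF f])
  have Fb: "\<bar>F x\<bar> \<le> c" for x by (auto simp: F_def clamp_real_def c_def)
  from F US have "F measurable_on U" by (simp add: measurable_on_iff_borel_measurable)
  then obtain N g where N: "negligible N" and g: "\<And>n. continuous_on UNIV (g n)"
    and lim: "\<And>x. x \<notin> N \<Longrightarrow> (\<lambda>n. g n x) \<longlonglongrightarrow> (if x \<in> U then F x else 0)"
    unfolding measurable_on_def by blast
  \<comment> \<open>Clamped at the height of F: the limit is unchanged, and a constant now dominates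
    on the finite measure.\<close>
  let ?g = "\<lambda>n x. clamp_real c (g n x)"
  have gc: "continuous_on UNIV (?g n)" for n unfolding clamp_real_def
    by (intro continuous_intros g)
  have gm: "?g n \<in> borel_measurable ?M" for n
    by (rule continuous_imp_measurable_on_sets_lebesgue[OF continuous_on_subset[OF gc] US]) simp
  have gb: "\<bar>?g n x\<bar> \<le> c" for n x by (auto simp: clamp_real_def c_def)
  have "(\<lambda>n. LINT x|?M. (F x - ?g n x)\<^sup>2) \<longlonglongrightarrow> (LINT x|?M. 0)"
  proof (rule integral_dominated_convergence[where w="\<lambda>_. (2 * c)\<^sup>2"])
    have "AE x in lebesgue. x \<notin> N" using N by (simp add: negligible_iff_null_sets AE_not_in)
    then have "AE x in lebesgue. x \<in> U \<longrightarrow> x \<notin> N" by eventually_elim simp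
    then have "AE x in ?M. x \<notin> N" using US by (simp add: AE_restrict_space_iff)
    moreover have "AE x in ?M. x \<in> U" using US by (intro AE_I2) (simp add: space_restrict_space)
    ultimately show "AE x in ?M. (\<lambda>n. (F x - ?g n x)\<^sup>2) \<longlonglongrightarrow> 0"
    proof eventually_elim
      fix x assume "x \<notin> N" "x \<in> U"
      with lim[of x] have "(\<lambda>n. g n x) \<longlonglongrightarrow> F x" by simp
      then have "(\<lambda>n. ?g n x) \<longlonglongrightarrow> clamp_real c (F x)" unfolding clamp_real_def
        by (intro tendsto_max tendsto_min tendsto_const)
      moreover have "clamp_real c (F x) = F x" using Fb[of x] by (auto simp: clamp_real_def)
      ultimately have "(\<lambda>n. (F x - ?g n x)\<^sup>2) \<longlonglongrightarrow> (F x - F x)\<^sup>2"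
        by (intro tendsto_intros) simp
      then show "(\<lambda>n. (F x - ?g n x)\<^sup>2) \<longlonglongrightarrow> 0" by simp
    qed
    show "AE x in ?M. norm ((F x - ?g n x)\<^sup>2) \<le> (2 * c)\<^sup>2" for n
    proof (rule AE_I2)
      fix x
      have "\<bar>F x - ?g n x\<bar> \<le> \<bar>2 * c\<bar>" using Fb[of x] gb[of n x] by linarith
      then have "(F x - ?g n x)\<^sup>2 \<le> (2 * c)\<^sup>2" by (simp only: abs_le_square_iff)
      then show "norm ((F x - ?g n x)\<^sup>2) \<le> (2 * c)\<^sup>2" by simp
    qed
    show "(\<lambda>x. (F x - ?g n x)\<^sup>2) \<in> borel_measurable ?M" for n using F gm[of n] by measurable
  qed simp_all
  then have lim2: "(\<lambda>n. LINT x|?M. (F x - ?g n x)\<^sup>2) \<longlonglongrightarrow> 0" by simp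
  from order_tendstoD(2)[OF lim2, of "d/4"] \<open>0 < d\<close> obtain j where j: "(LINT x|?M. (F x - ?g j x)\<^sup>2) < d/4"
    by (auto simp: eventually_sequentially)
  have bi: "integrable ?M (\<lambda>x. (h x)\<^sup>2)" if "h \<in> borel_measurable ?M" "\<And>x. \<bar>h x\<bar> \<le> c" for h :: "point \<Rightarrow> real"
  proof (rule integrable_const_bound[where B="c\<^sup>2"])
    show "AE x in ?M. norm ((h x)\<^sup>2) \<le> c\<^sup>2"
    proof (rule AE_I2)
      fix x
      have "\<bar>h x\<bar> \<le> \<bar>c\<bar>" using that(2)[of x] by linarith
      then have "(h x)\<^sup>2 \<le> c\<^sup>2" by (simp only: abs_le_square_iff)
      then show "norm ((h x)\<^sup>2) \<le> c\<^sup>2" by simp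
    qed
  qed (use that in measurable)
  have "(LINT x|?M. (f x - ?g j x)\<^sup>2) \<le> 2 * (LINT x|?M. (f x - F x)\<^sup>2) + 2 * (LINT x|?M. (F x - ?g j x)\<^sup>2)"
    by (intro integral_square_diff_le f F gm int bi Fb gb)
  also have "\<dots> < d" using n j by (simp add: F_def)
  finally have "(LINT x|?M. (f x - ?g j x)\<^sup>2) < d" .
  with gc gb show ?thesis by (intro exI[of _ "?g j"] exI[of _ c]) simp
qed

text \<open>Since \<open>k x\<close> is a probability density, expanding \<open>0 \<le> \<integral> (f - a)\<^sup>2 k x\<close> with \<open>a = \<integral> f k x\<close> gives
  \<open>a\<^sup>2 \<le> \<integral> f\<^sup>2 k x\<close>.\<close>

lemma kernel_operator_L2_bound:
  fixes k :: "point \<Rightarrow> point \<Rightarrow> real" and f :: "point \<Rightarrow> real"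
  assumes U: "U \<in> lmeasurable" and f: "f \<in> borel_measurable (lebesgue_on U)"
    and int: "integrable (lebesgue_on U) (\<lambda>x. (f x)\<^sup>2)"
    and k: "continuous_on UNIV (\<lambda>p. k (fst p) (snd p))" "\<And>x y. 0 \<le> k x y" "\<And>x y. k x y \<le> B"
    and one: "\<And>x. x \<in> U \<Longrightarrow> (LINT y|lebesgue_on U. k x y) = 1"
    and C: "\<And>y. (\<integral>\<^sup>+x. ennreal (k x y) \<partial>lebesgue_on U) \<le> ennreal C" "0 \<le> C"
    and T: "(\<lambda>x. LINT y|lebesgue_on U. f y * k x y) \<in> borel_measurable (lebesgue_on U)"
  shows "integrable (lebesgue_on U) (\<lambda>x. (LINT y|lebesgue_on U. f y * k x y)\<^sup>2)"
    and "(LINT x|lebesgue_on U. (LINT y|lebesgue_on U. f y * k x y)\<^sup>2) \<le> C * (LINT x|lebesgue_on U. (f x)\<^sup>2)"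
proof -
  let ?M = "lebesgue_on U"
  let ?T = "\<lambda>x. LINT y|?M. f y * k x y"
  have US: "U \<in> sets lebesgue" using U by (rule fmeasurableD)
  interpret finite_measure ?M using U by (rule finite_measure_lebesgue_on)
  interpret P: pair_sigma_finite ?M ?M ..
  have kx: "continuous_on UNIV (k x)" for x
    by (rule continuous_on_compose2[OF k(1), where f="\<lambda>y. (x, y)", simplified]) (intro continuous_intros)
  have kabs: "\<bar>k x y\<bar> \<le> B" for x y using k(2,3)[of x y] by simp
  have i1: "integrable ?M f" by (rule integrable_of_square[OF f int])
  have ik: "integrable ?M (k x)" for x
    using integrable_mult_bounded_continuous[OF integrable_const US kx kabs, of 1 x] by simp
  have ifk: "integrable ?M (\<lambda>y. f y * k x y)" for x
    by (rule integrable_mult_bounded_continuous[OF i1 US kx kabs])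
  have iffk: "integrable ?M (\<lambda>y. (f y)\<^sup>2 * k x y)" for x
    by (rule integrable_mult_bounded_continuous[OF int US kx kabs])
  have jensen: "(?T x)\<^sup>2 \<le> (LINT y|?M. (f y)\<^sup>2 * k x y)" if "x \<in> U" for x
  proof -
    let ?a = "?T x"
    have "0 \<le> (LINT y|?M. (f y - ?a)\<^sup>2 * k x y)" using k(2) by (intro integral_nonneg_AE AE_I2) simp
    also have "\<dots> = (LINT y|?M. (f y)\<^sup>2 * k x y - 2 * ?a * (f y * k x y) + ?a\<^sup>2 * k x y)"
      by (rule Bochner_Integration.integral_cong) (simp_all add: power2_eq_square algebra_simps)
    also have "\<dots> = (LINT y|?M. (f y)\<^sup>2 * k x y) - 2 * ?a * ?a + ?a\<^sup>2 * (LINT y|?M. k x y)"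
      using iffk ifk ik by simp
    finally show ?thesis using one[OF that] by (simp add: power2_eq_square)
  qed
  have m2: "(\<lambda>(x, y). ennreal ((f y)\<^sup>2 * k x y)) \<in> borel_measurable (?M \<Otimes>\<^sub>M ?M)"
  proof -
    have id: "(\<lambda>x. x) \<in> ?M \<rightarrow>\<^sub>M borel"
      by (rule continuous_imp_measurable_on_sets_lebesgue[OF continuous_on_id US])
    have "(\<lambda>p. (fst p, snd p)) \<in> ?M \<Otimes>\<^sub>M ?M \<rightarrow>\<^sub>M borel \<Otimes>\<^sub>M (borel :: point measure)"
      by (intro measurable_Pair measurable_compose[OF measurable_fst id] measurable_compose[OF measurable_snd id])
    then have "(\<lambda>p. (fst p, snd p)) \<in> ?M \<Otimes>\<^sub>M ?M \<rightarrow>\<^sub>M (borel :: (point \<times> point) measure)"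
      by (simp add: borel_prod)
    from measurable_compose[OF this borel_measurable_continuous_onI[OF k(1)]]
    have mk: "(\<lambda>p. k (fst p) (snd p)) \<in> borel_measurable (?M \<Otimes>\<^sub>M ?M)" by simp
    have "(\<lambda>p. f (snd p)) \<in> borel_measurable (?M \<Otimes>\<^sub>M ?M)"
      by (rule measurable_compose[OF measurable_snd f])
    with mk have "(\<lambda>p. ennreal ((f (snd p))\<^sup>2 * k (fst p) (snd p))) \<in> borel_measurable (?M \<Otimes>\<^sub>M ?M)"
      by measurable
    then show ?thesis by (simp add: case_prod_beta)
  qed
  have "(\<integral>\<^sup>+x. ennreal ((?T x)\<^sup>2) \<partial>?M) \<le> (\<integral>\<^sup>+x. (\<integral>\<^sup>+y. ennreal ((f y)\<^sup>2 * k x y) \<partial>?M) \<partial>?M)"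
  proof (rule nn_integral_mono)
    fix x assume "x \<in> space ?M"
    then have "x \<in> U" using US by (simp add: space_restrict_space)
    have "(\<integral>\<^sup>+y. ennreal ((f y)\<^sup>2 * k x y) \<partial>?M) = ennreal (LINT y|?M. (f y)\<^sup>2 * k x y)"
      using k(2) by (intro nn_integral_eq_integral iffk AE_I2) simp
    then show "ennreal ((?T x)\<^sup>2) \<le> (\<integral>\<^sup>+y. ennreal ((f y)\<^sup>2 * k x y) \<partial>?M)"
      using jensen[OF \<open>x \<in> U\<close>] by (simp add: ennreal_leI)
  qed
  \<comment> \<open>Schur test: rows of mass one gave \<open>jensen\<close>; after Tonelli's
    exchange the columns, of mass at most C, remain.\<close>
  also have "\<dots> = (\<integral>\<^sup>+y. (\<integral>\<^sup>+x. ennreal ((f y)\<^sup>2 * k x y) \<partial>?M) \<partial>?M)"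
    using P.Fubini'[OF m2] by simp
  also have "\<dots> \<le> (\<integral>\<^sup>+y. ennreal ((f y)\<^sup>2) * ennreal C \<partial>?M)"
  proof (rule nn_integral_mono)
    fix y
    have ky: "continuous_on UNIV (\<lambda>x. k x y)"
      by (rule continuous_on_compose2[OF k(1), where f="\<lambda>x. (x, y)", simplified]) (intro continuous_intros)
    have "(\<lambda>x. k x y) \<in> borel_measurable ?M"
      by (rule continuous_imp_measurable_on_sets_lebesgue[OF continuous_on_subset[OF ky] US]) simp
    then have "(\<integral>\<^sup>+x. ennreal ((f y)\<^sup>2) * ennreal (k x y) \<partial>?M) = ennreal ((f y)\<^sup>2) * (\<integral>\<^sup>+x. ennreal (k x y) \<partial>?M)"
      by (intro nn_integral_cmult) measurable
    moreover have "(\<integral>\<^sup>+x. ennreal ((f y)\<^sup>2 * k x y) \<partial>?M) = (\<integral>\<^sup>+x. ennreal ((f y)\<^sup>2) * ennreal (k x y) \<partial>?M)"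
      using k(2) by (simp add: ennreal_mult)
    ultimately show "(\<integral>\<^sup>+x. ennreal ((f y)\<^sup>2 * k x y) \<partial>?M) \<le> ennreal ((f y)\<^sup>2) * ennreal C"
      using C(1) by (simp add: mult_left_mono)
  qed
  also have "\<dots> = (\<integral>\<^sup>+y. ennreal ((f y)\<^sup>2) \<partial>?M) * ennreal C"
    using f by (intro nn_integral_multc) measurable
  also have "(\<integral>\<^sup>+y. ennreal ((f y)\<^sup>2) \<partial>?M) = ennreal (LINT y|?M. (f y)\<^sup>2)"
    by (intro nn_integral_eq_integral int AE_I2) simp
  also have "ennreal (LINT y|?M. (f y)\<^sup>2) * ennreal C = ennreal (C * (LINT y|?M. (f y)\<^sup>2))"
    using C(2) by (simp add: ennreal_mult' mult.commute)
  finally have le: "(\<integral>\<^sup>+x. ennreal ((?T x)\<^sup>2) \<partial>?M) \<le> ennreal (C * (LINT y|?M. (f y)\<^sup>2))" .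
  show I: "integrable ?M (\<lambda>x. (?T x)\<^sup>2)"
  proof (rule integrableI_bounded)
    show "(\<lambda>x. (?T x)\<^sup>2) \<in> borel_measurable ?M" using T by measurable
    have "(\<integral>\<^sup>+x. ennreal (norm ((?T x)\<^sup>2)) \<partial>?M) = (\<integral>\<^sup>+x. ennreal ((?T x)\<^sup>2) \<partial>?M)" by simp
    also have "\<dots> < \<infinity>" using le by (rule le_less_trans) simp
    finally show "(\<integral>\<^sup>+x. ennreal (norm ((?T x)\<^sup>2)) \<partial>?M) < \<infinity>" .
  qed
  have "ennreal (LINT x|?M. (?T x)\<^sup>2) = (\<integral>\<^sup>+x. ennreal ((?T x)\<^sup>2) \<partial>?M)"
    by (intro nn_integral_eq_integral[symmetric] I AE_I2) simp
  with le have "ennreal (LINT x|?M. (?T x)\<^sup>2) \<le> ennreal (C * (LINT y|?M. (f y)\<^sup>2))" by simp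
  moreover have "0 \<le> C * (LINT y|?M. (f y)\<^sup>2)" using C(2) by simp
  ultimately show "(LINT x|?M. (?T x)\<^sup>2) \<le> C * (LINT x|?M. (f x)\<^sup>2)"
    by (simp add: ennreal_le_iff)
qed

section \<open>Mollification on a star-shaped domain\<close>

lemma nn_integral_lborel_affine:
  fixes f :: "point \<Rightarrow> ennreal"
  assumes f: "f \<in> borel_measurable borel" and c: "c \<noteq> 0"
  shows "(\<integral>\<^sup>+x. f x \<partial>lborel) = ennreal (c\<^sup>2) * (\<integral>\<^sup>+z. f (t + c *\<^sub>R z) \<partial>lborel)"
proof -
  have m: "(\<lambda>z. t + c *\<^sub>R z) \<in> borel_measurable (lborel :: point measure)" by simp
  have "(\<integral>\<^sup>+x. f x \<partial>lborel) = (\<integral>\<^sup>+x. f x \<partial>density (distr lborel borel (\<lambda>z. t + c *\<^sub>R z)) (\<lambda>_. ennreal (\<bar>c\<bar> ^ DIM(point))))"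
    using lborel_affine[OF c, of t] by simp
  also have "\<dots> = (\<integral>\<^sup>+x. ennreal (\<bar>c\<bar> ^ DIM(point)) * f x \<partial>distr lborel borel (\<lambda>z. t + c *\<^sub>R z))"
    using f by (intro nn_integral_density) auto
  also have "\<dots> = (\<integral>\<^sup>+z. ennreal (\<bar>c\<bar> ^ DIM(point)) * f (t + c *\<^sub>R z) \<partial>lborel)"
    using f m by (intro nn_integral_distr) auto
  also have "\<dots> = ennreal (\<bar>c\<bar> ^ DIM(point)) * (\<integral>\<^sup>+z. f (t + c *\<^sub>R z) \<partial>lborel)"
    using measurable_compose[OF m f] by (intro nn_integral_cmult) simp
  finally show ?thesis by simp
qed

text \<open>The mass is a nonnegative integral, so the condition includes integrability.\<close>

definition mollifier :: "(point \<Rightarrow> real) \<Rightarrow> bool" where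
  "mollifier \<rho> \<longleftrightarrow> smooth \<rho> \<and> (\<forall>x. 0 \<le> \<rho> x) \<and> (\<forall>x. 2 \<le> norm x \<longrightarrow> \<rho> x = 0) \<and>
     (\<integral>\<^sup>+x. ennreal (\<rho> x) \<partial>lborel) = 1"

text \<open>The bump has finite mass, being bounded with bounded support, and positive mass,
  exceeding half its central value near 0; dividing by the mass normalizes it.\<close>

lemma mollifier_exists: "\<exists>\<rho>. mollifier \<rho>"
proof -
  obtain \<rho> :: "point \<Rightarrow> real" where \<rho>: "smooth \<rho>" "\<And>x. 0 \<le> \<rho> x" "\<And>x. 2 \<le> norm x \<Longrightarrow> \<rho> x = 0" "0 < \<rho> 0"
    by (rule smooth_bump_exists) (rule that)
  have cont: "continuous_on UNIV \<rho>" by (rule smooth_continuous[OF \<rho>(1)])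
  have m: "\<rho> \<in> borel_measurable borel" by (rule borel_measurable_continuous_onI[OF cont])
  have supp: "\<rho> z = 0" if "2 < norm z" for z using \<rho>(3) that by simp
  obtain B where B: "\<And>z. norm (\<rho> z) \<le> B"
    by (rule bounded_of_compact_support[where R=2, OF cont supp]) (assumption, rule that)
  let ?I = "\<integral>\<^sup>+x. ennreal (\<rho> x) \<partial>lborel"
  have "?I \<le> (\<integral>\<^sup>+x. ennreal B * indicator (cball 0 2) x \<partial>(lborel :: point measure))"
  proof (rule nn_integral_mono)
    fix x :: point
    show "ennreal (\<rho> x) \<le> ennreal B * indicator (cball 0 2) x"
      using B[of x] \<rho>(3)[of x] by (cases "x \<in> cball 0 2") (auto intro!: ennreal_leI)
  qed
  also have "\<dots> = ennreal B * emeasure lborel (cball (0::point) 2)"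
    by (intro nn_integral_cmult_indicator) simp
  also have "\<dots> < \<infinity>"
    using emeasure_bounded_finite[OF bounded_cball, of "0::point" 2] by (simp add: ennreal_mult_less_top)
  finally have fin: "?I < \<infinity>" .
  have "isCont \<rho> 0" using cont by (simp add: continuous_on_eq_continuous_at)
  then have "eventually (\<lambda>x. \<rho> 0 / 2 < \<rho> x) (nhds 0)"
    using \<rho>(4) by (intro order_tendstoD(1)[where y="\<rho> 0"]) (simp_all add: isCont_def continuous_at tendsto_nhds_iff)
  then obtain e where e: "0 < e" "\<And>x. dist x 0 < e \<Longrightarrow> \<rho> 0 / 2 < \<rho> x"
    unfolding eventually_nhds_metric by blast
  have "0 < ennreal (\<rho> 0 / 2) * emeasure lborel (ball (0::point) e)"
  proof -
    have "0 < measure lborel (ball (0::point) e)" using e(1) by (rule content_ball_pos)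
    then have "emeasure lborel (ball (0::point) e) \<noteq> 0" by (auto simp: measure_def)
    then show ?thesis using \<rho>(4) by (simp add: zero_less_iff_neq_zero)
  qed
  also have "\<dots> = (\<integral>\<^sup>+x. ennreal (\<rho> 0 / 2) * indicator (ball (0::point) e) x \<partial>lborel)"
    by (intro nn_integral_cmult_indicator[symmetric]) simp
  also have "\<dots> \<le> ?I"
  proof (rule nn_integral_mono)
    fix x :: point
    show "ennreal (\<rho> 0 / 2) * indicator (ball 0 e) x \<le> ennreal (\<rho> x)"
      using e(2)[of x] by (cases "x \<in> ball 0 e") (auto intro!: ennreal_leI simp: dist_commute)
  qed
  finally have pos: "0 < ?I" .
  define I where "I = enn2real ?I"
  have I: "?I = ennreal I" "0 < I"
    using fin pos by (auto simp: I_def enn2real_positive_iff)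
  have "(\<integral>\<^sup>+x. ennreal (\<rho> x * (1 / I)) \<partial>lborel) = (\<integral>\<^sup>+x. ennreal (\<rho> x) * ennreal (1 / I) \<partial>lborel)"
    by (intro nn_integral_cong ennreal_mult) (use \<rho>(2) I(2) in auto)
  also have "\<dots> = ?I * ennreal (1 / I)"
    using m by (intro nn_integral_multc) simp
  also have "\<dots> = 1" unfolding I(1) using I(2) by (simp add: ennreal_mult[symmetric])
  finally have "(\<integral>\<^sup>+x. ennreal (\<rho> x * (1 / I)) \<partial>lborel) = 1" .
  moreover have "smooth (\<lambda>x. \<rho> x * (1 / I))" by (intro smooth_mult \<rho>(1) smooth_const)
  ultimately have "mollifier (\<lambda>x. \<rho> x * (1 / I))"
    unfolding mollifier_def using \<rho>(2,3) I(2) by simp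
  then show ?thesis by blast
qed

text \<open>The factor 1/e^2 preserves the mass in dimension two; the summand 0 gives the argument
  the form of \<open>smooth_affine\<close>.\<close>

definition moll_kernel :: "(point \<Rightarrow> real) \<Rightarrow> real \<Rightarrow> point \<Rightarrow> real" where
  "moll_kernel \<rho> e z = \<rho> ((1 / e) *\<^sub>R z + 0) * (1 / e\<^sup>2)"

definition shrink :: "point \<Rightarrow> real \<Rightarrow> point \<Rightarrow> point" where
  "shrink x0 l x = x0 + l *\<^sub>R (x - x0)"

text \<open>Evaluating at the contracted point keeps the kernel inside U for x in U, if e is small
  enough, so that the weak gradient can be tested with it; the formula nevertheless defines a
  function on the whole plane.\<close>

definition mollify :: "(point \<Rightarrow> real) \<Rightarrow> point set \<Rightarrow> point \<Rightarrow> real \<Rightarrow> real \<Rightarrow> (point \<Rightarrow> real) \<Rightarrow> point \<Rightarrow> real" where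
  "mollify \<rho> U x0 l e f x = (LINT y|lebesgue_on U. f y * moll_kernel \<rho> e (shrink x0 l x - y))"

text \<open>The two masses differ: in y the kernel has mass one, while in x the contraction
  stretches it to mass 1/l^2. They are the row and column masses of
  \<open>kernel_operator_L2_bound\<close>.\<close>

lemma moll_kernel:
  assumes \<rho>: "mollifier \<rho>" and e: "0 < e"
  shows "smooth (moll_kernel \<rho> e)" "0 \<le> moll_kernel \<rho> e z" "2 * e \<le> norm z \<Longrightarrow> moll_kernel \<rho> e z = 0"
    and "(\<integral>\<^sup>+y. ennreal (moll_kernel \<rho> e (p - y)) \<partial>lborel) = 1"
    and "0 < l \<Longrightarrow> (\<integral>\<^sup>+x. ennreal (moll_kernel \<rho> e (shrink x0 l x - y)) \<partial>lborel) = ennreal (1 / l\<^sup>2)"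
    and "\<exists>B. \<forall>z. \<bar>moll_kernel \<rho> e z\<bar> \<le> B"
proof -
  have r: "smooth \<rho>" "\<And>x. 0 \<le> \<rho> x" "\<And>x. 2 \<le> norm x \<Longrightarrow> \<rho> x = 0" "(\<integral>\<^sup>+x. ennreal (\<rho> x) \<partial>lborel) = 1"
    using \<rho> by (auto simp: mollifier_def)
  show sm: "smooth (moll_kernel \<rho> e)"
    unfolding moll_kernel_def[abs_def]
    by (intro smooth_mult smooth_const smooth_affine r(1) bounded_linear_scaleR_right)
  show "0 \<le> moll_kernel \<rho> e z" using r(2) by (simp add: moll_kernel_def)
  show supp: "moll_kernel \<rho> e z = 0" if "2 * e \<le> norm z" for z
    using that e r(3)[of "(1 / e) *\<^sub>R z"] by (simp add: moll_kernel_def pos_le_divide_eq)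
  have cont: "continuous_on UNIV (moll_kernel \<rho> e)" by (rule smooth_continuous[OF sm])
  have mk: "(\<lambda>y. ennreal (moll_kernel \<rho> e (g y))) \<in> borel_measurable borel" if "continuous_on UNIV g" for g :: "point \<Rightarrow> point"
    by (rule measurable_compose[OF borel_measurable_continuous_onI[OF continuous_on_compose2[OF cont that]]]) auto
  have mr: "(\<lambda>z. ennreal (\<rho> z)) \<in> borel_measurable lborel"
    using borel_measurable_continuous_onI[OF smooth_continuous[OF r(1)]] by simp
  have scaled: "(\<integral>\<^sup>+z. ennreal (\<rho> z * (1 / e\<^sup>2)) \<partial>lborel) = ennreal (1 / e\<^sup>2)"
  proof -
    have "(\<integral>\<^sup>+z. ennreal (\<rho> z * (1 / e\<^sup>2)) \<partial>lborel) = (\<integral>\<^sup>+z. ennreal (\<rho> z) * ennreal (1 / e\<^sup>2) \<partial>lborel)"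
      by (intro nn_integral_cong ennreal_mult) (use r(2) in auto)
    also have "\<dots> = ennreal (1 / e\<^sup>2)" using mr r(4) by (subst nn_integral_multc) simp_all
    finally show ?thesis .
  qed
  have "(\<integral>\<^sup>+y. ennreal (moll_kernel \<rho> e (p - y)) \<partial>lborel)
      = ennreal ((- e)\<^sup>2) * (\<integral>\<^sup>+z. ennreal (moll_kernel \<rho> e (p - (p + (- e) *\<^sub>R z))) \<partial>lborel)"
    using e by (intro nn_integral_lborel_affine mk continuous_intros) auto
  \<comment> \<open>The substitution y = p - e z recovers \<rho>; its Jacobian e^2 cancels the
    normalizing factor.\<close>
  also have "(\<lambda>z. moll_kernel \<rho> e (p - (p + (- e) *\<^sub>R z))) = (\<lambda>z. \<rho> z * (1 / e\<^sup>2))"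
    using e by (simp add: moll_kernel_def fun_eq_iff)
  finally show "(\<integral>\<^sup>+y. ennreal (moll_kernel \<rho> e (p - y)) \<partial>lborel) = 1"
    unfolding scaled using e by (simp add: ennreal_mult[symmetric])
  show "(\<integral>\<^sup>+x. ennreal (moll_kernel \<rho> e (shrink x0 l x - y)) \<partial>lborel) = ennreal (1 / l\<^sup>2)" if l: "0 < l"
  proof -
    \<comment> \<open>The preimage of y under the contraction, where the kernel is centred as a
      function of x; its width there is e/l.\<close>
    let ?t = "x0 + (1 / l) *\<^sub>R (y - x0)"
    have "(\<integral>\<^sup>+x. ennreal (moll_kernel \<rho> e (shrink x0 l x - y)) \<partial>lborel)
      = ennreal ((e / l)\<^sup>2) * (\<integral>\<^sup>+z. ennreal (moll_kernel \<rho> e (shrink x0 l (?t + (e / l) *\<^sub>R z) - y)) \<partial>lborel)"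
      using e l unfolding shrink_def by (intro nn_integral_lborel_affine mk continuous_intros) auto
    also have "(\<lambda>z. moll_kernel \<rho> e (shrink x0 l (?t + (e / l) *\<^sub>R z) - y)) = (\<lambda>z. \<rho> z * (1 / e\<^sup>2))"
    proof
      fix z
      have "shrink x0 l (?t + (e / l) *\<^sub>R z) - y = e *\<^sub>R z"
        using l by (simp add: shrink_def scaleR_add_right)
      then show "moll_kernel \<rho> e (shrink x0 l (?t + (e / l) *\<^sub>R z) - y) = \<rho> z * (1 / e\<^sup>2)"
        using e by (simp add: moll_kernel_def)
    qed
    finally show ?thesis
      unfolding scaled using e l by (simp add: ennreal_mult[symmetric] power_divide)
  qed
  have "moll_kernel \<rho> e z = 0" if "2 * e < norm z" for z using supp that by simp
  then obtain B where "\<And>z. norm (moll_kernel \<rho> e z) \<le> B"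
    by (rule bounded_of_compact_support[where R="2 * e", OF cont]) (assumption, rule that)
  then show "\<exists>B. \<forall>z. \<bar>moll_kernel \<rho> e z\<bar> \<le> B" by auto
qed

lemma nn_integral_lebesgue_on_le_lborel:
  assumes "U \<in> sets lebesgue"
  shows "(\<integral>\<^sup>+x. f x \<partial>lebesgue_on U) \<le> (\<integral>\<^sup>+x. f x \<partial>lborel)"
proof -
  have "(\<integral>\<^sup>+x. f x \<partial>lebesgue_on U) = (\<integral>\<^sup>+x. f x * indicator U x \<partial>lebesgue)"
    using assms by (intro nn_integral_restrict_space) simp
  also have "\<dots> \<le> (\<integral>\<^sup>+x. f x \<partial>lebesgue)"
    by (intro nn_integral_mono) (simp add: indicator_def)
  finally show ?thesis by (simp add: nn_integral_completion)
qed

lemma moll_kernel_integral_one: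
  assumes \<rho>: "mollifier \<rho>" and e: "0 < e" and U: "U \<in> lmeasurable" and p: "cball p (2 * e) \<subseteq> U"
  shows "(LINT y|lebesgue_on U. moll_kernel \<rho> e (p - y)) = 1"
proof -
  have US: "U \<in> sets lebesgue" using U by (rule fmeasurableD)
  have "(\<integral>\<^sup>+y. ennreal (moll_kernel \<rho> e (p - y)) \<partial>lebesgue_on U)
      = (\<integral>\<^sup>+y. ennreal (moll_kernel \<rho> e (p - y)) * indicator U y \<partial>lebesgue)"
    using US by (intro nn_integral_restrict_space) simp
  also have "\<dots> = (\<integral>\<^sup>+y. ennreal (moll_kernel \<rho> e (p - y)) \<partial>lebesgue)"
  proof (rule nn_integral_cong)
    fix y
    show "ennreal (moll_kernel \<rho> e (p - y)) * indicator U y = ennreal (moll_kernel \<rho> e (p - y))"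
    proof (cases "y \<in> U")
      case False
      then have "2 * e \<le> norm (p - y)" using p by (force simp: dist_norm)
      then show ?thesis using moll_kernel(3)[OF \<rho> e] by simp
    qed simp
  qed
  also have "\<dots> = 1" by (simp add: nn_integral_completion moll_kernel(4)[OF \<rho> e])
  finally have one: "(\<integral>\<^sup>+y. ennreal (moll_kernel \<rho> e (p - y)) \<partial>lebesgue_on U) = 1" .
  have "continuous_on UNIV (\<lambda>y. moll_kernel \<rho> e (p - y))"
    by (rule continuous_on_compose2[OF smooth_continuous[OF moll_kernel(1)[OF \<rho> e]]]) (auto intro!: continuous_intros)
  then have "(\<lambda>y. moll_kernel \<rho> e (p - y)) \<in> borel_measurable (lebesgue_on U)"
    by - (rule continuous_imp_measurable_on_sets_lebesgue[OF continuous_on_subset[OF _ subset_UNIV] US])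
  then have "(LINT y|lebesgue_on U. moll_kernel \<rho> e (p - y)) = enn2real (\<integral>\<^sup>+y. ennreal (moll_kernel \<rho> e (p - y)) \<partial>lebesgue_on U)"
    using moll_kernel(2)[OF \<rho> e] by (intro integral_eq_nn_integral AE_I2) auto
  then show ?thesis unfolding one by simp
qed

lemma shrink_affine: "shrink x0 l x = l *\<^sub>R x + (x0 - l *\<^sub>R x0)"
  by (simp add: shrink_def algebra_simps)

lemma mollify_smooth:
  assumes \<rho>: "mollifier \<rho>" and e: "0 < e" and U: "U \<in> sets lebesgue" and f: "integrable (lebesgue_on U) f"
  shows "smooth (mollify \<rho> U x0 l e f)"
    and "grad (mollify \<rho> U x0 l e f) x = l *\<^sub>R (\<chi> i. LINT y|lebesgue_on U. f y * grad (moll_kernel \<rho> e) (shrink x0 l x - y) $ i)"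
proof -
  let ?k = "moll_kernel \<rho> e"
  define F where "F z = (LINT y|lebesgue_on U. f y * ?k (z - y))" for z
  have supp: "?k z = 0" if "2 * e < norm z" for z using moll_kernel(3)[OF \<rho> e] that by simp
  have m: "mollify \<rho> U x0 l e f = (\<lambda>x. F (l *\<^sub>R x + (x0 - l *\<^sub>R x0)))"
    by (simp add: mollify_def F_def shrink_affine fun_eq_iff)
  have "smooth F" unfolding F_def
    by (rule smooth_convolution[where R="2 * e", OF f U moll_kernel(1)[OF \<rho> e] supp])
  then show "smooth (mollify \<rho> U x0 l e f)" unfolding m
    by (rule smooth_affine[OF _ bounded_linear_scaleR_right])
  let ?g = "\<chi> i. LINT y|lebesgue_on U. f y * grad ?k (shrink x0 l x - y) $ i"
  have dF: "(F has_derivative (\<lambda>h. ?g \<bullet> h)) (at (shrink x0 l x))"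
    unfolding F_def
    by (rule convolution_has_derivative[where R="2 * e", OF f U moll_kernel(1)[OF \<rho> e] supp])
  have "((\<lambda>x. shrink x0 l x) has_derivative (\<lambda>h. l *\<^sub>R h)) (at x)"
    unfolding shrink_affine by (auto intro!: derivative_eq_intros)
  from diff_chain_at[OF this dF]
  have "(mollify \<rho> U x0 l e f has_derivative (\<lambda>h. (l *\<^sub>R ?g) \<bullet> h)) (at x)"
    by (simp add: o_def m shrink_affine)
  then show "grad (mollify \<rho> U x0 l e f) x = l *\<^sub>R ?g" by (rule grad_unique)
qed

lemma continuous_measurable_lebesgue_on:
  fixes g :: "point \<Rightarrow> 'b::euclidean_space"
  assumes "continuous_on UNIV g" "U \<in> sets lebesgue"
  shows "g \<in> borel_measurable (lebesgue_on U)"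
  by (rule continuous_imp_measurable_on_sets_lebesgue[OF continuous_on_subset[OF assms(1) subset_UNIV] assms(2)])

text \<open>The width e makes the kernel radius 2 e equal to the margin around the contracted point,
  so rows have mass one; columns have mass at most 1/l^2 \<le> 4 because l \<ge> 1/2.\<close>

lemma mollify_L2_bound:
  assumes \<rho>: "mollifier \<rho>" and U: "U \<in> lmeasurable" and "0 < r" and l: "1/2 \<le> l" "l < 1"
    and star: "\<And>x. x \<in> U \<Longrightarrow> cball (shrink x0 l x) ((1 - l) * r) \<subseteq> U"
    and f: "f \<in> borel_measurable (lebesgue_on U)" "integrable (lebesgue_on U) (\<lambda>x. (f x)\<^sup>2)"
  defines "e \<equiv> (1 - l) * r / 2"
  shows "integrable (lebesgue_on U) (\<lambda>x. (mollify \<rho> U x0 l e f x)\<^sup>2)"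
    and "(LINT x|lebesgue_on U. (mollify \<rho> U x0 l e f x)\<^sup>2) \<le> 4 * (LINT x|lebesgue_on U. (f x)\<^sup>2)"
proof -
  have US: "U \<in> sets lebesgue" using U by (rule fmeasurableD)
  interpret finite_measure "lebesgue_on U" using U by (rule finite_measure_lebesgue_on)
  have e: "0 < e" using l \<open>0 < r\<close> by (simp add: e_def)
  note k = moll_kernel[OF \<rho> e]
  obtain B where B: "\<forall>z. \<bar>moll_kernel \<rho> e z\<bar> \<le> B" using k(6) by (elim exE)
  have c: "continuous_on UNIV (\<lambda>p. moll_kernel \<rho> e (shrink x0 l (fst p) - snd p))"
    unfolding shrink_def
    by (rule continuous_on_compose2[OF smooth_continuous[OF k(1)]]) (auto intro!: continuous_intros)
  have one: "(LINT y|lebesgue_on U. moll_kernel \<rho> e (shrink x0 l x - y)) = 1" if "x \<in> U" for x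
    using star[OF that] by (intro moll_kernel_integral_one[OF \<rho> e U]) (simp add: e_def)
  have Bk: "moll_kernel \<rho> e (shrink x0 l x - y) \<le> B" for x y
    using B[rule_format, of "shrink x0 l x - y"] by linarith
  have C: "(\<integral>\<^sup>+x. ennreal (moll_kernel \<rho> e (shrink x0 l x - y)) \<partial>lebesgue_on U) \<le> ennreal 4" for y
  proof -
    have "(\<integral>\<^sup>+x. ennreal (moll_kernel \<rho> e (shrink x0 l x - y)) \<partial>lebesgue_on U) \<le> ennreal (1 / l\<^sup>2)"
      using nn_integral_lebesgue_on_le_lborel[OF US, of "\<lambda>x. ennreal (moll_kernel \<rho> e (shrink x0 l x - y))"] k(5)[of l x0 y] l by simp
    also have "\<dots> \<le> ennreal 4"
    proof (rule ennreal_leI)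
      have "(1/2)\<^sup>2 \<le> l\<^sup>2" using l by (intro power_mono) auto
      then show "1 / l\<^sup>2 \<le> 4" using l by (simp add: field_simps power2_eq_square)
    qed
    finally show ?thesis .
  qed
  have "mollify \<rho> U x0 l e f \<in> borel_measurable (lebesgue_on U)"
    by (rule continuous_measurable_lebesgue_on[OF smooth_continuous[OF mollify_smooth(1)[OF \<rho> e US integrable_of_square[OF f]]] US])
  then have T: "(\<lambda>x. LINT y|lebesgue_on U. f y * moll_kernel \<rho> e (shrink x0 l x - y)) \<in> borel_measurable (lebesgue_on U)"
    by (simp add: mollify_def[abs_def])
  note kb = kernel_operator_L2_bound[where k="\<lambda>x y. moll_kernel \<rho> e (shrink x0 l x - y)" and B=B and C=4,
      OF U f c k(2) Bk one C _ T, simplified]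
  show "integrable (lebesgue_on U) (\<lambda>x. (mollify \<rho> U x0 l e f x)\<^sup>2)" unfolding mollify_def by (rule kb(1))
  show "(LINT x|lebesgue_on U. (mollify \<rho> U x0 l e f x)\<^sup>2) \<le> 4 * (LINT x|lebesgue_on U. (f x)\<^sup>2)"
    unfolding mollify_def by (rule kb(2))
qed

lemma mollify_diff:
  assumes \<rho>: "mollifier \<rho>" and e: "0 < e" and U: "U \<in> sets lebesgue"
    and f: "integrable (lebesgue_on U) f" "integrable (lebesgue_on U) g"
  shows "mollify \<rho> U x0 l e (\<lambda>y. f y - g y) x = mollify \<rho> U x0 l e f x - mollify \<rho> U x0 l e g x"
proof -
  have supp: "moll_kernel \<rho> e z = 0" if "2 * e < norm z" for z using moll_kernel(3)[OF \<rho> e] that by simp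
  note i = convolution_integrable[where R="2 * e", OF _ U smooth_continuous[OF moll_kernel(1)[OF \<rho> e]] supp]
  show ?thesis unfolding mollify_def using i[OF f(1)] i[OF f(2)] by (simp add: left_diff_distrib)
qed

text \<open>The kernel ball lies in U, so the mollified value is an average of g over it and
  deviates from \<open>g x\<close> no more than g does there.\<close>

lemma mollify_uniform_close:
  assumes \<rho>: "mollifier \<rho>" and e: "0 < e" and U: "U \<in> lmeasurable"
    and g: "integrable (lebesgue_on U) g" and p: "cball (shrink x0 l x) (2 * e) \<subseteq> U"
    and w: "\<And>y. y \<in> U \<Longrightarrow> dist y (shrink x0 l x) \<le> 2 * e \<Longrightarrow> \<bar>g y - g x\<bar> \<le> \<omega>"
  shows "\<bar>mollify \<rho> U x0 l e g x - g x\<bar> \<le> \<omega>"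
proof -
  let ?M = "lebesgue_on U" and ?k = "\<lambda>y. moll_kernel \<rho> e (shrink x0 l x - y)"
  have US: "U \<in> sets lebesgue" using U by (rule fmeasurableD)
  interpret finite_measure ?M using U by (rule finite_measure_lebesgue_on)
  have supp: "moll_kernel \<rho> e z = 0" if "2 * e < norm z" for z using moll_kernel(3)[OF \<rho> e] that by simp
  note i = convolution_integrable[where R="2 * e", OF _ US smooth_continuous[OF moll_kernel(1)[OF \<rho> e]] supp]
  have one: "(LINT y|?M. ?k y) = 1" by (rule moll_kernel_integral_one[OF \<rho> e U p])
  have ik: "integrable ?M ?k" using i[OF integrable_const, of 1] by simp
  have ig: "integrable ?M (\<lambda>y. g y * ?k y)" by (rule i[OF g])
  have "mollify \<rho> U x0 l e g x - g x = (LINT y|?M. g y * ?k y) - g x * (LINT y|?M. ?k y)"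
    unfolding one by (simp add: mollify_def)
  also have "\<dots> = (LINT y|?M. g y * ?k y - g x * ?k y)" using ig ik by simp
  finally have eq: "mollify \<rho> U x0 l e g x - g x = (LINT y|?M. g y * ?k y - g x * ?k y)" .
  have "\<bar>LINT y|?M. g y * ?k y - g x * ?k y\<bar> \<le> (LINT y|?M. norm (g y * ?k y - g x * ?k y))"
    using integral_norm_bound[of ?M "\<lambda>y. g y * ?k y - g x * ?k y"] by simp
  also have "\<dots> \<le> (LINT y|?M. \<omega> * ?k y)"
  proof (rule integral_mono)
    fix y assume "y \<in> space ?M"
    then have y: "y \<in> U" using US by (simp add: space_restrict_space)
    have "norm (g y * ?k y - g x * ?k y) = \<bar>g y - g x\<bar> * ?k y"
      using moll_kernel(2)[OF \<rho> e] by (simp add: abs_mult left_diff_distrib[symmetric])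
    also have "\<dots> \<le> \<omega> * ?k y"
    proof (cases "dist y (shrink x0 l x) \<le> 2 * e")
      case True
      then show ?thesis using w[OF y] moll_kernel(2)[OF \<rho> e] by (intro mult_right_mono) auto
    next
      case False
      then have "?k y = 0" by (intro supp) (simp add: dist_norm norm_minus_commute)
      then show ?thesis by simp
    qed
    finally show "norm (g y * ?k y - g x * ?k y) \<le> \<omega> * ?k y" .
  qed (use ig ik in auto)
  also have "\<dots> = \<omega>" using one by simp
  finally show ?thesis unfolding eq .
qed

text \<open>Density argument: the operators are bounded in L^2 uniformly in l, and on a continuous g
  they converge uniformly, as contraction and kernel displace points by a multiple of 1 - l. The
  claim covers all l near 1, so that several functions can later share one l.\<close>

lemma mollify_L2_tendsto:
  assumes \<rho>: "mollifier \<rho>" and U: "U \<in> lmeasurable" "bounded U" and "0 < r"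
    and star: "\<And>x l. x \<in> U \<Longrightarrow> 0 < l \<Longrightarrow> l < 1 \<Longrightarrow> cball (shrink x0 l x) ((1 - l) * r) \<subseteq> U"
    and f: "f \<in> borel_measurable (lebesgue_on U)" "integrable (lebesgue_on U) (\<lambda>x. (f x)\<^sup>2)"
    and "0 < d"
  shows "\<exists>L<1. \<forall>l. L < l \<longrightarrow> l < 1 \<longrightarrow>
    (LINT x|lebesgue_on U. (mollify \<rho> U x0 l ((1 - l) * r / 2) f x - f x)\<^sup>2) < d"
proof -
  let ?M = "lebesgue_on U"
  have US: "U \<in> sets lebesgue" using U(1) by (rule fmeasurableD)
  interpret finite_measure ?M using U(1) by (rule finite_measure_lebesgue_on)
  \<comment> \<open>The squared triangle inequality is used twice, and the errors add up to 8 d/24 +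
    4 d/16 + 4 d/24 = 3 d/4.\<close>
  have "0 < d / 24" using \<open>0 < d\<close> by simp
  from continuous_approx_L2[OF U(1) f this]
  obtain g B where g: "continuous_on UNIV g" "\<forall>x. \<bar>g x\<bar> \<le> B" "(LINT x|?M. (f x - g x)\<^sup>2) < d / 24"
    by (elim exE conjE)
  have gm: "g \<in> borel_measurable ?M" by (rule continuous_measurable_lebesgue_on[OF g(1) US])
  have g2: "integrable ?M (\<lambda>x. (g x)\<^sup>2)"
  proof (rule integrable_const_bound[where B="B\<^sup>2"])
    show "AE x in ?M. norm ((g x)\<^sup>2) \<le> B\<^sup>2"
    proof (rule AE_I2)
      fix x
      have "\<bar>g x\<bar> \<le> \<bar>B\<bar>" using g(2)[rule_format, of x] by linarith
      then have "(g x)\<^sup>2 \<le> B\<^sup>2" by (simp only: abs_le_square_iff)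
      then show "norm ((g x)\<^sup>2) \<le> B\<^sup>2" by simp
    qed
  qed (use gm in measurable)
  define m where "m = measure ?M (space ?M)"
  have m: "0 \<le> m" by (simp add: m_def)
  \<comment> \<open>Makes \<omega>^2 times the measure m of U at most d/16; m + 1 admits m =
    0.\<close>
  define \<omega> where "\<omega> = sqrt (d / (16 * (m + 1)))"
  have \<omega>: "0 < \<omega>" "\<omega>\<^sup>2 = d / (16 * (m + 1))" using m \<open>0 < d\<close> by (simp_all add: \<omega>_def)
  have "compact (closure U)" using U(2) by (simp add: compact_closure)
  then have "uniformly_continuous_on (closure U) g"
    by (intro compact_uniformly_continuous continuous_on_subset[OF g(1)]) auto
  then have "\<exists>s>0. \<forall>x\<in>closure U. \<forall>x'\<in>closure U. dist x' x < s \<longrightarrow> dist (g x') (g x) < \<omega>"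
    using \<omega>(1) unfolding uniformly_continuous_on_def by simp
  then obtain s where s: "0 < s" "\<forall>x\<in>closure U. \<forall>x'\<in>closure U. dist x' x < s \<longrightarrow> dist (g x') (g x) < \<omega>"
    by (elim exE conjE)
  obtain D where D: "\<forall>x\<in>U. dist x0 x \<le> D" using U(2) by (auto simp: bounded_any_center[where a=x0])
  define D' where "D' = \<bar>D\<bar> + r"
  have D': "0 < D'" using \<open>0 < r\<close> by (simp add: D'_def)
  \<comment> \<open>1/2 is the threshold of the L^2 bound; 1 - s/D' brings the total displacement (1
    - l) D' below s.\<close>
  define L where "L = max (1/2) (1 - s / D')"
  show ?thesis
  proof (intro exI conjI allI impI)
    show "L < 1" using s(1) D' by (simp add: L_def)
    fix l assume l: "L < l" "l < 1"
    then have l2: "1/2 \<le> l" "0 < l" by (auto simp: L_def)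
    have "1 - l < s / D'" using l by (simp add: L_def)
    then have ls: "(1 - l) * D' < s" using D' by (simp add: pos_less_divide_eq)
    define e where "e = (1 - l) * r / 2"
    have e: "0 < e" using l \<open>0 < r\<close> by (simp add: e_def)
    let ?T = "mollify \<rho> U x0 l e"
    note fi = integrable_of_square[OF f] integrable_of_square[OF gm g2]
    have starl: "cball (shrink x0 l x) ((1 - l) * r) \<subseteq> U" if "x \<in> U" for x
      by (rule star[OF that l2(2) l(2)])
    have bound: "integrable ?M (\<lambda>x. (?T h x)\<^sup>2)" "(LINT x|?M. (?T h x)\<^sup>2) \<le> 4 * (LINT x|?M. (h x)\<^sup>2)"
      if h: "h \<in> borel_measurable ?M" "integrable ?M (\<lambda>x. (h x)\<^sup>2)" for h
      unfolding e_def by (rule mollify_L2_bound[OF \<rho> U(1) \<open>0 < r\<close> l2(1) l(2) starl h], assumption)+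
    have Tm: "?T h \<in> borel_measurable ?M" if "integrable ?M h" for h
      by (rule continuous_measurable_lebesgue_on[OF smooth_continuous[OF mollify_smooth(1)[OF \<rho> e US that]] US])
    have fg: "(\<lambda>x. f x - g x) \<in> borel_measurable ?M" "integrable ?M (\<lambda>x. (f x - g x)\<^sup>2)"
      using f(1) gm integrable_square_diff[OF f(1) gm f(2) g2] by auto
    have 1: "(LINT x|?M. (?T f x - ?T g x)\<^sup>2) \<le> 4 * (LINT x|?M. (f x - g x)\<^sup>2)"
      using bound(2)[OF fg] mollify_diff[OF \<rho> e US fi] by simp
    have close: "\<bar>?T g x - g x\<bar> \<le> \<omega>" if x: "x \<in> U" for x
    proof (rule mollify_uniform_close[OF \<rho> e U(1) fi(2)])
      show "cball (shrink x0 l x) (2 * e) \<subseteq> U" using star[OF x l2(2) l(2)] by (simp add: e_def)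
      fix y assume y: "y \<in> U" "dist y (shrink x0 l x) \<le> 2 * e"
      have "dist (shrink x0 l x) x = (1 - l) * dist x0 x"
      proof -
        have "shrink x0 l x - x = (1 - l) *\<^sub>R (x0 - x)" by (simp add: shrink_def algebra_simps)
        then show ?thesis using l by (simp add: dist_norm)
      qed
      also have "\<dots> \<le> (1 - l) * \<bar>D\<bar>" using D[rule_format, OF x] l by (intro mult_left_mono) auto
      finally have "dist y x \<le> 2 * e + (1 - l) * \<bar>D\<bar>"
        using dist_triangle[of y x "shrink x0 l x"] y(2) by linarith
      also have "\<dots> = (1 - l) * D'" by (simp add: e_def D'_def field_simps)
      finally have "dist y x < s" using ls by linarith
      then have "dist (g y) (g x) < \<omega>" using s(2) x y(1) closure_subset[of U] by blast
      then show "\<bar>g y - g x\<bar> \<le> \<omega>" by (simp add: dist_real_def)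
    qed
    have Tg2: "integrable ?M (\<lambda>x. (?T g x)\<^sup>2)" and Tf2: "integrable ?M (\<lambda>x. (?T f x)\<^sup>2)"
      using bound(1)[OF gm g2] bound(1)[OF f] by auto
    have "(LINT x|?M. (?T g x - g x)\<^sup>2) \<le> (LINT x|?M. \<omega>\<^sup>2)"
    proof (rule integral_mono)
      show "integrable ?M (\<lambda>x. (?T g x - g x)\<^sup>2)"
        by (rule integrable_square_diff[OF Tm[OF fi(2)] gm Tg2 g2])
      fix x assume "x \<in> space ?M"
      then have "x \<in> U" using US by (simp add: space_restrict_space)
      then have "\<bar>?T g x - g x\<bar> \<le> \<bar>\<omega>\<bar>" using close[of x] by linarith
      then show "(?T g x - g x)\<^sup>2 \<le> \<omega>\<^sup>2" by (simp only: abs_le_square_iff)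
    qed simp
    also have "\<dots> = m * \<omega>\<^sup>2" by (simp add: m_def)
    also have "\<dots> = (d / 16) * (m / (m + 1))" unfolding \<omega>(2) using m by (simp add: field_simps)
    also have "\<dots> \<le> (d / 16) * 1" using m \<open>0 < d\<close> by (intro mult_left_mono) auto
    finally have 2: "(LINT x|?M. (?T g x - g x)\<^sup>2) \<le> d / 16" by simp
    have gf: "(LINT x|?M. (g x - f x)\<^sup>2) = (LINT x|?M. (f x - g x)\<^sup>2)"
      by (simp add: power2_commute)
    have 3: "(LINT x|?M. (?T f x - f x)\<^sup>2) \<le> 2 * (LINT x|?M. (?T f x - ?T g x)\<^sup>2) + 2 * (LINT x|?M. (?T g x - f x)\<^sup>2)"
      by (rule integral_square_diff_le[OF Tm[OF fi(1)] Tm[OF fi(2)] f(1) Tf2 Tg2 f(2)])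
    have "(LINT x|?M. (?T g x - f x)\<^sup>2) \<le> 2 * (LINT x|?M. (?T g x - g x)\<^sup>2) + 2 * (LINT x|?M. (g x - f x)\<^sup>2)"
      by (rule integral_square_diff_le[OF Tm[OF fi(2)] gm f(1) Tg2 g2 f(2)])
    with 1 2 3 g(3) \<open>0 < d\<close> have "(LINT x|?M. (?T f x - f x)\<^sup>2) < d" unfolding gf by linarith
    then show "(LINT x|?M. (mollify \<rho> U x0 l ((1 - l) * r / 2) f x - f x)\<^sup>2) < d"
      by (simp add: e_def)
  qed
qed

text \<open>As a function of y the kernel centred at the contracted point is a test function on U.
  The minus sign of the weak gradient cancels the one from differentiating p - y, and the chain rule
  through the contraction gives the factor l.\<close>

lemma grad_mollify:
  assumes \<rho>: "mollifier \<rho>" and e: "0 < e" and U: "U \<in> lmeasurable"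
    and v: "integrable (lebesgue_on U) v" and G: "is_weak_grad U v G" 
    and p: "cball (shrink x0 l x) (2 * e) \<subseteq> U"
  shows "grad (mollify \<rho> U x0 l e v) x $ i = l * mollify \<rho> U x0 l e (\<lambda>y. G y $ i) x"
proof -
  let ?k = "moll_kernel \<rho> e" and ?p = "shrink x0 l x"
  define \<phi> where "\<phi> y = ?k (?p - y)" for y
  have US: "U \<in> sets lebesgue" using U by (rule fmeasurableD)
  note k = moll_kernel[OF \<rho> e]
  have sm: "smooth \<phi>"
    using smooth_affine[OF k(1) bounded_linear_minus[OF bounded_linear_ident], of ?p]
    by (simp add: \<phi>_def[abs_def])
  have gr: "grad \<phi> y = - grad ?k (?p - y)" for y
  proof (rule grad_unique)
    have "((\<lambda>y. ?p - y) has_derivative (\<lambda>h. - h)) (at y)" by (auto intro!: derivative_eq_intros)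
    from diff_chain_at[OF this smooth_grad_has_derivative[OF k(1)]]
    show "(\<phi> has_derivative (\<lambda>h. (- grad ?k (?p - y)) \<bullet> h)) (at y)"
      by (simp add: o_def \<phi>_def[abs_def])
  qed
  have "{y. \<phi> y \<noteq> 0} \<subseteq> cball ?p (2 * e)"
  proof
    fix y assume "y \<in> {y. \<phi> y \<noteq> 0}"
    then have "norm (?p - y) < 2 * e" using k(3)[of "?p - y"] by (force simp: \<phi>_def)
    then show "y \<in> cball ?p (2 * e)" by (simp add: dist_norm)
  qed
  then have sub: "closure {y. \<phi> y \<noteq> 0} \<subseteq> cball ?p (2 * e)" by (intro closure_minimal) auto
  then have "compact (closure {y. \<phi> y \<noteq> 0})"
    using bounded_subset[OF bounded_cball sub] by (simp add: compact_eq_bounded_closed)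
  with sm sub p have "test_function U \<phi>" unfolding test_function_def by blast
  then have "(LINT y|lebesgue_on U. v y * grad \<phi> y $ i) = - (LINT y|lebesgue_on U. G y $ i * \<phi> y)"
    using G unfolding is_weak_grad_def by blast
  then have "(LINT y|lebesgue_on U. v y * grad ?k (?p - y) $ i) = (LINT y|lebesgue_on U. G y $ i * ?k (?p - y))"
    unfolding gr by (simp add: \<phi>_def)
  then show ?thesis
    unfolding mollify_smooth(2)[OF \<rho> e US v] by (simp add: mollify_def)
qed

text \<open>On U the gradient of the mollified v is l times the mollified G. So besides the
  convergence for v and for both components of G, the factor l itself has to be near 1.\<close>

lemma smooth_approx_H1:
  assumes U: "U \<in> lmeasurable" "bounded U" and "0 < r"
    and star: "\<And>x l. x \<in> U \<Longrightarrow> 0 < l \<Longrightarrow> l < 1 \<Longrightarrow> cball (shrink x0 l x) ((1 - l) * r) \<subseteq> U"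
    and v: "L2_on U v" and G: "L2_on U G" "is_weak_grad U v G" and "0 < d"
  shows "\<exists>\<phi>. smooth \<phi> \<and> (LINT x|lebesgue_on U. (\<phi> x - v x)\<^sup>2) < d \<and>
     (LINT x|lebesgue_on U. (norm (grad \<phi> x - G x))\<^sup>2) < d"
proof -
  let ?M = "lebesgue_on U"
  have US: "U \<in> sets lebesgue" using U(1) by (rule fmeasurableD)
  interpret finite_measure ?M using U(1) by (rule finite_measure_lebesgue_on)
  obtain \<rho> where \<rho>: "mollifier \<rho>" using mollifier_exists by blast
  have vm: "v \<in> borel_measurable ?M" "integrable ?M (\<lambda>x. (v x)\<^sup>2)"
    using v by (auto simp: L2_on_def)
  have Gm: "(\<lambda>x. G x $ i) \<in> borel_measurable ?M" for i
  proof -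
    have "G \<in> borel_measurable ?M" using G(1) by (simp add: L2_on_def)
    moreover have "(\<lambda>z::point. z $ i) \<in> borel_measurable borel"
      by (intro borel_measurable_continuous_onI continuous_intros)
    ultimately show ?thesis by (rule measurable_compose)
  qed
  have G2: "integrable ?M (\<lambda>x. (G x $ i)\<^sup>2)" for i
  proof (rule Bochner_Integration.integrable_bound)
    show "integrable ?M (\<lambda>x. (norm (G x))\<^sup>2)" using G(1) by (simp add: L2_on_def)
    show "(\<lambda>x. (G x $ i)\<^sup>2) \<in> borel_measurable ?M" using Gm by measurable
    show "AE x in ?M. norm ((G x $ i)\<^sup>2) \<le> norm ((norm (G x))\<^sup>2)"
    proof (rule AE_I2)
      fix x
      have "\<bar>G x $ i\<bar>\<^sup>2 \<le> (norm (G x))\<^sup>2"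
        by (intro power_mono component_le_norm_cart) simp
      then show "norm ((G x $ i)\<^sup>2) \<le> norm ((norm (G x))\<^sup>2)" by simp
    qed
  qed
  define N where "N = (LINT x|?M. (G x $ 1)\<^sup>2) + (LINT x|?M. (G x $ 2)\<^sup>2)"
  have N: "0 \<le> N" by (simp add: N_def)
  \<comment> \<open>Each gradient component costs 2 d' for mollification, and the factor l costs 2
    d' for both together; 6 d' is below d.\<close>
  define d' where "d' = d / 8"
  have d': "0 < d'" using \<open>0 < d\<close> by (simp add: d'_def)
  let ?T = "\<lambda>l f. mollify \<rho> U x0 l ((1 - l) * r / 2) f"
  have mt: "\<exists>L<1. \<forall>l. L < l \<longrightarrow> l < 1 \<longrightarrow> (LINT x|?M. (?T l f x - f x)\<^sup>2) < d'"
    if "f \<in> borel_measurable ?M" "integrable ?M (\<lambda>x. (f x)\<^sup>2)" for f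
    by (rule mollify_L2_tendsto[OF \<rho> U \<open>0 < r\<close> star that d'])
  obtain Lv where Lv: "Lv < 1" "\<forall>l. Lv < l \<longrightarrow> l < 1 \<longrightarrow> (LINT x|?M. (?T l v x - v x)\<^sup>2) < d'"
    using mt[OF vm] by (elim exE conjE)
  obtain L1 where L1: "L1 < 1" "\<forall>l. L1 < l \<longrightarrow> l < 1 \<longrightarrow> (LINT x|?M. (?T l (\<lambda>y. G y $ 1) x - G x $ 1)\<^sup>2) < d'"
    using mt[OF Gm[of 1] G2[of 1]] by (elim exE conjE)
  obtain L2 where L2: "L2 < 1" "\<forall>l. L2 < l \<longrightarrow> l < 1 \<longrightarrow> (LINT x|?M. (?T l (\<lambda>y. G y $ 2) x - G x $ 2)\<^sup>2) < d'"
    using mt[OF Gm[of 2] G2[of 2]] by (elim exE conjE)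
  \<comment> \<open>Controls the factor l: (1 - l)^2 \<le> 1 - l < q and q N \<le> d'.\<close>
  define q where "q = min 1 (d' / (N + 1))"
  have q: "0 < q" "q \<le> 1" "q * N \<le> d'"
  proof -
    show "0 < q" "q \<le> 1" using d' N by (auto simp: q_def)
    have "q * N \<le> d' / (N + 1) * N" using N by (intro mult_right_mono) (auto simp: q_def)
    also have "\<dots> = d' * (N / (N + 1))" by simp
    also have "\<dots> \<le> d' * 1" using N d' by (intro mult_left_mono) auto
    finally show "q * N \<le> d'" by simp
  qed
  define L where "L = max (max Lv L1) (max (max L2 (1/2)) (1 - q))"
  have L: "L < 1" using Lv(1) L1(1) L2(1) q(1) by (simp add: L_def)
  define l where "l = (L + 1) / 2"
  have "L < l" and l1: "l < 1" using L by (auto simp: l_def)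
  then have lg: "Lv < l" "L1 < l" "L2 < l" "1/2 \<le> l" "1 - l < q" by (auto simp: L_def)
  define e where "e = (1 - l) * r / 2"
  have e: "0 < e" using l1 \<open>0 < r\<close> by (simp add: e_def)
  note fi = integrable_of_square[OF vm]
  let ?\<phi> = "mollify \<rho> U x0 l e v"
  have starl: "cball (shrink x0 l x) ((1 - l) * r) \<subseteq> U" if "x \<in> U" for x
    using lg l1 by (intro star that) auto
  have gr: "grad ?\<phi> x $ i = l * ?T l (\<lambda>y. G y $ i) x" if "x \<in> U" for x i
    using grad_mollify[OF \<rho> e U(1) fi G(2), of x0 l x i] starl[OF that] by (simp add: e_def)
  have comp: "(LINT x|?M. (l * ?T l (\<lambda>y. G y $ i) x - G x $ i)\<^sup>2)
      \<le> 2 * (LINT x|?M. (?T l (\<lambda>y. G y $ i) x - G x $ i)\<^sup>2) + 2 * (q * (LINT x|?M. (G x $ i)\<^sup>2))"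
    and compi: "integrable ?M (\<lambda>x. (l * ?T l (\<lambda>y. G y $ i) x - G x $ i)\<^sup>2)" for i
  proof -
    let ?t = "?T l (\<lambda>y. G y $ i)" and ?g = "\<lambda>x. G x $ i"
    have tm: "?t \<in> borel_measurable ?M"
      using mollify_smooth(1)[OF \<rho> e US integrable_of_square[OF Gm G2]]
      by (intro continuous_measurable_lebesgue_on US smooth_continuous) (simp add: e_def)
    have t2: "integrable ?M (\<lambda>x. (?t x)\<^sup>2)"
      by (rule mollify_L2_bound(1)[OF \<rho> U(1) \<open>0 < r\<close> lg(4) l1 starl Gm G2], assumption)
    have td: "integrable ?M (\<lambda>x. (?t x - ?g x)\<^sup>2)" by (rule integrable_square_diff[OF tm Gm t2 G2])
    have lt: "(\<lambda>x. l * ?t x) \<in> borel_measurable ?M" "integrable ?M (\<lambda>x. (l * ?t x)\<^sup>2)"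
      and lgm: "(\<lambda>x. l * ?g x) \<in> borel_measurable ?M" "integrable ?M (\<lambda>x. (l * ?g x)\<^sup>2)"
      using tm t2 Gm G2 by (auto simp: power_mult_distrib)
    show "integrable ?M (\<lambda>x. (l * ?t x - ?g x)\<^sup>2)"
      by (rule integrable_square_diff[OF lt(1) Gm lt(2) G2])
    have "(LINT x|?M. (l * ?t x - ?g x)\<^sup>2) \<le> 2 * (LINT x|?M. (l * ?t x - l * ?g x)\<^sup>2) + 2 * (LINT x|?M. (l * ?g x - ?g x)\<^sup>2)"
      by (rule integral_square_diff_le[OF lt(1) lgm(1) Gm lt(2) lgm(2) G2])
    also have "(LINT x|?M. (l * ?t x - l * ?g x)\<^sup>2) = l\<^sup>2 * (LINT x|?M. (?t x - ?g x)\<^sup>2)"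
      by (simp add: right_diff_distrib[symmetric] power_mult_distrib)
    also have "(\<lambda>x. (l * ?g x - ?g x)\<^sup>2) = (\<lambda>x. (1 - l)\<^sup>2 * (?g x)\<^sup>2)"
      by (simp add: fun_eq_iff power2_eq_square algebra_simps)
    also have "2 * (l\<^sup>2 * (LINT x|?M. (?t x - ?g x)\<^sup>2)) + 2 * (LINT x|?M. (1 - l)\<^sup>2 * (?g x)\<^sup>2)
        \<le> 2 * (1 * (LINT x|?M. (?t x - ?g x)\<^sup>2)) + 2 * (q * (LINT x|?M. (?g x)\<^sup>2))"
    proof (rule add_mono)
      have "l\<^sup>2 \<le> 1\<^sup>2" using lg(4) l1 by (intro power_mono) auto
      then show "2 * (l\<^sup>2 * (LINT x|?M. (?t x - ?g x)\<^sup>2)) \<le> 2 * (1 * (LINT x|?M. (?t x - ?g x)\<^sup>2))"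
        by (intro mult_left_mono mult_right_mono) auto
      have "(1 - l)\<^sup>2 \<le> (1 - l) * 1" unfolding power2_eq_square using lg(4) l1 by (intro mult_left_mono) auto
      then have "(1 - l)\<^sup>2 \<le> q" using lg(5) by simp
      then show "2 * (LINT x|?M. (1 - l)\<^sup>2 * (?g x)\<^sup>2) \<le> 2 * (q * (LINT x|?M. (?g x)\<^sup>2))"
        by (simp add: mult_right_mono)
    qed
    finally show "(LINT x|?M. (l * ?t x - ?g x)\<^sup>2)
      \<le> 2 * (LINT x|?M. (?t x - ?g x)\<^sup>2) + 2 * (q * (LINT x|?M. (?g x)\<^sup>2))" by simp
  qed
  have "(LINT x|?M. (norm (grad ?\<phi> x - G x))\<^sup>2)
      = (LINT x|?M. (l * ?T l (\<lambda>y. G y $ 1) x - G x $ 1)\<^sup>2 + (l * ?T l (\<lambda>y. G y $ 2) x - G x $ 2)\<^sup>2)"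
  proof (rule Bochner_Integration.integral_cong)
    fix x assume "x \<in> space ?M"
    then have "x \<in> U" using US by (simp add: space_restrict_space)
    then show "(norm (grad ?\<phi> x - G x))\<^sup>2 = (l * ?T l (\<lambda>y. G y $ 1) x - G x $ 1)\<^sup>2 + (l * ?T l (\<lambda>y. G y $ 2) x - G x $ 2)\<^sup>2"
      unfolding power2_norm_eq_inner inner_vec_def sum_2 by (simp add: gr power2_eq_square)
  qed simp
  also have "\<dots> = (LINT x|?M. (l * ?T l (\<lambda>y. G y $ 1) x - G x $ 1)\<^sup>2) + (LINT x|?M. (l * ?T l (\<lambda>y. G y $ 2) x - G x $ 2)\<^sup>2)"
    using compi by (intro Bochner_Integration.integral_add) auto
  also have "\<dots> < d"
  proof -
    have "(LINT x|?M. (?T l (\<lambda>y. G y $ 1) x - G x $ 1)\<^sup>2) < d'" "(LINT x|?M. (?T l (\<lambda>y. G y $ 2) x - G x $ 2)\<^sup>2) < d'"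
      using L1(2) L2(2) lg l1 by auto
    moreover have "q * (LINT x|?M. (G x $ 1)\<^sup>2) + q * (LINT x|?M. (G x $ 2)\<^sup>2) \<le> d'"
      using q(3) by (simp add: N_def distrib_left)
    ultimately show ?thesis using comp[of 1] comp[of 2] d' by (simp add: d'_def)
  qed
  finally have "(LINT x|?M. (norm (grad ?\<phi> x - G x))\<^sup>2) < d" .
  moreover have "(LINT x|?M. (?\<phi> x - v x)\<^sup>2) < d"
    using Lv(2) lg(1) l1 d' by (force simp: e_def d'_def)
  moreover have "smooth ?\<phi>" by (rule mollify_smooth(1)[OF \<rho> e US fi])
  ultimately show ?thesis by blast
qed

text \<open>The limit is pointwise because one function on the plane must serve all edges. Weights
  4^n against the decay 8^-n give S a finite integral, so S is finite almost everywhere; there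
  consecutive terms differ by at most sqrt(S) 2^-n. This yields convergence and, squared and
  integrated, the rate 4^-n.\<close>

lemma L2_Cauchy_limit:
  fixes f :: "nat \<Rightarrow> 'a \<Rightarrow> real"
  assumes f: "\<And>n. f n \<in> borel_measurable M" and int: "\<And>n. integrable M (\<lambda>x. (f n x)\<^sup>2)"
    and cauchy: "\<And>n. (LINT x|M. (f (Suc n) x - f n x)\<^sup>2) \<le> B * (1/8) ^ n"
  defines "w \<equiv> \<lambda>x. lim (\<lambda>n. f n x)"
  shows "w \<in> borel_measurable M" and "integrable M (\<lambda>x. (w x)\<^sup>2)"
    and "(\<lambda>n. LINT x|M. (f n x - w x)\<^sup>2) \<longlonglongrightarrow> 0"
proof -
  show w: "w \<in> borel_measurable M" unfolding w_def using f by measurable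
  define S where "S x = (\<Sum>n. ennreal (4 ^ n * (f (Suc n) x - f n x)\<^sup>2))" for x
  have di: "integrable M (\<lambda>x. (f (Suc n) x - f n x)\<^sup>2)" for n
    by (rule integrable_square_diff[OF f f int int])
  have "0 \<le> (LINT x|M. (f (Suc 0) x - f 0 x)\<^sup>2)" by (intro integral_nonneg_AE AE_I2) simp
  from order_trans[OF this cauchy[of 0]] have B: "0 \<le> B" by simp
  have trm: "(\<lambda>x. ennreal (4 ^ n * (f (Suc n) x - f n x)\<^sup>2)) \<in> borel_measurable M" for n
    using f[of n] f[of "Suc n"] by measurable
  have Sm: "S \<in> borel_measurable M" unfolding S_def using trm by measurable
  have "(\<integral>\<^sup>+x. S x \<partial>M) = (\<Sum>n. \<integral>\<^sup>+x. ennreal (4 ^ n * (f (Suc n) x - f n x)\<^sup>2) \<partial>M)"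
    unfolding S_def by (rule nn_integral_suminf[OF trm])
  also have "\<dots> \<le> (\<Sum>n. ennreal (B * (1/2) ^ n))"
  proof (rule suminf_le)
    fix n
    have "(\<integral>\<^sup>+x. ennreal (4 ^ n * (f (Suc n) x - f n x)\<^sup>2) \<partial>M) = ennreal (LINT x|M. 4 ^ n * (f (Suc n) x - f n x)\<^sup>2)"
      using di by (intro nn_integral_eq_integral AE_I2) auto
    also have "\<dots> \<le> ennreal (B * (1/2) ^ n)"
    proof (rule ennreal_leI)
      have "4 ^ n * (LINT x|M. (f (Suc n) x - f n x)\<^sup>2) \<le> 4 ^ n * (B * (1/8) ^ n)"
        by (intro mult_left_mono cauchy) simp
      also have "\<dots> = B * (4 ^ n * (1/8) ^ n)" by simp
      also have "4 ^ n * (1/8) ^ n = ((1/2) ^ n :: real)" by (simp add: power_mult_distrib[symmetric])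
      finally show "(LINT x|M. 4 ^ n * (f (Suc n) x - f n x)\<^sup>2) \<le> B * (1/2) ^ n" by simp
    qed
    finally show "(\<integral>\<^sup>+x. ennreal (4 ^ n * (f (Suc n) x - f n x)\<^sup>2) \<partial>M) \<le> ennreal (B * (1/2) ^ n)" .
  qed auto
  also have "\<dots> = ennreal (\<Sum>n. B * (1/2) ^ n)"
    using B by (intro suminf_ennreal2 summable_mult summable_geometric) auto
  also have "(\<Sum>n. B * (1/2) ^ n) = 2 * B"
    using suminf_geometric[of "1/2::real"] by (simp add: suminf_mult summable_geometric)
  finally have SI: "(\<integral>\<^sup>+x. S x \<partial>M) \<le> ennreal (2 * B)" .
  have close: "ennreal ((f n x - w x)\<^sup>2) \<le> ennreal (4 * (1/4) ^ n) * S x" if fin: "S x \<noteq> \<infinity>" for n x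
  proof -
    define s where "s = enn2real (S x)"
    have s: "S x = ennreal s" "0 \<le> s" using fin by (auto simp: s_def ennreal_enn2real_if)
    have dk: "\<bar>f (Suc k) x - f k x\<bar> \<le> sqrt s * (1/2) ^ k" for k
    proof -
      have "ennreal (4 ^ k * (f (Suc k) x - f k x)\<^sup>2) \<le> (\<Sum>i\<in>{k}. ennreal (4 ^ i * (f (Suc i) x - f i x)\<^sup>2))" by simp
      also have "\<dots> \<le> S x" unfolding S_def by (rule sum_le_suminf) auto
      finally have "4 ^ k * (f (Suc k) x - f k x)\<^sup>2 \<le> s" using s by simp
      then have "(2 ^ k * \<bar>f (Suc k) x - f k x\<bar>)\<^sup>2 \<le> s"
        by (simp add: power_mult_distrib power2_eq_square[of "2 ^ k"] power_mult_distrib[symmetric])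
      then have "2 ^ k * \<bar>f (Suc k) x - f k x\<bar> \<le> sqrt s" by (rule real_le_rsqrt)
      then show ?thesis by (simp add: power_divide field_simps)
    qed
    have tail: "\<bar>f (n + k) x - f n x\<bar> \<le> sqrt s * (2 * (1/2) ^ n)" for n k
    proof -
      \<comment> \<open>The subtracted term makes the induction close; it is dropped
        afterwards.\<close>
      have "\<bar>f (n + k) x - f n x\<bar> \<le> sqrt s * (2 * (1/2) ^ n - 2 * (1/2) ^ (n + k))"
      proof (induction k)
        case (Suc k)
        have "\<bar>f (n + Suc k) x - f n x\<bar> \<le> \<bar>f (Suc (n + k)) x - f (n + k) x\<bar> + \<bar>f (n + k) x - f n x\<bar>" by simp
        also have "\<dots> \<le> sqrt s * (1/2) ^ (n + k) + sqrt s * (2 * (1/2) ^ n - 2 * (1/2) ^ (n + k))"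
          by (intro add_mono dk Suc)
        also have "\<dots> = sqrt s * (2 * (1/2) ^ n - 2 * (1/2) ^ (n + Suc k))" by (simp add: algebra_simps)
        finally show ?case .
      qed simp
      also have "\<dots> \<le> sqrt s * (2 * (1/2) ^ n)" using s(2) by (intro mult_left_mono) auto
      finally show ?thesis .
    qed
    have "summable (\<lambda>k. f (Suc k) x - f k x)"
    proof (rule summable_comparison_test')
      show "summable (\<lambda>k. sqrt s * (1/2) ^ k)" by (intro summable_mult summable_geometric) simp
      show "norm (f (Suc k) x - f k x) \<le> sqrt s * (1/2) ^ k" if "0 \<le> k" for k using dk by simp
    qed
    from summable_LIMSEQ[OF this]
    have "(\<lambda>k. f k x - f 0 x) \<longlonglongrightarrow> (\<Sum>k. f (Suc k) x - f k x)"
      by (simp add: sum_lessThan_telescope[of "\<lambda>k. f k x"])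
    from tendsto_add[OF this tendsto_const[of "f 0 x"]]
    have "convergent (\<lambda>k. f k x)" unfolding convergent_def by (simp add: exI)
    then have lim: "(\<lambda>k. f k x) \<longlonglongrightarrow> w x" by (simp add: w_def convergent_LIMSEQ_iff)
    then have "(\<lambda>k. \<bar>f (n + k) x - f n x\<bar>) \<longlonglongrightarrow> \<bar>w x - f n x\<bar>"
      using LIMSEQ_ignore_initial_segment[OF lim, of n] by (intro tendsto_intros) (simp add: add.commute)
    then have "\<bar>w x - f n x\<bar> \<le> sqrt s * (2 * (1/2) ^ n)"
      by (rule LIMSEQ_le_const2) (use tail in blast)
    then have "\<bar>w x - f n x\<bar>\<^sup>2 \<le> (sqrt s * (2 * (1/2) ^ n))\<^sup>2" by (intro power_mono) auto
    also have "\<dots> = s * (4 * ((1/2) ^ n)\<^sup>2)" using s(2) by (simp add: power_mult_distrib)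
    also have "((1/2::real) ^ n)\<^sup>2 = (1/4) ^ n" by (simp add: power2_eq_square power_mult_distrib[symmetric])
    finally have "(f n x - w x)\<^sup>2 \<le> (4 * (1/4) ^ n) * s" by (simp add: power2_commute mult.commute)
    then have "ennreal ((f n x - w x)\<^sup>2) \<le> ennreal ((4 * (1/4) ^ n) * s)" by (rule ennreal_leI)
    then show ?thesis unfolding s(1) using s(2) by (simp add: ennreal_mult)
  qed
  have "(\<integral>\<^sup>+x. S x \<partial>M) \<noteq> \<infinity>" using SI by (auto simp: top_unique)
  then have AES: "AE x in M. S x \<noteq> \<infinity>" using nn_integral_noteq_infinite[OF Sm] by simp
  have nnb: "(\<integral>\<^sup>+x. ennreal ((f n x - w x)\<^sup>2) \<partial>M) \<le> ennreal (8 * B * (1/4) ^ n)" for n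
  proof -
    have "(\<integral>\<^sup>+x. ennreal ((f n x - w x)\<^sup>2) \<partial>M) \<le> (\<integral>\<^sup>+x. ennreal (4 * (1/4) ^ n) * S x \<partial>M)"
    proof (rule nn_integral_mono_AE)
      show "AE x in M. ennreal ((f n x - w x)\<^sup>2) \<le> ennreal (4 * (1/4) ^ n) * S x"
        using AES by eventually_elim (rule close)
    qed
    also have "\<dots> = ennreal (4 * (1/4) ^ n) * (\<integral>\<^sup>+x. S x \<partial>M)" by (rule nn_integral_cmult[OF Sm])
    also have "\<dots> \<le> ennreal (4 * (1/4) ^ n) * ennreal (2 * B)" using SI by (intro mult_left_mono) auto
    also have "\<dots> = ennreal ((4 * (1/4) ^ n) * (2 * B))" using B by (intro ennreal_mult[symmetric]) auto
    also have "(4 * (1/4) ^ n) * (2 * B) = 8 * B * (1/4) ^ n" by simp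
    finally show ?thesis .
  qed
  have fwi: "integrable M (\<lambda>x. (f n x - w x)\<^sup>2)" for n
  proof (rule integrableI_bounded)
    show "(\<lambda>x. (f n x - w x)\<^sup>2) \<in> borel_measurable M" using f[of n] w by measurable
    have "(\<integral>\<^sup>+x. ennreal (norm ((f n x - w x)\<^sup>2)) \<partial>M) = (\<integral>\<^sup>+x. ennreal ((f n x - w x)\<^sup>2) \<partial>M)" by simp
    also have "\<dots> < \<infinity>" using nnb by (rule le_less_trans) simp
    finally show "(\<integral>\<^sup>+x. ennreal (norm ((f n x - w x)\<^sup>2)) \<partial>M) < \<infinity>" .
  qed
  have le: "(LINT x|M. (f n x - w x)\<^sup>2) \<le> 8 * B * (1/4) ^ n" for n
  proof -
    have "ennreal (LINT x|M. (f n x - w x)\<^sup>2) = (\<integral>\<^sup>+x. ennreal ((f n x - w x)\<^sup>2) \<partial>M)"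
      by (intro nn_integral_eq_integral[symmetric] fwi AE_I2) simp
    with nnb[of n] have "ennreal (LINT x|M. (f n x - w x)\<^sup>2) \<le> ennreal (8 * B * (1/4) ^ n)" by simp
    then show ?thesis using B by (simp add: ennreal_le_iff)
  qed
  show "integrable M (\<lambda>x. (w x)\<^sup>2)"
  proof -
    have "(\<lambda>x. f 0 x - w x) \<in> borel_measurable M" using f[of 0] w by measurable
    from integrable_square_diff[OF f this int fwi, of 0] show ?thesis by simp
  qed
  have "(\<lambda>n. 8 * B * (1/4::real) ^ n) \<longlonglongrightarrow> 8 * B * 0"
    by (intro tendsto_intros LIMSEQ_power_zero) simp
  then have z: "(\<lambda>n. 8 * B * (1/4::real) ^ n) \<longlonglongrightarrow> 0" by simp
  show "(\<lambda>n. LINT x|M. (f n x - w x)\<^sup>2) \<longlonglongrightarrow> 0"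
    by (rule tendsto_sandwich[OF _ _ tendsto_const z]) (use le in auto)
qed

section \<open>Traces on star-shaped elements\<close>

lemma norm_square_add_le:
  fixes a b :: "'a::real_inner"
  shows "(norm (a + b))\<^sup>2 \<le> 2 * (norm a)\<^sup>2 + 2 * (norm b)\<^sup>2"
proof -
  have "0 \<le> (norm (a - b))\<^sup>2" by simp
  then show ?thesis by (simp add: power2_norm_eq_inner inner_add_left inner_add_right inner_diff_left inner_diff_right inner_commute)
qed

lemma integrable_norm_square_diff:
  fixes f g :: "'a \<Rightarrow> 'b::euclidean_space"
  assumes "f \<in> borel_measurable M" "g \<in> borel_measurable M"
    "integrable M (\<lambda>x. (norm (f x))\<^sup>2)" "integrable M (\<lambda>x. (norm (g x))\<^sup>2)"
  shows "integrable M (\<lambda>x. (norm (f x - g x))\<^sup>2)"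
proof (rule Bochner_Integration.integrable_bound)
  show "integrable M (\<lambda>x. 2 * (norm (f x))\<^sup>2 + 2 * (norm (g x))\<^sup>2)" using assms by simp
  show "AE x in M. norm ((norm (f x - g x))\<^sup>2) \<le> norm (2 * (norm (f x))\<^sup>2 + 2 * (norm (g x))\<^sup>2)"
    using norm_square_add_le[of "f _" "- g _"] by (intro AE_I2) simp
qed (use assms in simp)

lemma integral_norm_square_le:
  fixes f g :: "'a \<Rightarrow> 'b::euclidean_space"
  assumes "f \<in> borel_measurable M" "g \<in> borel_measurable M"
    "integrable M (\<lambda>x. (norm (f x))\<^sup>2)" "integrable M (\<lambda>x. (norm (g x))\<^sup>2)"
  shows "(LINT x|M. (norm (f x))\<^sup>2) \<le> 2 * (LINT x|M. (norm (f x - g x))\<^sup>2) + 2 * (LINT x|M. (norm (g x))\<^sup>2)"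
proof -
  have i: "integrable M (\<lambda>x. (norm (f x - g x))\<^sup>2)" using assms by (rule integrable_norm_square_diff)
  have "(LINT x|M. (norm (f x))\<^sup>2) \<le> (LINT x|M. 2 * (norm (f x - g x))\<^sup>2 + 2 * (norm (g x))\<^sup>2)"
  proof (rule integral_mono)
    show "(norm (f x))\<^sup>2 \<le> 2 * (norm (f x - g x))\<^sup>2 + 2 * (norm (g x))\<^sup>2" for x
      using norm_square_add_le[of "f x - g x" "g x"] by simp
  qed (use i assms(3,4) in simp_all)
  also have "\<dots> = 2 * (LINT x|M. (norm (f x - g x))\<^sup>2) + 2 * (LINT x|M. (norm (g x))\<^sup>2)"
    using i assms(4) by simp
  finally show ?thesis .
qed

lemma continuous_integrable_lebesgue_on:
  fixes g :: "point \<Rightarrow> real"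
  assumes g: "continuous_on UNIV g" and U: "U \<in> lmeasurable" "bounded U"
  shows "integrable (lebesgue_on U) g"
proof -
  have US: "U \<in> sets lebesgue" using U(1) by (rule fmeasurableD)
  interpret finite_measure "lebesgue_on U" using U(1) by (rule finite_measure_lebesgue_on)
  have "compact (g ` closure U)"
    using U(2) by (intro compact_continuous_image continuous_on_subset[OF g]) (auto simp: compact_closure)
  then have "bounded (g ` closure U)" by (rule compact_imp_bounded)
  then obtain B where "\<forall>x\<in>g ` closure U. norm x \<le> B" unfolding bounded_iff by (elim exE)
  then have B: "norm (g x) \<le> B" if "x \<in> U" for x using that closure_subset[of U] by blast
  show ?thesis
  proof (rule integrable_const_bound[where B=B])
    show "AE x in lebesgue_on U. norm (g x) \<le> B"
      using B US by (intro AE_I2) (simp add: space_restrict_space)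
  qed (rule continuous_measurable_lebesgue_on[OF g US])
qed

section \<open>Weighted L^2 integrals along an edge\<close>

lemma visible_edge_continuous:
  assumes "visible_edge s y \<kappa> \<gamma>"
  shows "continuous_on {0..1} \<gamma>" "continuous_on {0..1} (\<lambda>t. norm (vector_derivative \<gamma> (at t)))"
proof -
  have "\<gamma> differentiable (at t)" if "t \<in> {0..1}" for t
    using assms that by (simp add: visible_edge_def)
  then have "isCont \<gamma> t" if "t \<in> {0..1}" for t
    using that differentiable_imp_continuous_within by blast
  then show "continuous_on {0..1} \<gamma>" by (simp add: continuous_at_imp_continuous_on)
  show "continuous_on {0..1} (\<lambda>t. norm (vector_derivative \<gamma> (at t)))"
    using assms by (intro continuous_intros) (simp add: visible_edge_def)
qed

definition edge_L2sq :: "(real \<Rightarrow> point) \<Rightarrow> (point \<Rightarrow> real) \<Rightarrow> real" where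
  "edge_L2sq \<gamma> w = (LINT t|lebesgue_on {0..1}. (w (\<gamma> t))\<^sup>2 * norm (vector_derivative \<gamma> (at t)))"

lemma edge_L2sq_nonneg: "0 \<le> edge_L2sq \<gamma> w"
  unfolding edge_L2sq_def by (intro integral_nonneg_AE AE_I2) simp

lemma L2_norm_bdry_sq: "(L2_norm_bdry K w)\<^sup>2 = (\<Sum>\<gamma>\<leftarrow>edge_paths K. edge_L2sq \<gamma> w)"
proof -
  have "0 \<le> (\<Sum>\<gamma>\<leftarrow>edge_paths K. edge_L2sq \<gamma> w)"
    by (intro sum_list_nonneg) (auto simp: edge_L2sq_nonneg)
  then show ?thesis by (simp add: L2_norm_bdry_def edge_L2sq_def[symmetric])
qed

lemma L2_norm_on_sq: "(L2_norm_on U f)\<^sup>2 = (LINT x|lebesgue_on U. (norm (f x))\<^sup>2)"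
proof -
  have "0 \<le> (LINT x|lebesgue_on U. (norm (f x))\<^sup>2)" by (intro integral_nonneg_AE AE_I2) simp
  then show ?thesis by (simp add: L2_norm_on_def)
qed

lemma edge_L2_continuous:
  assumes vis: "visible_edge s y \<kappa> \<gamma>" and \<phi>: "continuous_on UNIV \<phi>"
  shows "(\<lambda>t. \<phi> (\<gamma> t)) \<in> borel_measurable (lebesgue_on {0..1})"
    and "integrable (lebesgue_on {0..1}) (\<lambda>t. (\<phi> (\<gamma> t))\<^sup>2 * norm (vector_derivative \<gamma> (at t)))"
proof -
  note c = visible_edge_continuous[OF vis]
  have c1: "continuous_on {0..1} (\<lambda>t. \<phi> (\<gamma> t))" by (rule continuous_on_compose2[OF \<phi> c(1)]) simp
  then show "(\<lambda>t. \<phi> (\<gamma> t)) \<in> borel_measurable (lebesgue_on {0..1})"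
    by (rule continuous_imp_measurable_on_sets_lebesgue) simp
  show "integrable (lebesgue_on {0..1}) (\<lambda>t. (\<phi> (\<gamma> t))\<^sup>2 * norm (vector_derivative \<gamma> (at t)))"
    by (intro continuous_imp_integrable_real continuous_on_mult continuous_on_power c1 c(2))
qed

lemma edge_L2sq_le:
  assumes vis: "visible_edge s y \<kappa> \<gamma>" and \<phi>: "continuous_on UNIV \<phi>"
    and w: "(\<lambda>t. w (\<gamma> t)) \<in> borel_measurable (lebesgue_on {0..1})"
      "integrable (lebesgue_on {0..1}) (\<lambda>t. (w (\<gamma> t))\<^sup>2 * norm (vector_derivative \<gamma> (at t)))"
  shows "edge_L2sq \<gamma> w \<le> 2 * edge_L2sq \<gamma> (\<lambda>x. \<phi> x - w x) + 2 * edge_L2sq \<gamma> \<phi>"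
proof -
  let ?M = "lebesgue_on {0..1::real}" and ?n = "\<lambda>t. norm (vector_derivative \<gamma> (at t))"
  note p = edge_L2_continuous[OF vis \<phi>]
  have nm: "?n \<in> borel_measurable ?M"
    by (rule continuous_imp_measurable_on_sets_lebesgue[OF visible_edge_continuous(2)[OF vis]]) simp
  have le: "(a - b)\<^sup>2 * c \<le> 2 * (a\<^sup>2 * c) + 2 * (b\<^sup>2 * c)" if "0 \<le> c" for a b c :: real
    using mult_right_mono[OF square_diff_le[of a b 0] that] by (simp add: distrib_right)
  have i: "integrable ?M (\<lambda>t. (\<phi> (\<gamma> t) - w (\<gamma> t))\<^sup>2 * ?n t)"
  proof (rule Bochner_Integration.integrable_bound)
    show "integrable ?M (\<lambda>t. 2 * ((\<phi> (\<gamma> t))\<^sup>2 * ?n t) + 2 * ((w (\<gamma> t))\<^sup>2 * ?n t))" using p w by simp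
    show "AE t in ?M. norm ((\<phi> (\<gamma> t) - w (\<gamma> t))\<^sup>2 * ?n t) \<le> norm (2 * ((\<phi> (\<gamma> t))\<^sup>2 * ?n t) + 2 * ((w (\<gamma> t))\<^sup>2 * ?n t))"
      using le[OF norm_ge_zero] by (intro AE_I2) simp
  qed (use p(1) w(1) nm in measurable)
  have "edge_L2sq \<gamma> w \<le> (LINT t|?M. 2 * ((\<phi> (\<gamma> t) - w (\<gamma> t))\<^sup>2 * ?n t) + 2 * ((\<phi> (\<gamma> t))\<^sup>2 * ?n t))"
    unfolding edge_L2sq_def
  proof (rule integral_mono)
    show "integrable ?M (\<lambda>t. 2 * ((\<phi> (\<gamma> t) - w (\<gamma> t))\<^sup>2 * ?n t) + 2 * ((\<phi> (\<gamma> t))\<^sup>2 * ?n t))"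
      using i p by simp
    show "(w (\<gamma> t))\<^sup>2 * ?n t \<le> 2 * ((\<phi> (\<gamma> t) - w (\<gamma> t))\<^sup>2 * ?n t) + 2 * ((\<phi> (\<gamma> t))\<^sup>2 * ?n t)" for t
      using le[OF norm_ge_zero, of "\<phi> (\<gamma> t) - w (\<gamma> t)" "\<phi> (\<gamma> t)"] by (simp add: power2_commute)
  qed (rule w(2))
  also have "\<dots> = 2 * edge_L2sq \<gamma> (\<lambda>x. \<phi> x - w x) + 2 * edge_L2sq \<gamma> \<phi>"
    unfolding edge_L2sq_def using i p by simp
  finally show ?thesis .
qed

text \<open>A smooth sequence that is Cauchy in \<open>L\<^sup>2\<close> of the edge converges to its pointwise limit; the
  arc-length weight is made part of the measure so that this limit is a function on the plane.\<close>

lemma edge_limit: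
  assumes vis: "visible_edge s y \<kappa> \<gamma>" and \<phi>: "\<And>n. continuous_on UNIV (\<phi> n)"
    and cauchy: "\<And>n. edge_L2sq \<gamma> (\<lambda>x. \<phi> (Suc n) x - \<phi> n x) \<le> B * (1/8) ^ n"
  defines "w \<equiv> \<lambda>x. lim (\<lambda>n. \<phi> n x)"
  shows "(\<lambda>t. w (\<gamma> t)) \<in> borel_measurable (lebesgue_on {0..1})"
    and "integrable (lebesgue_on {0..1}) (\<lambda>t. (w (\<gamma> t))\<^sup>2 * norm (vector_derivative \<gamma> (at t)))"
    and "(\<lambda>n. edge_L2sq \<gamma> (\<lambda>x. \<phi> n x - w x)) \<longlonglongrightarrow> 0"
proof -
  let ?M = "lebesgue_on {0..1::real}" and ?n = "\<lambda>t. norm (vector_derivative \<gamma> (at t))"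
  let ?D = "density ?M (\<lambda>t. ennreal (?n t))"
  note p = edge_L2_continuous[OF vis \<phi>]
  have nm: "?n \<in> borel_measurable ?M"
    by (rule continuous_imp_measurable_on_sets_lebesgue[OF visible_edge_continuous(2)[OF vis]]) simp
  have I: "(LINT t|?D. (g t)\<^sup>2) = (LINT t|?M. (g t)\<^sup>2 * ?n t)" if "g \<in> borel_measurable ?M" for g :: "real \<Rightarrow> real"
  proof -
    have "(\<lambda>t. (g t)\<^sup>2) \<in> borel_measurable ?M" using that by measurable
    from integral_density[OF this nm] show ?thesis by (simp add: mult.commute)
  qed
  have J: "integrable ?D (\<lambda>t. (g t)\<^sup>2) \<longleftrightarrow> integrable ?M (\<lambda>t. (g t)\<^sup>2 * ?n t)" if "g \<in> borel_measurable ?M" for g :: "real \<Rightarrow> real"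
  proof -
    have "(\<lambda>t. (g t)\<^sup>2) \<in> borel_measurable ?M" using that by measurable
    from integrable_density[OF this nm] show ?thesis by (simp add: mult.commute)
  qed
  have cD: "(LINT t|?D. (\<phi> (Suc n) (\<gamma> t) - \<phi> n (\<gamma> t))\<^sup>2) \<le> B * (1/8) ^ n" for n
  proof -
    have "(\<lambda>t. \<phi> (Suc n) (\<gamma> t) - \<phi> n (\<gamma> t)) \<in> borel_measurable ?M"
      using p(1)[of "Suc n"] p(1)[of n] by measurable
    from I[OF this] show ?thesis using cauchy[of n] by (simp add: edge_L2sq_def)
  qed
  have 1: "\<And>n. (\<lambda>t. \<phi> n (\<gamma> t)) \<in> borel_measurable ?D" using p(1) by simp
  have 2: "\<And>n. integrable ?D (\<lambda>t. (\<phi> n (\<gamma> t))\<^sup>2)" using p by (simp add: J)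
  note lim = L2_Cauchy_limit[where f="\<lambda>n t. \<phi> n (\<gamma> t)" and M="?D", OF 1 2 cD]
  show wm: "(\<lambda>t. w (\<gamma> t)) \<in> borel_measurable ?M" using lim(1) by (simp add: w_def)
  show "integrable ?M (\<lambda>t. (w (\<gamma> t))\<^sup>2 * ?n t)" using lim(2) unfolding J[OF wm, symmetric] by (simp add: w_def)
  have "(LINT t|?D. (\<phi> n (\<gamma> t) - w (\<gamma> t))\<^sup>2) = edge_L2sq \<gamma> (\<lambda>x. \<phi> n x - w x)" for n
  proof -
    have "(\<lambda>t. \<phi> n (\<gamma> t) - w (\<gamma> t)) \<in> borel_measurable ?M" using p(1)[of n] wm by measurable
    from I[OF this] show ?thesis by (simp add: edge_L2sq_def)
  qed
  with lim(3) show "(\<lambda>n. edge_L2sq \<gamma> (\<lambda>x. \<phi> n x - w x)) \<longlonglongrightarrow> 0" by (simp add: w_def)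
qed

text \<open>The data x0, r, s and \<kappa> vary from element to element; C is the one that is
  uniform over the meshes and reaches the final constant.\<close>

locale star_shaped_element =
  fixes K :: element and x0 :: point and r s \<kappa> C :: real
  assumes elt: "is_element K" and star: "star_element K x0 r s \<kappa>" and C: "\<kappa> * h_el K \<le> C"
begin

abbreviation (input) "U \<equiv> elem_int K"
abbreviation (input) "h \<equiv> h_el K"

lemma r: "0 < r" and s: "\<bar>s\<bar> = 1" and \<kappa>: "0 < \<kappa>"
  using star by (auto simp: star_element_def)

lemma visible: "\<gamma> \<in> set (edge_paths K) \<Longrightarrow> visible_edge s x0 \<kappa> \<gamma>"
  using star by (simp add: star_element_def)

lemmas region = star_element_region[OF elt star]

lemma center: "x0 \<in> ball x0 r" using r by simp

lemma boundary: "\<gamma> \<in> set (edge_paths K) \<Longrightarrow> t \<in> {0..1} \<Longrightarrow> \<gamma> t \<in> element_boundary K"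
  unfolding element_boundary_def path_image_def by (rule UN_I, assumption, rule imageI)

lemma U: "U \<in> lmeasurable" "bounded U"
proof -
  have "compact (element_boundary K)"
    using element_boundary_homeomorphic_sphere[OF elt] homeomorphic_compactness compact_sphere by blast
  then have "bounded (inside (element_boundary K))" "open (inside (element_boundary K))"
    by (simp_all add: bounded_inside compact_imp_bounded open_inside compact_imp_closed)
  then show "bounded U" "U \<in> lmeasurable"
    unfolding region(2)[OF center] by (simp_all add: lmeasurable_open)
qed

lemma U_sets: "U \<in> sets lebesgue"
  using U(1) by (rule fmeasurableD)

text \<open>A point z of the ball around the contracted x is (1 - l) y + l x with y within r/2 of
  the centre, and U is star-shaped about y. Halving r keeps y in the open ball.\<close>

lemma shrink_subset:
  assumes x: "x \<in> U" and l: "0 < l" "l < 1"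
  shows "cball (shrink x0 l x) ((1 - l) * (r / 2)) \<subseteq> U"
proof
  fix z assume z: "z \<in> cball (shrink x0 l x) ((1 - l) * (r / 2))"
  define y where "y = x0 + (1 / (1 - l)) *\<^sub>R (z - shrink x0 l x)"
  have "norm (z - shrink x0 l x) \<le> (1 - l) * (r / 2)" using z by (simp add: dist_norm norm_minus_commute)
  moreover have "norm (y - x0) = norm (z - shrink x0 l x) / (1 - l)" using l by (simp add: y_def)
  ultimately have "norm (y - x0) \<le> r / 2" using l by (simp add: pos_divide_le_eq mult.commute)
  then have yb: "y \<in> ball x0 r" using r by (simp add: dist_norm norm_minus_commute)
  have "(1 - l) *\<^sub>R (y - x0) = z - shrink x0 l x" using l by (simp add: y_def)
  then have zy: "z = y + l *\<^sub>R (x - y)" by (simp add: shrink_def algebra_simps)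
  obtain p t where p: "p \<in> element_boundary K" "0 \<le> t" "t < 1" "x = y + t *\<^sub>R (p - y)"
    using x unfolding region(1)[OF yb] by blast
  have "z = y + (l * t) *\<^sub>R (p - y)" unfolding zy by (simp add: p(4))
  moreover have "0 \<le> l * t" using l p(2) by simp
  moreover have "l * t \<le> l * 1" using l p(3) by (intro mult_left_mono) auto
  then have "l * t < 1" using l(2) by linarith
  ultimately show "z \<in> U" unfolding region(1)[OF yb] using p(1) by blast
qed

lemma dist_center: "p \<in> element_boundary K \<Longrightarrow> norm (p - x0) \<le> h"
proof -
  assume p: "p \<in> element_boundary K"
  have "x0 = x0 + 0 *\<^sub>R (p - x0)" by simp
  then have "x0 \<in> U" unfolding region(1)[OF center] using p
    by (intro CollectI exI[of _ p] exI[of _ "0::real"]) simp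
  then have "x0 \<in> region K" using interior_subset by blast
  moreover have "p \<in> region K" using p by (simp add: region_def)
  ultimately have "dist p x0 \<le> h" unfolding h_el_def
    by (intro diameter_bounded_bound bounded_region elt)
  then show ?thesis by (simp add: dist_norm)
qed

lemma h: "0 < h"
proof -
  obtain g1 g2 g3 where g: "edge_paths K = [g1, g2, g3]" by (rule edge_paths_three)
  then have g1: "g1 \<in> set (edge_paths K)" by simp
  have "g1 0 \<noteq> x0" by (rule visible_edge_not_center[OF visible[OF g1] \<kappa>]) simp
  moreover have "norm (g1 0 - x0) \<le> h" by (intro dist_center boundary[OF g1]) simp
  moreover from calculation(1) have "0 < norm (g1 0 - x0)" by simp
  ultimately show ?thesis by linarith
qed

text \<open>Young's inequality: \<open>2 h |\<phi>| |\<nabla>\<phi>| \<le> \<phi>\<^sup>2 + h\<^sup>2 |\<nabla>\<phi>|\<^sup>2\<close>.\<close>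

lemma edge_trace_smooth:
  assumes \<phi>: "smooth \<phi>" and \<gamma>: "\<gamma> \<in> set (edge_paths K)"
  shows "edge_L2sq \<gamma> \<phi> \<le> 3 * C * (inverse h * (LINT x|lebesgue_on U. (\<phi> x)\<^sup>2) + h * (LINT x|lebesgue_on U. (norm (grad \<phi> x))\<^sup>2))"
proof -
  let ?H = "\<lambda>x. 2 * (\<phi> x)\<^sup>2 + 2 * h * \<bar>\<phi> x\<bar> * norm (grad \<phi> x)"
  let ?A = "LINT x|lebesgue_on U. (\<phi> x)\<^sup>2" and ?B = "LINT x|lebesgue_on U. (norm (grad \<phi> x))\<^sup>2"
  have c: "continuous_on UNIV \<phi>" "continuous_on UNIV (grad \<phi>)"
    by (rule smooth_continuous[OF \<phi>], rule smooth_grad_continuous[OF \<phi>])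
  have i: "integrable (lebesgue_on U) (\<lambda>x. (\<phi> x)\<^sup>2)" "integrable (lebesgue_on U) (\<lambda>x. (norm (grad \<phi> x))\<^sup>2)"
      "integrable (lebesgue_on U) ?H"
    by (intro continuous_integrable_lebesgue_on U continuous_intros c)+
  note vis = visible[OF \<gamma>]
  have "edge_L2sq \<gamma> \<phi> = integral {0..1} (\<lambda>t. (\<phi> (\<gamma> t))\<^sup>2 * norm (vector_derivative \<gamma> (at t)))"
    unfolding edge_L2sq_def by (rule lebesgue_integral_eq_integral[OF edge_L2_continuous(2)[OF vis c(1)]]) simp
  also have "\<dots> \<le> \<kappa> * integral U ?H"
  proof (rule visible_edge_trace[OF vis \<kappa> s smooth_grad_has_derivative[OF \<phi>] c(2)])
    show "norm (\<gamma> t - x0) \<le> h" if "t \<in> {0..1}" for t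
      by (rule dist_center[OF boundary[OF \<gamma> that]])
    show "x0 + q *\<^sub>R (\<gamma> t - x0) \<in> U" if "t \<in> {0<..<1}" "q \<in> {0<..<1}" for t q
      unfolding region(1)[OF center] using that boundary[OF \<gamma>, of t] by (intro CollectI exI[of _ "\<gamma> t"] exI[of _ q]) auto
    show "?H integrable_on U" by (rule integrable_on_lebesgue_on[OF i(3) U_sets])
  qed
  also have "integral U ?H = (LINT x|lebesgue_on U. ?H x)"
    by (rule lebesgue_integral_eq_integral[OF i(3) U_sets, symmetric])
  also have "\<kappa> * (LINT x|lebesgue_on U. ?H x) \<le> \<kappa> * (LINT x|lebesgue_on U. 3 * (\<phi> x)\<^sup>2 + h\<^sup>2 * (norm (grad \<phi> x))\<^sup>2)"
  proof (intro mult_left_mono integral_mono)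
    fix x
    have "0 \<le> (\<bar>\<phi> x\<bar> - h * norm (grad \<phi> x))\<^sup>2" by simp
    then show "?H x \<le> 3 * (\<phi> x)\<^sup>2 + h\<^sup>2 * (norm (grad \<phi> x))\<^sup>2"
      by (simp add: power2_diff power_mult_distrib algebra_simps)
  qed (use i \<kappa> in auto)
  also have "\<dots> = \<kappa> * (3 * ?A + h\<^sup>2 * ?B)" using i by simp
  \<comment> \<open>Extracting \<kappa> h, which is at most C, leaves the weights 1/h and h of the
    claim.\<close>
  also have "\<dots> = (\<kappa> * h) * (3 * (inverse h * ?A) + h * ?B)"
    using h by (simp add: field_simps power2_eq_square)
  also have "\<dots> \<le> C * (3 * (inverse h * ?A) + h * ?B)"
    using C h by (intro mult_right_mono add_nonneg_nonneg mult_nonneg_nonneg integral_nonneg_AE AE_I2) auto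
  \<comment> \<open>The gradient term is enlarged so that both terms share the factor 3.\<close>
  also have "\<dots> \<le> C * (3 * (inverse h * ?A) + 3 * (h * ?B))"
  proof (rule mult_left_mono)
    have "0 \<le> h * ?B" using h by (intro mult_nonneg_nonneg integral_nonneg_AE AE_I2) auto
    then show "3 * (inverse h * ?A) + h * ?B \<le> 3 * (inverse h * ?A) + 3 * (h * ?B)" by simp
    show "0 \<le> C" using C mult_pos_pos[OF \<kappa> h] by linarith
  qed
  finally show ?thesis by (simp add: algebra_simps)
qed

lemma C_pos: "0 < C"
  using C mult_pos_pos[OF \<kappa> h] by linarith

lemma smooth_square_integrable:
  assumes "smooth \<phi>"
  shows "\<phi> \<in> borel_measurable (lebesgue_on U)" "grad \<phi> \<in> borel_measurable (lebesgue_on U)"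
    "integrable (lebesgue_on U) (\<lambda>x. (norm (\<phi> x))\<^sup>2)" "integrable (lebesgue_on U) (\<lambda>x. (norm (grad \<phi> x))\<^sup>2)"
proof -
  have c: "continuous_on UNIV \<phi>" "continuous_on UNIV (grad \<phi>)"
    by (rule smooth_continuous[OF assms], rule smooth_grad_continuous[OF assms])
  show "\<phi> \<in> borel_measurable (lebesgue_on U)" "grad \<phi> \<in> borel_measurable (lebesgue_on U)"
    by (rule continuous_measurable_lebesgue_on[OF c(1) U_sets], rule continuous_measurable_lebesgue_on[OF c(2) U_sets])
  show "integrable (lebesgue_on U) (\<lambda>x. (norm (\<phi> x))\<^sup>2)" "integrable (lebesgue_on U) (\<lambda>x. (norm (grad \<phi> x))\<^sup>2)"
    by (intro continuous_integrable_lebesgue_on U continuous_intros c)+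
qed

lemma weak_grad:
  assumes "v \<in> H1_on U"
  shows "L2_on U v" "L2_on U (weak_grad U v)" "is_weak_grad U v (weak_grad U v)"
proof -
  show "L2_on U v" using assms by (simp add: H1_on_def)
  have "\<exists>G. L2_on U G \<and> is_weak_grad U v G" using assms by (simp add: H1_on_def)
  from someI_ex[OF this] show "L2_on U (weak_grad U v)" "is_weak_grad U v (weak_grad U v)"
    unfolding weak_grad_def by auto
qed

text \<open>With tolerance 8^-n for the approximants, the inequality for smooth functions bounds
  successive differences on each edge at the rate that \<open>L2_Cauchy_limit\<close> asks for. A
  single pointwise limit w works on all three edges, so it is consistent at shared vertices.\<close>

lemma trace_exists:
  assumes v: "v \<in> H1_on U"
  shows "\<exists>w. has_trace K v w"
proof -
  let ?M = "lebesgue_on U" and ?G = "weak_grad U v"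
  note wg = weak_grad[OF v]
  have ex: "\<exists>\<phi>. smooth \<phi> \<and> (LINT x|?M. (\<phi> x - v x)\<^sup>2) < (1/8) ^ n \<and> (LINT x|?M. (norm (grad \<phi> x - ?G x))\<^sup>2) < (1/8) ^ n" for n :: nat
    using r by (intro smooth_approx_H1[OF U _ shrink_subset wg]) auto
  have "\<forall>n. \<exists>\<phi>. smooth \<phi> \<and> (LINT x|?M. (\<phi> x - v x)\<^sup>2) < (1/8) ^ n \<and> (LINT x|?M. (norm (grad \<phi> x - ?G x))\<^sup>2) < (1/8) ^ n"
    by (rule allI) (rule ex)
  from choice[OF this] obtain \<phi> where \<phi>: "\<forall>n. smooth (\<phi> n) \<and> (LINT x|?M. (\<phi> n x - v x)\<^sup>2) < (1/8) ^ n \<and> (LINT x|?M. (norm (grad (\<phi> n) x - ?G x))\<^sup>2) < (1/8) ^ n"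
    by (elim exE)
  have sm: "smooth (\<phi> n)" and a: "(LINT x|?M. (norm (\<phi> n x - v x))\<^sup>2) < (1/8) ^ n"
    and b: "(LINT x|?M. (norm (grad (\<phi> n) x - ?G x))\<^sup>2) < (1/8) ^ n" for n
    using \<phi>[rule_format, of n] by auto
  have vm: "v \<in> borel_measurable ?M" "integrable ?M (\<lambda>x. (norm (v x))\<^sup>2)"
    and Gm: "?G \<in> borel_measurable ?M" "integrable ?M (\<lambda>x. (norm (?G x))\<^sup>2)"
    using wg(1,2) by (simp_all add: L2_on_def)
  define w where "w = (\<lambda>x. lim (\<lambda>n. \<phi> n x))"
  \<comment> \<open>Successive approximants differ in either squared norm by at most 2 (8^-n +
    8^-(n+1)) \<le> 4 * 8^-n; hence the two factors 4.\<close>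
  define B where "B = 3 * C * (inverse h * 4 + h * 4)"
  have diff_sm: "smooth (\<lambda>x. \<phi> (Suc n) x - \<phi> n x)" and diff_gr: "grad (\<lambda>x. \<phi> (Suc n) x - \<phi> n x) x = grad (\<phi> (Suc n)) x - grad (\<phi> n) x" for n x
  proof -
    have "smooth (\<lambda>x. (- 1) * \<phi> n x)" by (intro smooth_mult smooth_const sm)
    from smooth_add[OF sm[of "Suc n"] this] show "smooth (\<lambda>x. \<phi> (Suc n) x - \<phi> n x)" by simp
    show "grad (\<lambda>x. \<phi> (Suc n) x - \<phi> n x) x = grad (\<phi> (Suc n)) x - grad (\<phi> n) x"
      using has_derivative_diff[OF smooth_grad_has_derivative[OF sm[of "Suc n"], of x] smooth_grad_has_derivative[OF sm[of n], of x]]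
      by (intro grad_unique) (simp add: inner_diff_left)
  qed
  have cauchy: "edge_L2sq \<gamma> (\<lambda>x. \<phi> (Suc n) x - \<phi> n x) \<le> B * (1/8) ^ n" if \<gamma>: "\<gamma> \<in> set (edge_paths K)" for \<gamma> n
  proof -
    note s1 = smooth_square_integrable[OF sm[of "Suc n"]] and s0 = smooth_square_integrable[OF sm[of n]]
    have pow: "(1/8::real) ^ Suc n \<le> (1/8) ^ n" by simp
    have d1: "(LINT x|?M. (\<phi> (Suc n) x - \<phi> n x)\<^sup>2) \<le> 4 * (1/8) ^ n"
    proof -
      have 1: "(LINT x|?M. (\<phi> (Suc n) x - \<phi> n x)\<^sup>2) \<le> 2 * (LINT x|?M. (\<phi> (Suc n) x - v x)\<^sup>2) + 2 * (LINT x|?M. (v x - \<phi> n x)\<^sup>2)"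
        using s1 s0 vm by (intro integral_square_diff_le) simp_all
      have 2: "(LINT x|?M. (v x - \<phi> n x)\<^sup>2) = (LINT x|?M. (\<phi> n x - v x)\<^sup>2)" by (simp add: power2_commute)
      have 3: "(LINT x|?M. (\<phi> k x - v x)\<^sup>2) < (1/8) ^ k" for k using a[of k] by simp
      show ?thesis using 1 2 3[of n] 3[of "Suc n"] pow by linarith
    qed
    have d2: "(LINT x|?M. (norm (grad (\<phi> (Suc n)) x - grad (\<phi> n) x))\<^sup>2) \<le> 4 * (1/8) ^ n"
    proof -
      let ?f = "\<lambda>x. grad (\<phi> (Suc n)) x - ?G x" and ?g = "\<lambda>x. grad (\<phi> n) x - ?G x"
      have i: "integrable ?M (\<lambda>x. (norm (?f x))\<^sup>2)" "integrable ?M (\<lambda>x. (norm (?g x))\<^sup>2)"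
        by (rule integrable_norm_square_diff[OF s1(2) Gm(1) s1(4) Gm(2)], rule integrable_norm_square_diff[OF s0(2) Gm(1) s0(4) Gm(2)])
      have "(LINT x|?M. (norm (grad (\<phi> (Suc n)) x - grad (\<phi> n) x))\<^sup>2) \<le> (LINT x|?M. 2 * (norm (?f x))\<^sup>2 + 2 * (norm (?g x))\<^sup>2)"
      proof (rule integral_mono)
        show "integrable ?M (\<lambda>x. (norm (grad (\<phi> (Suc n)) x - grad (\<phi> n) x))\<^sup>2)"
          by (rule integrable_norm_square_diff[OF s1(2) s0(2) s1(4) s0(4)])
        show "(norm (grad (\<phi> (Suc n)) x - grad (\<phi> n) x))\<^sup>2 \<le> 2 * (norm (?f x))\<^sup>2 + 2 * (norm (?g x))\<^sup>2" for x
          using norm_square_add_le[of "?f x" "- ?g x"] unfolding norm_minus_cancel by simp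
      qed (use i in simp)
      also have "\<dots> = 2 * (LINT x|?M. (norm (?f x))\<^sup>2) + 2 * (LINT x|?M. (norm (?g x))\<^sup>2)" using i by simp
      finally show ?thesis using b[of n] b[of "Suc n"] pow by linarith
    qed
    have "edge_L2sq \<gamma> (\<lambda>x. \<phi> (Suc n) x - \<phi> n x) \<le> 3 * C * (inverse h * (LINT x|?M. (\<phi> (Suc n) x - \<phi> n x)\<^sup>2)
        + h * (LINT x|?M. (norm (grad (\<phi> (Suc n)) x - grad (\<phi> n) x))\<^sup>2))"
      using edge_trace_smooth[OF diff_sm \<gamma>] unfolding diff_gr .
    also have "\<dots> \<le> 3 * C * (inverse h * (4 * (1/8) ^ n) + h * (4 * (1/8) ^ n))"
      using C_pos h d1 d2 by (intro mult_left_mono add_mono) auto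
    also have "\<dots> = B * (1/8) ^ n" by (simp add: B_def algebra_simps)
    finally show ?thesis .
  qed
  have cont: "continuous_on UNIV (\<phi> n)" for n by (rule smooth_continuous[OF sm])
  have lim: "(\<lambda>t. w (\<gamma> t)) \<in> borel_measurable (lebesgue_on {0..1})"
      "integrable (lebesgue_on {0..1}) (\<lambda>t. (w (\<gamma> t))\<^sup>2 * norm (vector_derivative \<gamma> (at t)))"
      "(\<lambda>n. edge_L2sq \<gamma> (\<lambda>x. \<phi> n x - w x)) \<longlonglongrightarrow> 0"
    if \<gamma>: "\<gamma> \<in> set (edge_paths K)" for \<gamma>
    unfolding w_def by (rule edge_limit[OF visible[OF \<gamma>] cont cauchy[OF \<gamma>]])+
  have "L2_bdry K w" unfolding L2_bdry_def by (intro ballI conjI lim(1,2))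
  moreover have "(\<lambda>n. L2_norm_on U (\<lambda>x. \<phi> n x - v x)) \<longlonglongrightarrow> 0" "(\<lambda>n. L2_norm_on U (\<lambda>x. grad (\<phi> n) x - ?G x)) \<longlonglongrightarrow> 0"
  proof -
    have z: "(\<lambda>n. (1/8::real) ^ n) \<longlonglongrightarrow> 0" by (rule LIMSEQ_power_zero) simp
    have "(\<lambda>n. LINT x|?M. (norm (\<phi> n x - v x))\<^sup>2) \<longlonglongrightarrow> 0"
    proof (rule tendsto_sandwich[OF _ _ tendsto_const z], goal_cases)
      case 1
      show ?case by (intro always_eventually allI integral_nonneg_AE AE_I2) simp
    next
      case 2
      show ?case by (intro always_eventually allI less_imp_le a)
    qed
    from tendsto_real_sqrt[OF this] show "(\<lambda>n. L2_norm_on U (\<lambda>x. \<phi> n x - v x)) \<longlonglongrightarrow> 0" by (simp add: L2_norm_on_def)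
    have "(\<lambda>n. LINT x|?M. (norm (grad (\<phi> n) x - ?G x))\<^sup>2) \<longlonglongrightarrow> 0"
    proof (rule tendsto_sandwich[OF _ _ tendsto_const z], goal_cases)
      case 1
      show ?case by (intro always_eventually allI integral_nonneg_AE AE_I2) simp
    next
      case 2
      show ?case by (intro always_eventually allI less_imp_le b)
    qed
    from tendsto_real_sqrt[OF this] show "(\<lambda>n. L2_norm_on U (\<lambda>x. grad (\<phi> n) x - ?G x)) \<longlonglongrightarrow> 0" by (simp add: L2_norm_on_def)
  qed
  moreover have "(\<lambda>n. L2_norm_bdry K (\<lambda>x. \<phi> n x - w x)) \<longlonglongrightarrow> 0"
  proof -
    obtain g1 g2 g3 where g: "edge_paths K = [g1, g2, g3]" by (rule edge_paths_three)
    have "(\<lambda>n. edge_L2sq g1 (\<lambda>x. \<phi> n x - w x) + (edge_L2sq g2 (\<lambda>x. \<phi> n x - w x) + edge_L2sq g3 (\<lambda>x. \<phi> n x - w x))) \<longlonglongrightarrow> 0 + (0 + 0)"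
      by (intro tendsto_add lim(3)) (simp_all add: g)
    from tendsto_real_sqrt[OF this] show ?thesis
      by (simp add: L2_norm_bdry_def g edge_L2sq_def)
  qed
  ultimately show ?thesis unfolding has_trace_def using sm
    by (intro exI[of _ w] conjI exI[of _ \<phi>] allI)
qed

text \<open>The smooth inequality is applied along an approximating sequence and passed to the
  limit. The constant 36 is 3 for the edges, 3 from the smooth case, 2 for passing from w to the
  approximant and 2 for passing from the approximant to v.\<close>

lemma trace_bound:
  assumes v: "v \<in> H1_on U" and w: "has_trace K v w"
  shows "(L2_norm_bdry K w)\<^sup>2 \<le> 36 * C * (inverse h * (L2_norm_on U v)\<^sup>2 + h * (H1_seminorm_on U v)\<^sup>2)"
proof -
  let ?M = "lebesgue_on U" and ?G = "weak_grad U v"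
  note wg = weak_grad[OF v]
  have vm: "v \<in> borel_measurable ?M" "integrable ?M (\<lambda>x. (norm (v x))\<^sup>2)"
    and Gm: "?G \<in> borel_measurable ?M" "integrable ?M (\<lambda>x. (norm (?G x))\<^sup>2)"
    using wg(1,2) by (simp_all add: L2_on_def)
  from w obtain \<phi> where wb: "L2_bdry K w" and sm: "\<And>n. smooth (\<phi> n)"
    and l1: "(\<lambda>n. L2_norm_on U (\<lambda>x. \<phi> n x - v x)) \<longlonglongrightarrow> 0"
    and l2: "(\<lambda>n. L2_norm_on U (\<lambda>x. grad (\<phi> n) x - ?G x)) \<longlonglongrightarrow> 0"
    and l3: "(\<lambda>n. L2_norm_bdry K (\<lambda>x. \<phi> n x - w x)) \<longlonglongrightarrow> 0"
    unfolding has_trace_def by (elim conjE exE) (rule that, simp_all)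
  define a where "a n = (L2_norm_on U (\<lambda>x. \<phi> n x - v x))\<^sup>2" for n
  define b where "b n = (L2_norm_on U (\<lambda>x. grad (\<phi> n) x - ?G x))\<^sup>2" for n
  define c where "c n = (L2_norm_bdry K (\<lambda>x. \<phi> n x - w x))\<^sup>2" for n
  define A where "A = (L2_norm_on U v)\<^sup>2"
  define B where "B = (H1_seminorm_on U v)\<^sup>2"
  obtain g1 g2 g3 where g: "edge_paths K = [g1, g2, g3]" by (rule edge_paths_three)
  have step: "(L2_norm_bdry K w)\<^sup>2 \<le> 2 * c n + 18 * C * (inverse h * (2 * a n + 2 * A) + h * (2 * b n + 2 * B))" for n
  proof -
    note s0 = smooth_square_integrable[OF sm[of n]]
    have A: "(LINT x|?M. (\<phi> n x)\<^sup>2) \<le> 2 * a n + 2 * A"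
      using integral_norm_square_le[OF s0(1) vm(1) s0(3) vm(2)] by (simp add: a_def A_def L2_norm_on_sq)
    have B: "(LINT x|?M. (norm (grad (\<phi> n) x))\<^sup>2) \<le> 2 * b n + 2 * B"
      using integral_norm_square_le[OF s0(2) Gm(1) s0(4) Gm(2)]
      by (simp add: b_def B_def H1_seminorm_on_def L2_norm_on_sq)
    have e: "edge_L2sq \<gamma> w \<le> 2 * edge_L2sq \<gamma> (\<lambda>x. \<phi> n x - w x)
        + 2 * (3 * C * (inverse h * (2 * a n + 2 * A) + h * (2 * b n + 2 * B)))" if \<gamma>: "\<gamma> \<in> set (edge_paths K)" for \<gamma>
    proof -
      have "edge_L2sq \<gamma> w \<le> 2 * edge_L2sq \<gamma> (\<lambda>x. \<phi> n x - w x) + 2 * edge_L2sq \<gamma> (\<phi> n)"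
        using wb \<gamma> by (intro edge_L2sq_le[OF visible[OF \<gamma>] smooth_continuous[OF sm]]) (auto simp: L2_bdry_def)
      also have "edge_L2sq \<gamma> (\<phi> n) \<le> 3 * C * (inverse h * (2 * a n + 2 * A) + h * (2 * b n + 2 * B))"
        by (rule order_trans[OF edge_trace_smooth[OF sm \<gamma>]])
          (use C_pos h A B in \<open>intro mult_left_mono add_mono; simp\<close>)
      finally show ?thesis by simp
    qed
    have c: "c n = edge_L2sq g1 (\<lambda>x. \<phi> n x - w x) + edge_L2sq g2 (\<lambda>x. \<phi> n x - w x) + edge_L2sq g3 (\<lambda>x. \<phi> n x - w x)"
      and wsum: "(L2_norm_bdry K w)\<^sup>2 = edge_L2sq g1 w + edge_L2sq g2 w + edge_L2sq g3 w"
      by (simp_all add: c_def L2_norm_bdry_sq g)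
    define X where "X = 3 * C * (inverse h * (2 * a n + 2 * A) + h * (2 * b n + 2 * B))"
    have "edge_L2sq g1 w + edge_L2sq g2 w + edge_L2sq g3 w \<le> 2 * c n + 6 * X"
      using e[of g1] e[of g2] e[of g3] unfolding c X_def[symmetric] by (simp add: g)
    then show ?thesis unfolding wsum by (simp add: X_def algebra_simps)
  qed
  have lim: "a \<longlonglongrightarrow> 0" "b \<longlonglongrightarrow> 0" "c \<longlonglongrightarrow> 0"
    using tendsto_power[OF l1, of 2] tendsto_power[OF l2, of 2] tendsto_power[OF l3, of 2]
    by (simp_all add: a_def[abs_def] b_def[abs_def] c_def[abs_def])
  have "(\<lambda>n. 2 * c n + 18 * C * (inverse h * (2 * a n + 2 * A) + h * (2 * b n + 2 * B)))
      \<longlonglongrightarrow> 2 * 0 + 18 * C * (inverse h * (2 * 0 + 2 * A) + h * (2 * 0 + 2 * B))"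
    by (intro tendsto_intros lim)
  then have "(L2_norm_bdry K w)\<^sup>2 \<le> 2 * 0 + 18 * C * (inverse h * (2 * 0 + 2 * A) + h * (2 * 0 + 2 * B))"
    by (rule LIMSEQ_le_const) (use step in simp)
  then show ?thesis by (simp add: A_def B_def algebra_simps)
qed

end

theorem theorem3p3:
  fixes m :: nat
    and \<Omega> \<Omega>m \<Omega>p :: "point set"
    and \<Gamma>b \<Gamma>i :: curve
    and \<epsilon>0 :: real
    and \<T> :: "element set set"
  assumes "m \<ge> 1"
    and "interface_geometry (m + 2) \<Omega> \<Omega>m \<Omega>p \<Gamma>b \<Gamma>i \<epsilon>0"
    and "quasi_uniform_curved_family \<Omega> \<Gamma>b \<Gamma>i \<epsilon>0 \<T>"
  shows "\<exists>h0>0. \<exists>C. \<forall>T\<in>\<T>. h_mesh T \<le> h0 \<longrightarrow>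
           (\<forall>K\<in>T. \<forall>v\<in>H1_on (elem_int K).
              (\<exists>w. has_trace K v w) \<and>
              (L2_norm_bdry K (trace_of K v))\<^sup>2
                \<le> C * (inverse (h_el K) * (L2_norm_on (elem_int K) v)\<^sup>2
                       + h_el K * (H1_seminorm_on (elem_int K) v)\<^sup>2))"
proof -
  \<comment> \<open>Writing m + 2 as a successor is the form in which the curve lemmas extract a
    continuous derivative.\<close>
  have geo: "interface_geometry (Suc (m + 1)) \<Omega> \<Omega>m \<Omega>p \<Gamma>b \<Gamma>i \<epsilon>0" using assms(2) by simp
  obtain h0 C where h0: "0 < h0" and elts:
    "\<And>T K. T \<in> \<T> \<Longrightarrow> h_mesh T \<le> h0 \<Longrightarrow> K \<in> T \<Longrightarrow>
       is_element K \<and> (\<exists>x0 r s \<kappa>. star_element K x0 r s \<kappa> \<and> \<kappa> * h_el K \<le> C)"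
    by (rule mesh_elements_star[OF geo assms(3)]) (rule that)
  show ?thesis
  proof (rule exI[of _ h0], rule conjI[OF h0], rule exI[of _ "36 * C"], intro ballI impI)
    fix T K v assume T: "T \<in> \<T>" "h_mesh T \<le> h0" "K \<in> T" and v: "v \<in> H1_on (elem_int K)"
    from elts[OF T] obtain x0 r s \<kappa> where "is_element K" "star_element K x0 r s \<kappa>" "\<kappa> * h_el K \<le> C"
      by (elim conjE exE)
    then interpret star_shaped_element K x0 r s \<kappa> C by (rule star_shaped_element.intro)
    have ex: "\<exists>w. has_trace K v w" by (rule trace_exists[OF v])
    have "has_trace K v (trace_of K v)" unfolding trace_of_def by (rule someI_ex[OF ex])
    from ex trace_bound[OF v this] show "(\<exists>w. has_trace K v w) \<and> (L2_norm_bdry K (trace_of K v))\<^sup>2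
        \<le> 36 * C * (inverse (h_el K) * (L2_norm_on (elem_int K) v)\<^sup>2 + h_el K * (H1_seminorm_on (elem_int K) v)\<^sup>2)"
      by (rule conjI)
  qed
qed

end
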